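(* Let $r, m, p$ be positive integers. The manifold $\mathcal{M}$ of stable rational $p \times m$ functions of McMillan degree $r$ is an embedded submanifold of the Hardy space $\mathcal{H}_2 = \mathcal{H}_2^{p \times m}(\mathbb{C}^+)$. Likewise, the manifold $\mathcal{M}_{\mathbb{R}}$ of real stable rational $p \times m$ functions of McMillan degree $r$ is an embedded submanifold of the real Hilbert space $\mathcal{H}_{2,\mathbb{R}}$ of real transfer functions.
   Context: $\mathbb{C}^+$ is the open right half-plane. $\mathcal{H}_2=\mathcal{H}_2^{p\times m}(\mathbb{C}^+)$ is the Hilbert space of analytic functions $F:\mathbb{C}^+\to\mathbb{C}^{p\times m}$ with $\sup_{\xi>0}\int_{-\infty}^{\infty}\|F(\xi+\mathrm{i}\omega)\|_{\mathrm{F}}^2\,d\omega<\infty$, with inner product $\langle F,G\rangle_{\mathcal{H}_2}=\frac{1}{2\pi}\int_{-\infty}^{\infty}\operatorname{tr}(F(\mathrm{i}\omega)^*G(\mathrm{i}\omega))\,d\omega$ (using boundary extensions to the imaginary axis). $\mathcal{H}_{2,\mathbb{R}}=\{H\in\mathcal{H}_2:\overline{H(s)}=H(\overline{s})\ \forall s\in\mathbb{C}^+\}$, a real Hilbert space. A square matrix is Hurwitz if all its eigenvalues have negative real part. A triple $(\hat A,\hat B,\hat C)$ is minimal if it is a realization of least possible order of its transfer function $\hat C(sI-\hat A)^{-1}\hat B$. Let $\mathcal{S}$ be the (open) set of triples $(\hat A,\hat B,\hat C)\in\mathbb{C}^{r\times r}\times\mathbb{C}^{r\times m}\times\mathbb{C}^{p\times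 r}$ that are minimal with $\hat A$ Hurwitz, and $$\mathcal{M}=\{\hat C(sI-\hat A)^{-1}\hat B : (\hat A,\hat B,\hat C)\in\mathcal{S}\}\subset\mathcal{H}_2 .$$ $\mathcal{M}_{\mathbb{R}}\subset\mathcal{H}_{2,\mathbb{R}}$ is defined in the same way with real matrices. $\mathcal{M}$ (resp. $\mathcal{M}_{\mathbb{R}}$) carries the Hazewinkel–Kalman manifold structure of the quotient of $\mathcal{S}$ (resp. its real version) by state-space equivalence $(\hat A,\hat B,\hat C)\sim(T\hat AT^{-1},T\hat B,\hat CT^{-1})$, $T$ invertible; it has complex (resp. real) dimension $r(m+p)$, and the map $(\hat A,\hat B,\hat C)\mapsto\hat C(sI-\hat A)^{-1}\hat B$ from $\mathcal{S}$ to $\mathcal{M}$ is the quotient map. Smooth means infinitely differentiable. A smooth immersion is a smooth map whose differential at each point is injective with closed image. A smooth embedding is a smooth immersion that is a homeomorphism onto its image. An embedded submanifold of a manifold $\overline{\mathcal{N}}$ is a subset $\mathcal{N}\subseteq\overline{\mathcal{N}}$ that is a manifold in the subspace topology, endowed with a smooth structure for which the inclusion $\mathcal{N}\hookrightarrow\overline{\mathcal{N}}$ is a smooth embedding. Manifolds may be modeled on (possibly infinite-dimensional) Banach spaces; $\mathcal{H}_2$ is a manifold with the identity chart. *)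

theory Defs
  imports "HOL-Complex_Analysis.Cauchy_Integral_Theorem"
begin

section \<open>Boundary values in the Hardy space\<close>

text \<open>The lemmas up to the type of Hardy functions show that a scalar $H_2$ function on the right
half-plane has an $L_2$ boundary function, and that its $L_2$ norms on vertical lines increase
towards the boundary. They are needed to make the boundary inner product an instance of
\<^class>\<open>real_inner\<close>.\<close>

lemma L2_fast_Cauchy_AE_convergent:
  fixes u :: "nat \<Rightarrow> 'a \<Rightarrow> 'b::{banach, second_countable_topology}"
  assumes meas [measurable]: "\<And>n. u n \<in> borel_measurable M"
    and fast: "\<And>n. (\<integral>\<^sup>+x. ennreal ((norm (u (Suc n) x - u n x))\<^sup>2) \<partial>M) \<le> ennreal ((1/4)^n)"
  shows "\<exists>b\<in>borel_measurable M. AE x in M. (\<lambda>n. u n x) \<longlonglongrightarrow> b x"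
proof -
  define d where "d = (\<lambda>n x. (norm (u (Suc n) x - u n x))\<^sup>2)"
  have [measurable]: "d n \<in> borel_measurable M" for n
    unfolding d_def by measurable
  have "(\<integral>\<^sup>+x. (\<Sum>n. ennreal (2^n * d n x)) \<partial>M) = (\<Sum>n. \<integral>\<^sup>+x. ennreal (2^n * d n x) \<partial>M)"
    by (rule nn_integral_suminf) measurable
  also have "\<dots> \<le> (\<Sum>n. ennreal ((1/2)^n))"
  proof (rule suminf_le)
    fix n
    have "(\<integral>\<^sup>+x. ennreal (2^n * d n x) \<partial>M) = ennreal (2^n) * (\<integral>\<^sup>+x. ennreal (d n x) \<partial>M)"
      by (subst nn_integral_cmult [symmetric]) (auto simp: ennreal_mult' d_def)
    also have "\<dots> \<le> ennreal (2^n) * ennreal ((1/4)^n)"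
      by (rule mult_left_mono) (use fast in \<open>auto simp: d_def\<close>)
    also have "\<dots> = ennreal ((1/2)^n)"
      by (simp flip: ennreal_mult power_mult_distrib)
    finally show "(\<integral>\<^sup>+x. ennreal (2^n * d n x) \<partial>M) \<le> ennreal ((1/2)^n)" .
  qed auto
  also have "\<dots> = ennreal (\<Sum>n. (1/2)^n)"
    by (rule suminf_ennreal2) auto
  also have "\<dots> < \<infinity>" by simp
  finally have "AE x in M. (\<Sum>n. ennreal (2^n * d n x)) \<noteq> \<infinity>"
    by (intro nn_integral_PInf_AE) auto
  hence "AE x in M. (\<lambda>n. u n x) \<longlonglongrightarrow> lim (\<lambda>n. u n x)"
  proof eventually_elim
    case (elim x)
    then obtain C where C: "C \<ge> 0" "(\<Sum>n. ennreal (2^n * d n x)) = ennreal C"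
      by (metis ennreal_cases infinity_ennreal_def)
    have le: "2^n * d n x \<le> C" for n
    proof -
      have "ennreal (2^n * d n x) \<le> (\<Sum>n. ennreal (2^n * d n x))"
        using sum_le_suminf[of "\<lambda>n. ennreal (2^n * d n x)" "{n}"] by simp
      thus ?thesis using C by simp
    qed
    have nle: "norm (u (Suc n) x - u n x) \<le> sqrt C * (sqrt (1/2))^n" for n
    proof -
      have "d n x \<le> C * (1/2)^n"
        using le[of n] by (simp add: field_simps power_one_over)
      hence "sqrt (d n x) \<le> sqrt (C * (1/2)^n)" by (rule real_sqrt_le_mono)
      thus ?thesis by (simp add: d_def real_sqrt_mult real_sqrt_power)
    qed
    have "summable (\<lambda>n. sqrt C * (sqrt (1/2))^n)"
      by (intro summable_mult summable_geometric) (simp add: real_sqrt_lt_1_iff)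
    hence "summable (\<lambda>n. u (Suc n) x - u n x)"
      by (rule summable_comparison_test'[where N=0]) (use nle in auto)
    then have "(\<lambda>n. \<Sum>k<n. u (Suc k) x - u k x) \<longlonglongrightarrow> (\<Sum>k. u (Suc k) x - u k x)"
      by (rule summable_LIMSEQ)
    hence "(\<lambda>n. u n x - u 0 x) \<longlonglongrightarrow> (\<Sum>k. u (Suc k) x - u k x)"
      by (simp add: sum_lessThan_telescope[of "\<lambda>n. u n x"])
    hence "(\<lambda>n. u n x - u 0 x + u 0 x) \<longlonglongrightarrow> (\<Sum>k. u (Suc k) x - u k x) + u 0 x"
      by (intro tendsto_intros)
    hence "convergent (\<lambda>n. u n x)" by (auto simp: convergent_def)
    thus ?case by (simp add: convergent_LIMSEQ_iff)
  qed
  moreover have "(\<lambda>x. lim (\<lambda>n. u n x)) \<in> borel_measurable M"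
    by (rule borel_measurable_lim_metric) measurable
  ultimately show ?thesis by (intro bexI[of _ "\<lambda>x. lim (\<lambda>n. u n x)"])
qed

lemma L2_Cauchy_at_right_convergent:
  fixes f :: "real \<Rightarrow> 'a \<Rightarrow> 'b::{banach, second_countable_topology}"
  assumes meas: "\<And>x. x > 0 \<Longrightarrow> f x \<in> borel_measurable M"
    and cauchy: "\<And>e. e > 0 \<Longrightarrow> \<exists>\<delta>>0. \<forall>x y. 0 < x \<longrightarrow> x < \<delta> \<longrightarrow> 0 < y \<longrightarrow> y < \<delta> \<longrightarrow>
          (\<integral>\<^sup>+w. ennreal ((norm (f x w - f y w))\<^sup>2) \<partial>M) \<le> ennreal e"
  shows "\<exists>b\<in>borel_measurable M.
           ((\<lambda>x. \<integral>\<^sup>+w. ennreal ((norm (f x w - b w))\<^sup>2) \<partial>M) \<longlongrightarrow> 0) (at_right 0)"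
proof -
  have "\<exists>\<delta>. \<forall>n. \<delta> n > 0 \<and> (\<forall>x y. 0 < x \<longrightarrow> x < \<delta> n \<longrightarrow> 0 < y \<longrightarrow> y < \<delta> n \<longrightarrow>
          (\<integral>\<^sup>+w. ennreal ((norm (f x w - f y w))\<^sup>2) \<partial>M) \<le> ennreal ((1/4)^n))"
    by (rule choice) (use cauchy in simp)
  then obtain \<delta> where \<delta>: "\<And>n. \<delta> n > 0"
    "\<And>n x y. 0 < x \<Longrightarrow> x < \<delta> n \<Longrightarrow> 0 < y \<Longrightarrow> y < \<delta> n \<Longrightarrow>
          (\<integral>\<^sup>+w. ennreal ((norm (f x w - f y w))\<^sup>2) \<partial>M) \<le> ennreal ((1/4)^n)"
    by blast
  define \<xi> where "\<xi> = (\<lambda>n::nat. Min (\<delta> ` {..n}) / 2)"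
  have \<xi>0: "\<xi> n > 0" for n unfolding \<xi>_def using \<delta> by (auto simp: Min_gr_iff)
  have \<xi>lt: "\<xi> n < \<delta> k" if "k \<le> n" for n k
  proof -
    have "Min (\<delta> ` {..n}) \<le> \<delta> k" using that by (intro Min_le) auto
    thus ?thesis using \<delta>(1)[of k] \<xi>0[of n] unfolding \<xi>_def by linarith
  qed
  have [measurable]: "f (\<xi> n) \<in> borel_measurable M" for n using meas \<xi>0 by auto
  have "\<exists>b\<in>borel_measurable M. AE w in M. (\<lambda>n. f (\<xi> n) w) \<longlonglongrightarrow> b w"
    by (rule L2_fast_Cauchy_AE_convergent) (use \<delta> \<xi>0 \<xi>lt in auto)
  then obtain b where b [measurable]: "b \<in> borel_measurable M"
    and bl: "AE w in M. (\<lambda>n. f (\<xi> n) w) \<longlonglongrightarrow> b w" by blast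
  have key: "(\<integral>\<^sup>+w. ennreal ((norm (f x w - b w))\<^sup>2) \<partial>M) \<le> ennreal ((1/4)^k)"
    if x: "0 < x" "x < \<delta> k" for x k
  proof -
    have [measurable]: "f x \<in> borel_measurable M" using meas x by auto
    have "(\<integral>\<^sup>+w. ennreal ((norm (f x w - b w))\<^sup>2) \<partial>M)
        = (\<integral>\<^sup>+w. liminf (\<lambda>n. ennreal ((norm (f x w - f (\<xi> n) w))\<^sup>2)) \<partial>M)"
    proof (rule nn_integral_cong_AE, use bl in eventually_elim)
      case (elim w)
      have "(\<lambda>n. ennreal ((norm (f x w - f (\<xi> n) w))\<^sup>2)) \<longlonglongrightarrow> ennreal ((norm (f x w - b w))\<^sup>2)"
        by (intro tendsto_intros elim)
      from lim_imp_Liminf[OF _ this] show ?case by simp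
    qed
    also have "\<dots> \<le> liminf (\<lambda>n. \<integral>\<^sup>+w. ennreal ((norm (f x w - f (\<xi> n) w))\<^sup>2) \<partial>M)"
      by (rule nn_integral_liminf) measurable
    also have "\<dots> \<le> limsup (\<lambda>n. \<integral>\<^sup>+w. ennreal ((norm (f x w - f (\<xi> n) w))\<^sup>2) \<partial>M)"
      by (rule Liminf_le_Limsup) auto
    also have "\<dots> \<le> ennreal ((1/4)^k)"
      by (rule Limsup_bounded, rule eventually_sequentiallyI[of k]) (use \<delta> \<xi>0 \<xi>lt x in auto)
    finally show ?thesis .
  qed
  have "((\<lambda>x. \<integral>\<^sup>+w. ennreal ((norm (f x w - b w))\<^sup>2) \<partial>M) \<longlongrightarrow> 0) (at_right 0)"
  proof (rule order_tendstoI)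
    fix a :: ennreal assume "0 < a"
    have "(\<lambda>k. ennreal ((1/4)^k)) \<longlonglongrightarrow> ennreal 0"
      by (intro tendsto_ennrealI LIMSEQ_power_zero) auto
    with \<open>0 < a\<close> have "eventually (\<lambda>k. ennreal ((1/4)^k) < a) sequentially"
      by (auto dest: order_tendstoD)
    then obtain k where k: "ennreal ((1/4)^k) < a" by (auto simp: eventually_sequentially)
    show "\<forall>\<^sub>F x in at_right 0. (\<integral>\<^sup>+w. ennreal ((norm (f x w - b w))\<^sup>2) \<partial>M) < a"
      unfolding eventually_at_right_field
      using key[of _ k] k \<delta>(1)[of k] by (meson le_less_trans)
  qed auto
  with b show ?thesis by blast
qed

lemma midpoint_convex_bounded_antimono:
  fixes \<phi> :: "real \<Rightarrow> real"
  assumes mid: "\<And>x y. x > 0 \<Longrightarrow> y > 0 \<Longrightarrow> 2 * \<phi> ((x + y) / 2) \<le> \<phi> x + \<phi> y"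
    and bdd: "\<And>x. x > 0 \<Longrightarrow> \<phi> x \<le> K"
    and ab: "0 < a" "a \<le> b"
  shows "\<phi> b \<le> \<phi> a"
proof (rule ccontr)
  assume "\<not> \<phi> b \<le> \<phi> a"
  define d c where "d = b - a" and "c = \<phi> b - \<phi> a"
  have c: "c > 0" using \<open>\<not> \<phi> b \<le> \<phi> a\<close> by (simp add: c_def)
  have d: "d \<ge> 0" using ab by (simp add: d_def)
  have step: "\<phi> (a + real (Suc n) * d) - \<phi> (a + real n * d) \<ge> c" for n
  proof (induction n)
    case 0 thus ?case by (simp add: c_def d_def)
  next
    case (Suc n)
    have "2 * \<phi> (((a + real n * d) + (a + real (Suc (Suc n)) * d)) / 2)
        \<le> \<phi> (a + real n * d) + \<phi> (a + real (Suc (Suc n)) * d)"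
      by (rule mid) (use ab d in \<open>auto intro!: add_pos_nonneg\<close>)
    also have "((a + real n * d) + (a + real (Suc (Suc n)) * d)) / 2 = a + real (Suc n) * d"
      by (simp add: field_simps)
    finally show ?case using Suc by linarith
  qed
  have lin: "\<phi> (a + real n * d) \<ge> \<phi> a + real n * c" for n
  proof (induction n)
    case (Suc n)
    show ?case using step[of n] Suc by (simp add: algebra_simps)
  qed simp
  obtain n :: nat where "real n * c > K - \<phi> a" using reals_Archimedean3[OF c] by blast
  moreover have "\<phi> (a + real n * d) \<le> K"
    by (rule bdd) (use ab d in \<open>auto intro!: add_pos_nonneg\<close>)
  ultimately show False using lin[of n] by linarith
qed

lemma vertical_line_integral_shift:
  fixes g :: "complex \<Rightarrow> complex"
  assumes hol: "g holomorphic_on {s. \<alpha> < Re s \<and> Re s < \<beta>}"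
    and ab: "\<alpha> < a" "a \<le> b" "b < \<beta>"
    and bdd: "\<And>x. a \<le> x \<Longrightarrow> x \<le> b \<Longrightarrow> (\<integral>\<^sup>+t. ennreal (norm (g (Complex x t))) \<partial>lborel) \<le> ennreal K"
  shows "(LINT t|lborel. g (Complex a t)) = (LINT t|lborel. g (Complex b t))"
proof -
  define S where "S = {s. \<alpha> < Re s \<and> Re s < \<beta>}"
  have S: "convex S" "open S"
    unfolding S_def Collect_conj_eq
    by (auto intro!: convex_Int open_Int convex_halfspace_Re_gt convex_halfspace_Re_lt
        open_halfspace_Re_gt open_halfspace_Re_lt)
  obtain P where P: "\<And>s. s \<in> S \<Longrightarrow> (P has_field_derivative g s) (at s within S)"
    using holomorphic_convex_primitive'[OF S hol[folded S_def]] by blast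
  have P': "(P has_field_derivative g s) (at s)" if "s \<in> S" for s
    using P[OF that] at_within_open[OF that S(2)] by simp
  have contg: "continuous_on S g"
    using hol holomorphic_on_imp_continuous_on by (auto simp: S_def)
  have inS: "Complex x t \<in> S" if "a \<le> x" "x \<le> b" for x t
    using that ab by (auto simp: S_def)
  have contC: "continuous_on A (\<lambda>p. Complex (u p) (v p))"
    if "continuous_on A u" "continuous_on A v" for u v :: "'z::topological_space \<Rightarrow> real" and A
    unfolding Complex_eq by (intro continuous_intros that)
  have contv: "continuous_on UNIV (\<lambda>t. g (Complex x t))" if "a \<le> x" "x \<le> b" for x
    by (rule continuous_on_compose2[OF contg contC]) (use inS that in \<open>auto intro!: continuous_intros\<close>)
  have conth: "continuous_on {a..b} (\<lambda>x. g (Complex x t))" for t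
    by (rule continuous_on_compose2[OF contg contC]) (use inS in \<open>auto intro!: continuous_intros\<close>)
  have meas [measurable]: "(\<lambda>t. g (Complex x t)) \<in> borel_measurable borel" if "a \<le> x" "x \<le> b" for x
    using contv[OF that] by (rule borel_measurable_continuous_onI)
  have int: "integrable lborel (\<lambda>t. g (Complex x t))" if "a \<le> x" "x \<le> b" for x
    unfolding integrable_iff_bounded using bdd[OF that] meas[OF that]
    by (auto intro: le_less_trans)
  define I where "I = (\<lambda>x T. LINT t|lborel. indicator {-T..T} t *\<^sub>R g (Complex x t))"
  have I_lim: "((\<lambda>T. I x T) \<longlongrightarrow> (LINT t|lborel. g (Complex x t))) at_top" if "a \<le> x" "x \<le> b" for x
    unfolding I_def
  proof (rule integral_dominated_convergence_at_top)
    show "(\<lambda>t. g (Complex x t)) \<in> borel_measurable lborel" using meas[OF that] by simp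
    show "(\<lambda>t. indicator {-T..T} t *\<^sub>R g (Complex x t)) \<in> borel_measurable lborel" for T
      using meas[OF that] by simp
    show "integrable lborel (\<lambda>t. norm (g (Complex x t)))" using int[OF that] by simp
    show "\<forall>\<^sub>F T in at_top. AE t in lborel. norm (indicator {-T..T} t *\<^sub>R g (Complex x t)) \<le> norm (g (Complex x t))"
      by (intro always_eventually allI AE_I2) (auto simp: indicator_def)
    show "AE t in lborel. ((\<lambda>T. indicator {-T..T} t *\<^sub>R g (Complex x t)) \<longlongrightarrow> g (Complex x t)) at_top"
    proof (intro AE_I2)
      fix t :: real
      have "\<forall>\<^sub>F T in at_top. indicator {-T..T} t *\<^sub>R g (Complex x t) = g (Complex x t)"
        using eventually_ge_at_top[of "\<bar>t\<bar>"] by eventually_elim (auto simp: indicator_def)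
      thus "((\<lambda>T. indicator {-T..T} t *\<^sub>R g (Complex x t)) \<longlongrightarrow> g (Complex x t)) at_top"
        by (rule tendsto_eventually)
    qed
  qed
  have I_P: "\<i> * I x T = P (Complex x T) - P (Complex x (-T))" if x: "a \<le> x" "x \<le> b" and T: "T \<ge> 0" for x T
  proof -
    have "(LINT t|lborel. indicator {-T..T} t *\<^sub>R (g (Complex x t) * \<i>))
        = P (Complex x T) - P (Complex x (-T))"
    proof (rule integral_FTC_atLeastAtMost[of "-T" T "\<lambda>t. P (Complex x t)"])
      show "((\<lambda>t. P (Complex x t)) has_vector_derivative g (Complex x t) * \<i>) (at t within {-T..T})" for t
      proof -
        have "((\<lambda>t. Complex x t) has_vector_derivative \<i>) (at t within {-T..T})"
          unfolding Complex_eq by (auto intro!: derivative_eq_intros)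
        from field_vector_diff_chain_within[OF this, of P "g (Complex x t)"]
          show ?thesis using has_field_derivative_at_within[OF P'[OF inS[OF x]], of t]
          by (auto simp: o_def mult.commute)
      qed
      show "continuous_on {-T..T} (\<lambda>t. g (Complex x t) * \<i>)"
        by (intro continuous_intros continuous_on_subset[OF contv[OF x]]) auto
    qed (use T in auto)
    thus ?thesis
      unfolding I_def by (simp flip: integral_mult_right_zero add: mult_ac)
  qed
  define h where "h = (\<lambda>t. \<integral>\<^sup>+x. ennreal (norm (indicator {a..b} x *\<^sub>R g (Complex x t))) \<partial>lborel)"
  have P_h: "ennreal (norm (P (Complex b t) - P (Complex a t))) \<le> h t" for t
  proof -
    have "(LINT x|lborel. indicator {a..b} x *\<^sub>R g (Complex x t))
        = P (Complex b t) - P (Complex a t)"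
    proof (rule integral_FTC_atLeastAtMost[of a b "\<lambda>x. P (Complex x t)"])
      show "((\<lambda>x. P (Complex x t)) has_vector_derivative g (Complex x t)) (at x within {a..b})"
        if "a \<le> x" "x \<le> b" for x
      proof -
        have "((\<lambda>x. Complex x t) has_vector_derivative 1) (at x within {a..b})"
          unfolding Complex_eq has_vector_derivative_def by (auto intro!: derivative_eq_intros simp: scaleR_conv_of_real)
        from field_vector_diff_chain_within[OF this, of P "g (Complex x t)"]
          show ?thesis using has_field_derivative_at_within[OF P'[OF inS[OF that]], of t]
          by (auto simp: o_def)
      qed
    qed (use conth ab in auto)
    moreover have "integrable lborel (\<lambda>x. indicator {a..b} x *\<^sub>R g (Complex x t))"
      using borel_integrable_compact[OF _ conth] by simp
    ultimately show ?thesis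
      unfolding h_def using integral_norm_bound_ennreal by metis
  qed
  have contp: "continuous_on ({a..b} \<times> UNIV) (\<lambda>p. g (Complex (fst p) (snd p)))"
    by (rule continuous_on_compose2[OF contg contC])
       (use inS in \<open>auto intro!: continuous_intros\<close>)
  have "(\<lambda>p. indicator ({a..b} \<times> (UNIV::real set)) p *\<^sub>R g (Complex (fst p) (snd p))) \<in> borel_measurable borel"
    by (rule borel_measurable_continuous_on_indicator[OF _ contp]) (auto intro!: borel_closed closed_Times)
  hence [measurable]: "(\<lambda>p. indicator {a..b} (fst p) *\<^sub>R g (Complex (fst p) (snd p))) \<in> borel_measurable (lborel \<Otimes>\<^sub>M lborel)"
    by (simp add: indicator_times lborel_prod)
  have "(\<lambda>p. ennreal (norm (indicator {a..b} (fst p) *\<^sub>R g (Complex (fst p) (snd p))))) \<in> borel_measurable (lborel \<Otimes>\<^sub>M lborel)"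
    by measurable
  hence [measurable]: "(\<lambda>(x,t). ennreal (norm (indicator {a..b} x *\<^sub>R g (Complex x t)))) \<in> borel_measurable (lborel \<Otimes>\<^sub>M lborel)"
    unfolding case_prod_beta .
  have mh [measurable]: "h \<in> borel_measurable borel"
    unfolding h_def
    using lborel.borel_measurable_nn_integral_fst
    by measurable
  have "(\<integral>\<^sup>+t. h t \<partial>lborel)
      = (\<integral>\<^sup>+x. \<integral>\<^sup>+t. ennreal (norm (indicator {a..b} x *\<^sub>R g (Complex x t))) \<partial>lborel \<partial>lborel)"
    unfolding h_def by (rule lborel_pair.Fubini') measurable
  also have "\<dots> \<le> (\<integral>\<^sup>+x. ennreal K * indicator {a..b} x \<partial>lborel)"
    by (rule nn_integral_mono) (use bdd in \<open>auto simp: indicator_def\<close>)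
  also have "\<dots> < \<infinity>"
    using ab by (simp add: nn_integral_cmult_indicator ennreal_mult_less_top)
  finally have hfin: "(\<integral>\<^sup>+t. h t \<partial>lborel) < \<infinity>" .
  have hrefl: "(\<integral>\<^sup>+t. h (-t) \<partial>lborel) = (\<integral>\<^sup>+t. h t \<partial>lborel)"
    using nn_integral_real_affine[of h "-1" 0] by simp
  define \<Delta> where "\<Delta> = (\<lambda>T. norm (I b T - I a T))"
  define c where "c = norm ((LINT t|lborel. g (Complex b t)) - (LINT t|lborel. g (Complex a t)))"
  have \<Delta>_lim: "(\<Delta> \<longlongrightarrow> c) at_top"
    unfolding \<Delta>_def c_def by (intro tendsto_intros I_lim) (use ab in auto)
  have \<Delta>_h: "ennreal (\<Delta> T) \<le> h T + h (-T)" if "T \<ge> 0" for T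
  proof -
    have "\<i> * (I b T - I a T) = (P (Complex b T) - P (Complex a T)) - (P (Complex b (-T)) - P (Complex a (-T)))"
      using I_P[of b T] I_P[of a T] ab that by (simp add: algebra_simps)
    hence "\<Delta> T = norm ((P (Complex b T) - P (Complex a T)) - (P (Complex b (-T)) - P (Complex a (-T))))"
      unfolding \<Delta>_def by (metis norm_ii norm_mult mult_1)
    also have "\<dots> \<le> norm (P (Complex b T) - P (Complex a T)) + norm (P (Complex b (-T)) - P (Complex a (-T)))"
      by (rule norm_triangle_ineq4)
    finally have "ennreal (\<Delta> T) \<le> ennreal (norm (P (Complex b T) - P (Complex a T))) + ennreal (norm (P (Complex b (-T)) - P (Complex a (-T))))"
      by (simp flip: ennreal_plus)
    also have "\<dots> \<le> h T + h (-T)" by (intro add_mono P_h)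
    finally show ?thesis .
  qed
  have "c = 0"
  proof (rule ccontr)
    assume "c \<noteq> 0"
    hence c: "c > 0" by (simp add: c_def)
    have "\<forall>\<^sub>F T in at_top. \<Delta> T > c/2" using order_tendstoD(1)[OF \<Delta>_lim, of "c/2"] c by simp
    then obtain T0 where T0: "\<And>T. T \<ge> T0 \<Longrightarrow> \<Delta> T > c/2" by (auto simp: eventually_at_top_linorder)
    define T1 where "T1 = max T0 0"
    have "emeasure lborel {T1..} = \<infinity>"
    proof (rule ccontr)
      assume "emeasure lborel {T1..} \<noteq> \<infinity>"
      then obtain n :: nat where n: "emeasure lborel {T1..} < of_nat n"
        using ennreal_Ex_less_of_nat[of "emeasure lborel {T1..}"] by (auto simp: less_top)
      have "emeasure lborel {T1..T1 + real n} \<le> emeasure lborel {T1..}"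
        by (rule emeasure_mono) auto
      thus False using n by (simp add: ennreal_of_nat_eq_real_of_nat)
    qed
    hence "\<infinity> = ennreal (c/2) * emeasure lborel {T1..}"
      using c by (simp add: ennreal_mult_top)
    also have "\<dots> = (\<integral>\<^sup>+t. ennreal (c/2) * indicator {T1..} t \<partial>lborel)"
      by (rule nn_integral_cmult_indicator [symmetric]) simp
    also have "\<dots> \<le> (\<integral>\<^sup>+t. h t + h (-t) \<partial>lborel)"
    proof (rule nn_integral_mono)
      fix t
      have "ennreal (c/2) \<le> h t + h (-t)" if "t \<ge> T1"
      proof -
        have "ennreal (c/2) \<le> ennreal (\<Delta> t)"
          using T0[of t] that by (intro ennreal_leI) (auto simp: T1_def)
        also have "\<dots> \<le> h t + h (-t)" using \<Delta>_h[of t] that by (simp add: T1_def)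
        finally show ?thesis .
      qed
      thus "ennreal (c/2) * indicator {T1..} t \<le> h t + h (-t)" by (auto simp: indicator_def)
    qed
    also have "\<dots> = (\<integral>\<^sup>+t. h t \<partial>lborel) + (\<integral>\<^sup>+t. h (-t) \<partial>lborel)"
      by (rule nn_integral_add) auto
    also have "\<dots> < \<infinity>" using hfin hrefl by simp
    finally show False by simp
  qed
  thus ?thesis by (simp add: c_def)
qed

lemma hardy_scalar_L2:
  fixes f :: "complex \<Rightarrow> complex"
  assumes hol: "f holomorphic_on {s. 0 < Re s}"
    and bdd: "\<And>x. 0 < x \<Longrightarrow> (\<integral>\<^sup>+t. ennreal ((norm (f (Complex x t)))\<^sup>2) \<partial>lborel) \<le> ennreal K"
  shows "\<exists>b\<in>borel_measurable lborel.
           ((\<lambda>x. \<integral>\<^sup>+t. ennreal ((norm (f (Complex x t) - b t))\<^sup>2) \<partial>lborel) \<longlongrightarrow> 0) (at_right 0)"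
    and "\<And>x y. 0 < x \<Longrightarrow> x \<le> y \<Longrightarrow>
           (\<integral>\<^sup>+t. ennreal ((norm (f (Complex y t)))\<^sup>2) \<partial>lborel)
             \<le> (\<integral>\<^sup>+t. ennreal ((norm (f (Complex x t)))\<^sup>2) \<partial>lborel)"
proof -
  have contf: "continuous_on {s. 0 < Re s} f"
    using hol by (rule holomorphic_on_imp_continuous_on)
  have "continuous_on UNIV (\<lambda>t. f (Complex x t))" if "x > 0" for x
    unfolding Complex_eq
    by (rule continuous_on_compose2[OF contf]) (use that in \<open>auto intro!: continuous_intros\<close>)
  hence meas [measurable]: "(\<lambda>t. f (Complex x t)) \<in> borel_measurable borel" if "x > 0" for x
    using that by (intro borel_measurable_continuous_onI) auto
  have intsq: "integrable lborel (\<lambda>t. (norm (f (Complex x t)))\<^sup>2)" if "x > 0" for x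
    unfolding integrable_iff_bounded using bdd[OF that] meas[OF that]
    by (auto intro: le_less_trans)
  have amgm: "u * v \<le> u\<^sup>2 + v\<^sup>2" for u v :: real
    using sum_squares_bound[of u v] zero_le_power2[of u] zero_le_power2[of v] by linarith
  have mcnj: "cnj \<in> borel_measurable borel"
    by (intro borel_measurable_continuous_onI continuous_intros)
  have intprod: "integrable lborel (\<lambda>t. cnj (f (Complex x t)) * f (Complex y t))"
    if "x > 0" "y > 0" for x y
  proof (rule Bochner_Integration.integrable_bound)
    show "integrable lborel (\<lambda>t. (norm (f (Complex x t)))\<^sup>2 + (norm (f (Complex y t)))\<^sup>2)"
      using that by (intro Bochner_Integration.integrable_add intsq)
    show "(\<lambda>t. cnj (f (Complex x t)) * f (Complex y t)) \<in> borel_measurable lborel"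
      using measurable_compose[OF meas[OF that(1)] mcnj] meas[OF that(2)]
      by (intro borel_measurable_times) simp_all
    show "AE t in lborel. norm (cnj (f (Complex x t)) * f (Complex y t))
            \<le> norm ((norm (f (Complex x t)))\<^sup>2 + (norm (f (Complex y t)))\<^sup>2)"
      by (intro AE_I2) (use amgm in \<open>simp add: norm_mult\<close>)
  qed
  define G where "G = (\<lambda>x y. LINT t|lborel. cnj (f (Complex x t)) * f (Complex y t))"
  have shift: "G x y = G x' y'" if "0 < x" "0 < x'" "0 < y" "y \<le> y'" "x + y = x' + y'" for x y x' y'
  proof -
    define \<sigma> where "\<sigma> = x + y"
    define g where "g = (\<lambda>s. (cnj \<circ> f \<circ> cnj) (of_real \<sigma> - s) * f s)"
    have g: "g (Complex v t) = cnj (f (Complex (\<sigma> - v) t)) * f (Complex v t)" for v t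
    proof -
      have "cnj (of_real \<sigma> - Complex v t) = Complex (\<sigma> - v) t" by (simp add: complex_eq_iff)
      thus ?thesis by (simp add: g_def)
    qed
    have "(LINT t|lborel. g (Complex y t)) = (LINT t|lborel. g (Complex y' t))"
    proof (rule vertical_line_integral_shift[where \<alpha>=0 and \<beta>=\<sigma> and K="K+K"])
      have "(cnj \<circ> f \<circ> cnj) holomorphic_on {s. 0 < Re s}"
        by (rule holomorphic_on_compose_cnj_cnj) (use hol in \<open>auto simp: open_halfspace_Re_gt image_def\<close>)
      hence "(\<lambda>s. (cnj \<circ> f \<circ> cnj) (of_real \<sigma> - s)) holomorphic_on {s. 0 < Re s \<and> Re s < \<sigma>}"
        by (rule holomorphic_on_compose_gen[of "\<lambda>s. of_real \<sigma> - s", unfolded o_def[of _ "\<lambda>s. of_real \<sigma> - s"], rotated])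
           (auto intro!: holomorphic_intros)
      thus "g holomorphic_on {s. 0 < Re s \<and> Re s < \<sigma>}"
        unfolding g_def by (intro holomorphic_on_mult holomorphic_on_subset[OF hol]) auto
    next
      fix v assume v: "y \<le> v" "v \<le> y'"
      have v0: "v > 0" "\<sigma> - v > 0" using v that by (auto simp: \<sigma>_def)
      have "(\<integral>\<^sup>+t. ennreal (norm (g (Complex v t))) \<partial>lborel)
          \<le> (\<integral>\<^sup>+t. ennreal ((norm (f (Complex (\<sigma> - v) t)))\<^sup>2) + ennreal ((norm (f (Complex v t)))\<^sup>2) \<partial>lborel)"
      proof (rule nn_integral_mono)
        fix t
        show "ennreal (norm (g (Complex v t))) \<le> ennreal ((norm (f (Complex (\<sigma> - v) t)))\<^sup>2) + ennreal ((norm (f (Complex v t)))\<^sup>2)"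
          using amgm by (auto simp: g norm_mult simp flip: ennreal_plus intro!: ennreal_leI)
      qed
      also have "\<dots> = (\<integral>\<^sup>+t. ennreal ((norm (f (Complex (\<sigma> - v) t)))\<^sup>2) \<partial>lborel) + (\<integral>\<^sup>+t. ennreal ((norm (f (Complex v t)))\<^sup>2) \<partial>lborel)"
        using meas[OF v0(1)] meas[OF v0(2)] by (intro nn_integral_add) auto
      also have "\<dots> \<le> ennreal K + ennreal K" by (intro add_mono bdd v0)
      also have "\<dots> = ennreal (K + K)"
        by (cases "K \<ge> 0") (auto simp: ennreal_neg simp flip: ennreal_plus)
      finally show "(\<integral>\<^sup>+t. ennreal (norm (g (Complex v t))) \<partial>lborel) \<le> ennreal (K + K)" .
    qed (use that in \<open>auto simp: \<sigma>_def\<close>)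
    moreover have "\<sigma> - y = x" "\<sigma> - y' = x'" using that by (auto simp: \<sigma>_def)
    ultimately show ?thesis by (simp add: g G_def)
  qed
  define \<phi> where "\<phi> = (\<lambda>t. Re (G (t/2) (t/2)))"
  have Gphi: "Re (G x y) = \<phi> (x + y)" if "x > 0" "y > 0" for x y
  proof (cases "y \<le> (x+y)/2")
    case True
    thus ?thesis using shift[of x "(x+y)/2" y "(x+y)/2"] that by (simp add: \<phi>_def)
  next
    case False
    thus ?thesis using shift[of "(x+y)/2" x "(x+y)/2" y] that by (simp add: \<phi>_def)
  qed
  have phi_int: "\<phi> (2*x) = (LINT t|lborel. (norm (f (Complex x t)))\<^sup>2)" if "x > 0" for x
  proof -
    have "Re (G x x) = (LINT t|lborel. Re (cnj (f (Complex x t)) * f (Complex x t)))"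
      unfolding G_def by (subst integral_Re) (use intprod that in auto)
    also have "\<dots> = (LINT t|lborel. (norm (f (Complex x t)))\<^sup>2)"
      by (rule Bochner_Integration.integral_cong) (simp_all add: cmod_power2 flip: power2_eq_square)
    finally show ?thesis by (simp add: \<phi>_def)
  qed
  have phi_nn: "(\<integral>\<^sup>+t. ennreal ((norm (f (Complex x t)))\<^sup>2) \<partial>lborel) = ennreal (\<phi> (2*x))" if "x > 0" for x
    unfolding phi_int[OF that] by (rule nn_integral_eq_integral) (use intsq that in auto)
  have phi0: "\<phi> x \<ge> 0" if "x > 0" for x
    using phi_int[of "x/2"] that by simp
  have phiK: "\<phi> x \<le> max K 0" if "x > 0" for x
    using bdd[of "x/2"] phi_nn[of "x/2"] that by (auto simp: ennreal_le_iff2 le_max_iff_disj)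
  have dist_int: "integrable lborel (\<lambda>t. (norm (f (Complex x t) - f (Complex y t)))\<^sup>2)"
    "(LINT t|lborel. (norm (f (Complex x t) - f (Complex y t)))\<^sup>2) = \<phi> (2*x) + \<phi> (2*y) - 2 * \<phi> (x+y)"
    if xy: "x > 0" "y > 0" for x y
  proof -
    have eq: "(\<lambda>t. (norm (f (Complex x t) - f (Complex y t)))\<^sup>2) =
      (\<lambda>t. (norm (f (Complex x t)))\<^sup>2 + (norm (f (Complex y t)))\<^sup>2 - 2 * Re (cnj (f (Complex x t)) * f (Complex y t)))"
      unfolding cmod_power2 by (rule ext) (simp add: power2_eq_square algebra_simps)
    have intRe: "integrable lborel (\<lambda>t. Re (cnj (f (Complex x t)) * f (Complex y t)))"
      by (rule integrable_Re[OF intprod]) (use xy in auto)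
    show "integrable lborel (\<lambda>t. (norm (f (Complex x t) - f (Complex y t)))\<^sup>2)"
      unfolding eq using intsq[OF xy(1)] intsq[OF xy(2)] intRe by (intro Bochner_Integration.integrable_add Bochner_Integration.integrable_diff integrable_mult_right)
    have "Re (G x y) = (LINT t|lborel. Re (cnj (f (Complex x t)) * f (Complex y t)))"
      unfolding G_def by (rule integral_Re[OF intprod, symmetric]) (use xy in auto)
    thus "(LINT t|lborel. (norm (f (Complex x t) - f (Complex y t)))\<^sup>2) = \<phi> (2*x) + \<phi> (2*y) - 2 * \<phi> (x+y)"
      unfolding eq using intsq[OF xy(1)] intsq[OF xy(2)] intRe Gphi[OF xy] phi_int xy by (simp del: times_complex.sel)
  qed
  have anti: "\<phi> b \<le> \<phi> a" if "0 < a" "a \<le> b" for a b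
  proof (rule midpoint_convex_bounded_antimono[OF _ phiK that])
    fix x y :: real assume xy: "x > 0" "y > 0"
    have "0 \<le> (LINT t|lborel. (norm (f (Complex (x/2) t) - f (Complex (y/2) t)))\<^sup>2)" by simp
    thus "2 * \<phi> ((x + y) / 2) \<le> \<phi> x + \<phi> y"
      using dist_int(2)[of "x/2" "y/2"] xy by (simp add: add_divide_distrib)
  qed
  show "(\<integral>\<^sup>+t. ennreal ((norm (f (Complex y t)))\<^sup>2) \<partial>lborel)
             \<le> (\<integral>\<^sup>+t. ennreal ((norm (f (Complex x t)))\<^sup>2) \<partial>lborel)" if "0 < x" "x \<le> y" for x y
    using that anti[of "2*x" "2*y"] by (simp add: phi_nn ennreal_leI)
  define L where "L = Sup (\<phi> ` {0<..})"
  have bdA: "bdd_above (\<phi> ` {0<..})" using phiK by (auto intro!: bdd_aboveI)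
  have phiL: "\<phi> x \<le> L" if "x > 0" for x
    unfolding L_def by (rule cSup_upper) (use that bdA in auto)
  show "\<exists>b\<in>borel_measurable lborel.
           ((\<lambda>x. \<integral>\<^sup>+t. ennreal ((norm (f (Complex x t) - b t))\<^sup>2) \<partial>lborel) \<longlongrightarrow> 0) (at_right 0)"
  proof (rule L2_Cauchy_at_right_convergent)
    fix e :: real assume e: "e > 0"
    obtain a where a: "a > 0" "\<phi> a > L - e/4"
    proof -
      have "L - e/4 < Sup (\<phi> ` {0<..})" using e by (simp add: L_def)
      then obtain z where "z \<in> \<phi> ` {0<..}" "L - e/4 < z"
        by (subst (asm) less_cSup_iff) (use bdA in auto)
      thus ?thesis using that by auto
    qed
    have close: "L - e/4 < \<phi> x" if "0 < x" "x \<le> a" for x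
      using anti[OF that] a by linarith
    show "\<exists>\<delta>>0. \<forall>x y. 0 < x \<longrightarrow> x < \<delta> \<longrightarrow> 0 < y \<longrightarrow> y < \<delta> \<longrightarrow>
          (\<integral>\<^sup>+w. ennreal ((norm (f (Complex x w) - f (Complex y w)))\<^sup>2) \<partial>lborel) \<le> ennreal e"
    proof (intro exI[of _ "a/2"] conjI allI impI)
      fix x y assume xy: "0 < x" "x < a/2" "0 < y" "y < a/2"
      have "(\<integral>\<^sup>+w. ennreal ((norm (f (Complex x w) - f (Complex y w)))\<^sup>2) \<partial>lborel)
          = ennreal (\<phi> (2*x) + \<phi> (2*y) - 2 * \<phi> (x+y))"
        using dist_int[of x y] xy by (subst nn_integral_eq_integral) auto
      also have "\<dots> \<le> ennreal e"
        using phiL[of "2*x"] phiL[of "2*y"] close[of "x+y"] xy e by (intro ennreal_leI) auto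
      finally show "(\<integral>\<^sup>+w. ennreal ((norm (f (Complex x w) - f (Complex y w)))\<^sup>2) \<partial>lborel) \<le> ennreal e" .
    qed (use a in auto)
  qed (use meas in simp)
qed

lemma power2_norm_add_le: "(norm (x + y))\<^sup>2 \<le> 2 * (norm x)\<^sup>2 + 2 * (norm y)\<^sup>2"
  for x y :: "'b::real_normed_vector"
proof -
  have "(norm (x + y))\<^sup>2 \<le> (norm x + norm y)\<^sup>2"
    by (intro power_mono norm_triangle_ineq) auto
  also have "\<dots> \<le> 2 * (norm x)\<^sup>2 + 2 * (norm y)\<^sup>2"
    using sum_squares_bound[of "norm x" "norm y"] by (simp add: power2_sum)
  finally show ?thesis .
qed

lemma nn_integral_power2_norm_add_le:
  fixes f g :: "'a \<Rightarrow> 'b::{real_normed_vector, second_countable_topology}"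
  assumes [measurable]: "f \<in> borel_measurable M" "g \<in> borel_measurable M"
  shows "(\<integral>\<^sup>+x. ennreal ((norm (f x + g x))\<^sup>2) \<partial>M)
    \<le> 2 * (\<integral>\<^sup>+x. ennreal ((norm (f x))\<^sup>2) \<partial>M) + 2 * (\<integral>\<^sup>+x. ennreal ((norm (g x))\<^sup>2) \<partial>M)"
proof -
  have "(\<integral>\<^sup>+x. ennreal ((norm (f x + g x))\<^sup>2) \<partial>M)
      \<le> (\<integral>\<^sup>+x. 2 * ennreal ((norm (f x))\<^sup>2) + 2 * ennreal ((norm (g x))\<^sup>2) \<partial>M)"
  proof (rule nn_integral_mono)
    fix x
    have "ennreal ((norm (f x + g x))\<^sup>2) \<le> ennreal (2 * (norm (f x))\<^sup>2 + 2 * (norm (g x))\<^sup>2)"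
      by (intro ennreal_leI power2_norm_add_le)
    thus "ennreal ((norm (f x + g x))\<^sup>2) \<le> 2 * ennreal ((norm (f x))\<^sup>2) + 2 * ennreal ((norm (g x))\<^sup>2)"
      by (simp add: ennreal_plus ennreal_mult)
  qed
  also have "\<dots> = 2 * (\<integral>\<^sup>+x. ennreal ((norm (f x))\<^sup>2) \<partial>M) + 2 * (\<integral>\<^sup>+x. ennreal ((norm (g x))\<^sup>2) \<partial>M)"
    by (simp add: nn_integral_add nn_integral_cmult)
  finally show ?thesis .
qed

section \<open>The Hardy space\<close>

text \<open>A \<open>p \<times> m\<close> matrix over \<open>'k\<close> has type \<open>'k^'m^'p\<close>; the library norm of that type is the Frobenius
norm. Functions on the half-plane are total functions that vanish off the half-plane, so that
equality of elements is equality on the half-plane.\<close>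

definition hardy_h2 :: "(complex \<Rightarrow> complex^'m^'p) set" where
  "hardy_h2 = {F. (\<forall>i j. (\<lambda>s. F s $ i $ j) holomorphic_on {s. 0 < Re s}) \<and>
     (SUP \<xi>\<in>{0<..}. \<integral>\<^sup>+\<omega>. ennreal ((norm (F (Complex \<xi> \<omega>)))\<^sup>2) \<partial>lborel) < \<infinity> \<and>
     (\<forall>s. Re s \<le> 0 \<longrightarrow> F s = 0)}"

lemma hardy_h2_alt:
  "F \<in> hardy_h2 \<longleftrightarrow> (\<forall>i j. (\<lambda>s. F s $ i $ j) holomorphic_on {s. 0 < Re s}) \<and>
     (\<exists>K. \<forall>\<xi>>0. (\<integral>\<^sup>+\<omega>. ennreal ((norm (F (Complex \<xi> \<omega>)))\<^sup>2) \<partial>lborel) \<le> ennreal K) \<and>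
     (\<forall>s. Re s \<le> 0 \<longrightarrow> F s = 0)"
proof -
  have "(SUP \<xi>\<in>{0<..}. \<integral>\<^sup>+\<omega>. ennreal ((norm (F (Complex \<xi> \<omega>)))\<^sup>2) \<partial>lborel) < \<infinity> \<longleftrightarrow>
     (\<exists>K. \<forall>\<xi>>0. (\<integral>\<^sup>+\<omega>. ennreal ((norm (F (Complex \<xi> \<omega>)))\<^sup>2) \<partial>lborel) \<le> ennreal K)" (is "?S < \<infinity> \<longleftrightarrow> ?E")
  proof
    assume "?S < \<infinity>"
    then obtain K where K: "?S = ennreal K"
      by (auto simp: less_top_ennreal)
    show ?E
    proof (intro exI allI impI)
      fix \<xi> :: real assume "\<xi> > 0"
      thus "(\<integral>\<^sup>+\<omega>. ennreal ((norm (F (Complex \<xi> \<omega>)))\<^sup>2) \<partial>lborel) \<le> ennreal K"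
        unfolding K[symmetric] by (intro SUP_upper) auto
    qed
  next
    assume ?E
    then obtain K where "\<And>\<xi>. \<xi> > 0 \<Longrightarrow> (\<integral>\<^sup>+\<omega>. ennreal ((norm (F (Complex \<xi> \<omega>)))\<^sup>2) \<partial>lborel) \<le> ennreal K"
      by blast
    hence "?S \<le> ennreal K" by (intro SUP_least) auto
    thus "?S < \<infinity>" by (auto intro: le_less_trans)
  qed
  thus ?thesis unfolding hardy_h2_def by auto
qed

lemma borel_measurable_matrixI:
  fixes f :: "'a \<Rightarrow> complex^'m^'p"
  assumes "\<And>i j. (\<lambda>x. f x $ i $ j) \<in> borel_measurable M"
  shows "f \<in> borel_measurable M"
proof (subst borel_measurable_euclidean_space, intro ballI)
  fix u :: "complex^'m^'p" assume "u \<in> Basis"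
  then obtain i j v where "u = axis i (axis j v)" by (auto simp: Basis_vec_def)
  thus "(\<lambda>x. f x \<bullet> u) \<in> borel_measurable M"
    using assms[of i j] by (simp add: inner_axis)
qed

lemma power2_norm_matrix:
  fixes A :: "complex^'m^'p"
  shows "(norm A)\<^sup>2 = (\<Sum>i\<in>UNIV. \<Sum>j\<in>UNIV. (norm (A $ i $ j))\<^sup>2)"
  by (simp add: norm_vec_def L2_set_def sum_nonneg)

lemma nn_integral_power2_norm_matrix:
  fixes f :: "'a \<Rightarrow> complex^'m^'p"
  assumes "\<And>i j. (\<lambda>x. f x $ i $ j) \<in> borel_measurable M"
  shows "(\<integral>\<^sup>+x. ennreal ((norm (f x))\<^sup>2) \<partial>M)
     = (\<Sum>i\<in>UNIV. \<Sum>j\<in>UNIV. \<integral>\<^sup>+x. ennreal ((norm (f x $ i $ j))\<^sup>2) \<partial>M)"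
proof -
  note assms [measurable]
  have "(\<integral>\<^sup>+x. ennreal ((norm (f x))\<^sup>2) \<partial>M) = (\<integral>\<^sup>+x. (\<Sum>i\<in>UNIV. \<Sum>j\<in>UNIV. ennreal ((norm (f x $ i $ j))\<^sup>2)) \<partial>M)"
    unfolding power2_norm_matrix by (simp add: sum_ennreal sum_nonneg)
  also have "\<dots> = (\<Sum>i\<in>UNIV. \<integral>\<^sup>+x. (\<Sum>j\<in>UNIV. ennreal ((norm (f x $ i $ j))\<^sup>2)) \<partial>M)"
    by (rule nn_integral_sum) measurable
  also have "\<dots> = (\<Sum>i\<in>UNIV. \<Sum>j\<in>UNIV. \<integral>\<^sup>+x. ennreal ((norm (f x $ i $ j))\<^sup>2) \<partial>M)"
    by (intro sum.cong refl nn_integral_sum) measurable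
  finally show ?thesis .
qed

lemma hardy_h2_continuous:
  assumes "F \<in> hardy_h2" "x > 0"
  shows "continuous_on UNIV (\<lambda>t. F (Complex x t) $ i $ j)"
proof -
  have "continuous_on {s. 0 < Re s} (\<lambda>s. F s $ i $ j)"
    using assms unfolding hardy_h2_def by (auto intro: holomorphic_on_imp_continuous_on)
  thus ?thesis unfolding Complex_eq
    by (rule continuous_on_compose2) (use assms in \<open>auto intro!: continuous_intros\<close>)
qed

lemma hardy_h2_measurable_nth:
  assumes "F \<in> hardy_h2" "x > 0"
  shows "(\<lambda>t. F (Complex x t) $ i $ j) \<in> borel_measurable borel"
  using hardy_h2_continuous[OF assms] by (rule borel_measurable_continuous_onI)

lemma hardy_h2_measurable:
  assumes "F \<in> hardy_h2" "x > 0"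
  shows "(\<lambda>t. F (Complex x t)) \<in> borel_measurable borel"
  using hardy_h2_measurable_nth[OF assms] by (rule borel_measurable_matrixI)

lemma hardy_h2_nth_bound:
  assumes "F \<in> hardy_h2"
  obtains K where "\<And>i j x. x > 0 \<Longrightarrow> (\<integral>\<^sup>+t. ennreal ((norm (F (Complex x t) $ i $ j))\<^sup>2) \<partial>lborel) \<le> ennreal K"
proof -
  obtain K where K: "\<And>x. x > 0 \<Longrightarrow> (\<integral>\<^sup>+t. ennreal ((norm (F (Complex x t)))\<^sup>2) \<partial>lborel) \<le> ennreal K"
    using assms unfolding hardy_h2_alt by blast
  show ?thesis
  proof (rule that)
    fix i j x assume "(x::real) > 0"
    have "(\<integral>\<^sup>+t. ennreal ((norm (F (Complex x t) $ i $ j))\<^sup>2) \<partial>lborel) \<le> (\<integral>\<^sup>+t. ennreal ((norm (F (Complex x t)))\<^sup>2) \<partial>lborel)"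
      by (intro nn_integral_mono ennreal_leI power_mono)
         (auto intro: order_trans[OF Finite_Cartesian_Product.norm_nth_le Finite_Cartesian_Product.norm_nth_le])
    also have "\<dots> \<le> ennreal K" using K \<open>x > 0\<close> by blast
    finally show "(\<integral>\<^sup>+t. ennreal ((norm (F (Complex x t) $ i $ j))\<^sup>2) \<partial>lborel) \<le> ennreal K" .
  qed
qed

lemma hardy_h2_boundary_exists:
  fixes F :: "complex \<Rightarrow> complex^'m^'p"
  assumes F: "F \<in> hardy_h2"
  shows "\<exists>b. b \<in> borel_measurable lborel \<and>
     ((\<lambda>x. \<integral>\<^sup>+t. ennreal ((norm (F (Complex x t) - b t))\<^sup>2) \<partial>lborel) \<longlongrightarrow> 0) (at_right 0)"
proof -
  obtain K where K: "\<And>i j x. x > 0 \<Longrightarrow> (\<integral>\<^sup>+t. ennreal ((norm (F (Complex x t) $ i $ j))\<^sup>2) \<partial>lborel) \<le> ennreal K"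
    using hardy_h2_nth_bound[OF F] by blast
  have "\<exists>b. b \<in> borel_measurable lborel \<and>
     ((\<lambda>x. \<integral>\<^sup>+t. ennreal ((norm (F (Complex x t) $ i $ j - b t))\<^sup>2) \<partial>lborel) \<longlongrightarrow> 0) (at_right 0)" for i j
  proof -
    have "(\<lambda>s. F s $ i $ j) holomorphic_on {s. 0 < Re s}"
      using F by (simp add: hardy_h2_def)
    from hardy_scalar_L2(1)[OF this K] show ?thesis by (simp add: Bex_def)
  qed
  then have "\<forall>i. \<exists>b. \<forall>j. b j \<in> borel_measurable lborel \<and>
     ((\<lambda>x. \<integral>\<^sup>+t. ennreal ((norm (F (Complex x t) $ i $ j - b j t))\<^sup>2) \<partial>lborel) \<longlongrightarrow> 0) (at_right 0)"
    by (intro allI choice)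
  from choice[OF this] obtain b where b: "\<And>i j. b i j \<in> borel_measurable lborel"
     "\<And>i j. ((\<lambda>x. \<integral>\<^sup>+t. ennreal ((norm (F (Complex x t) $ i $ j - b i j t))\<^sup>2) \<partial>lborel) \<longlongrightarrow> 0) (at_right 0)"
    by blast
  define B where "B = (\<lambda>t. \<chi> i j. b i j t)"
  have B: "B \<in> borel_measurable lborel"
    by (rule borel_measurable_matrixI) (use b in \<open>simp add: B_def\<close>)
  have "((\<lambda>x. \<Sum>i\<in>UNIV. \<Sum>j\<in>UNIV. \<integral>\<^sup>+t. ennreal ((norm (F (Complex x t) $ i $ j - b i j t))\<^sup>2) \<partial>lborel) \<longlongrightarrow> (\<Sum>i\<in>(UNIV::'p set). \<Sum>j\<in>(UNIV::'m set). 0)) (at_right 0)"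
    by (intro tendsto_sum b)
  hence "((\<lambda>x. \<Sum>i\<in>UNIV. \<Sum>j\<in>UNIV. \<integral>\<^sup>+t. ennreal ((norm (F (Complex x t) $ i $ j - b i j t))\<^sup>2) \<partial>lborel) \<longlongrightarrow> 0) (at_right 0)"
    by simp
  moreover have "\<forall>\<^sub>F x in at_right 0. (\<Sum>i\<in>UNIV. \<Sum>j\<in>UNIV. \<integral>\<^sup>+t. ennreal ((norm (F (Complex x t) $ i $ j - b i j t))\<^sup>2) \<partial>lborel)
      = (\<integral>\<^sup>+t. ennreal ((norm (F (Complex x t) - B t))\<^sup>2) \<partial>lborel)"
    using eventually_at_right_less[of 0]
  proof eventually_elim
    case (elim x)
    show ?case
      by (subst nn_integral_power2_norm_matrix)
         (use hardy_h2_measurable_nth[OF F elim] b(1) in \<open>auto simp: B_def\<close>)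
  qed
  ultimately have "((\<lambda>x. \<integral>\<^sup>+t. ennreal ((norm (F (Complex x t) - B t))\<^sup>2) \<partial>lborel) \<longlongrightarrow> 0) (at_right 0)"
    by (rule Lim_transform_eventually)
  with B show ?thesis by blast
qed

lemma hardy_h2_antimono:
  assumes F: "F \<in> hardy_h2" and xy: "0 < x" "x \<le> y"
  shows "(\<integral>\<^sup>+t. ennreal ((norm (F (Complex y t)))\<^sup>2) \<partial>lborel) \<le> (\<integral>\<^sup>+t. ennreal ((norm (F (Complex x t)))\<^sup>2) \<partial>lborel)"
proof -
  obtain K where K: "\<And>i j x. x > 0 \<Longrightarrow> (\<integral>\<^sup>+t. ennreal ((norm (F (Complex x t) $ i $ j))\<^sup>2) \<partial>lborel) \<le> ennreal K"
    using hardy_h2_nth_bound[OF F] by blast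
  have nth: "(\<integral>\<^sup>+t. ennreal ((norm (F (Complex y t) $ i $ j))\<^sup>2) \<partial>lborel) \<le> (\<integral>\<^sup>+t. ennreal ((norm (F (Complex x t) $ i $ j))\<^sup>2) \<partial>lborel)" for i j
    by (rule hardy_scalar_L2(2)[of "\<lambda>s. F s $ i $ j" K]) (use K F xy in \<open>auto simp: hardy_h2_def\<close>)
  have y: "0 < y" using xy by simp
  show ?thesis
    using hardy_h2_measurable_nth[OF F xy(1)] hardy_h2_measurable_nth[OF F y]
    by (subst (1 2) nn_integral_power2_norm_matrix) (auto intro!: sum_mono nth)
qed

lemma hardy_h2_zero: "(\<lambda>s. 0) \<in> hardy_h2"
  by (auto simp: hardy_h2_def)

lemma hardy_h2_add:
  assumes F: "F \<in> hardy_h2" and G: "G \<in> hardy_h2"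
  shows "(\<lambda>s. F s + G s) \<in> hardy_h2"
  unfolding hardy_h2_alt
proof (intro conjI allI impI)
  show "(\<lambda>s. (F s + G s) $ i $ j) holomorphic_on {s. 0 < Re s}" for i j
    using F G by (auto simp: hardy_h2_def intro!: holomorphic_intros)
  obtain K L where K: "\<And>x. x > 0 \<Longrightarrow> (\<integral>\<^sup>+t. ennreal ((norm (F (Complex x t)))\<^sup>2) \<partial>lborel) \<le> ennreal K"
    and L: "\<And>x. x > 0 \<Longrightarrow> (\<integral>\<^sup>+t. ennreal ((norm (G (Complex x t)))\<^sup>2) \<partial>lborel) \<le> ennreal L"
    using F G unfolding hardy_h2_alt by blast
  show "\<exists>K. \<forall>\<xi>>0. (\<integral>\<^sup>+\<omega>. ennreal ((norm (F (Complex \<xi> \<omega>) + G (Complex \<xi> \<omega>)))\<^sup>2) \<partial>lborel) \<le> ennreal K"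
  proof (intro exI allI impI)
    fix x :: real assume x: "x > 0"
    have "(\<integral>\<^sup>+\<omega>. ennreal ((norm (F (Complex x \<omega>) + G (Complex x \<omega>)))\<^sup>2) \<partial>lborel)
        \<le> 2 * (\<integral>\<^sup>+t. ennreal ((norm (F (Complex x t)))\<^sup>2) \<partial>lborel) + 2 * (\<integral>\<^sup>+t. ennreal ((norm (G (Complex x t)))\<^sup>2) \<partial>lborel)"
      using hardy_h2_measurable[OF F x] hardy_h2_measurable[OF G x] by (intro nn_integral_power2_norm_add_le) simp_all
    also have "\<dots> \<le> 2 * ennreal (max K 0) + 2 * ennreal (max L 0)"
      by (intro add_mono mult_left_mono order_trans[OF K[OF x]] order_trans[OF L[OF x]] ennreal_leI) auto
    also have "\<dots> = ennreal (2 * max K 0 + 2 * max L 0)"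
      by (simp add: ennreal_mult)
    finally show "(\<integral>\<^sup>+\<omega>. ennreal ((norm (F (Complex x \<omega>) + G (Complex x \<omega>)))\<^sup>2) \<partial>lborel) \<le> ennreal (2 * max K 0 + 2 * max L 0)" .
  qed
qed (use F G in \<open>auto simp: hardy_h2_def\<close>)

lemma hardy_h2_scale:
  fixes F :: "complex \<Rightarrow> complex^'m^'p"
  assumes F: "F \<in> hardy_h2"
  shows "(\<lambda>s. \<chi> i j. c * F s $ i $ j) \<in> hardy_h2"
  unfolding hardy_h2_alt
proof (intro conjI allI impI)
  show "(\<lambda>s. (\<chi> i j. c * F s $ i $ j) $ i $ j) holomorphic_on {s. 0 < Re s}" for i j
    using F by (auto simp: hardy_h2_def intro!: holomorphic_intros)
  have nrm: "(norm (\<chi> i j. c * F s $ i $ j :: complex^'m^'p))\<^sup>2 = (norm c)\<^sup>2 * (norm (F s))\<^sup>2" for s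
    by (simp add: power2_norm_matrix norm_mult power_mult_distrib sum_distrib_left)
  obtain K where K: "\<And>x. x > 0 \<Longrightarrow> (\<integral>\<^sup>+t. ennreal ((norm (F (Complex x t)))\<^sup>2) \<partial>lborel) \<le> ennreal K"
    using F unfolding hardy_h2_alt by blast
  show "\<exists>K. \<forall>\<xi>>0. (\<integral>\<^sup>+\<omega>. ennreal ((norm (\<chi> i j. c * F (Complex \<xi> \<omega>) $ i $ j :: complex^'m^'p))\<^sup>2) \<partial>lborel) \<le> ennreal K"
  proof (intro exI allI impI)
    fix x :: real assume x: "x > 0"
    have [measurable]: "(\<lambda>t. F (Complex x t)) \<in> borel_measurable borel" by (rule hardy_h2_measurable[OF F x])
    have "(\<integral>\<^sup>+\<omega>. ennreal ((norm (\<chi> i j. c * F (Complex x \<omega>) $ i $ j :: complex^'m^'p))\<^sup>2) \<partial>lborel)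
        = ennreal ((norm c)\<^sup>2) * (\<integral>\<^sup>+t. ennreal ((norm (F (Complex x t)))\<^sup>2) \<partial>lborel)"
      unfolding nrm by (simp add: ennreal_mult nn_integral_cmult)
    also have "\<dots> \<le> ennreal ((norm c)\<^sup>2) * ennreal (max K 0)"
      by (intro mult_left_mono order_trans[OF K[OF x]] ennreal_leI) auto
    also have "\<dots> = ennreal ((norm c)\<^sup>2 * max K 0)" by (simp add: ennreal_mult)
    finally show "(\<integral>\<^sup>+\<omega>. ennreal ((norm (\<chi> i j. c * F (Complex x \<omega>) $ i $ j :: complex^'m^'p))\<^sup>2) \<partial>lborel) \<le> ennreal ((norm c)\<^sup>2 * max K 0)" .
  qed
qed (use F in \<open>auto simp: hardy_h2_def vec_eq_iff\<close>)

typedef ('m, 'p) h2 = "hardy_h2 :: (complex \<Rightarrow> complex^'m^'p) set"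
  morphisms h2_fun Abs_h2
  using hardy_h2_zero by blast

text \<open>The boundary extension to the imaginary axis: the function, unique up to null sets, to which
the restrictions to vertical lines converge in $L_2$ as the lines approach the axis.\<close>

definition boundary_value :: "('m::finite, 'p::finite) h2 \<Rightarrow> real \<Rightarrow> complex^'m^'p" where
  "boundary_value F = (SOME f. f \<in> borel_measurable lborel \<and>
     ((\<lambda>\<xi>. \<integral>\<^sup>+\<omega>. ennreal ((norm (h2_fun F (Complex \<xi> \<omega>) - f \<omega>))\<^sup>2) \<partial>lborel) \<longlongrightarrow> 0) (at_right 0))"

definition conj_transpose :: "complex^'m^'p \<Rightarrow> complex^'p^'m" where
  "conj_transpose A = (\<chi> i j. cnj (A $ j $ i))"

definition h2_cinner :: "('m::finite, 'p::finite) h2 \<Rightarrow> ('m, 'p) h2 \<Rightarrow> complex" where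
  "h2_cinner F G = 1 / (2 * of_real pi) *
     (LINT \<omega>|lborel. trace (conj_transpose (boundary_value F \<omega>) ** boundary_value G \<omega>))"

definition scaleC_h2 :: "complex \<Rightarrow> ('m::finite, 'p::finite) h2 \<Rightarrow> ('m, 'p) h2" where
  "scaleC_h2 c F = Abs_h2 (\<lambda>s. \<chi> i j. c * h2_fun F s $ i $ j)"

instantiation h2 :: (finite, finite) real_vector
begin
definition zero_h2 :: "('a, 'b) h2" where "0 = Abs_h2 (\<lambda>s. 0)"
definition plus_h2 :: "('a, 'b) h2 \<Rightarrow> ('a, 'b) h2 \<Rightarrow> ('a, 'b) h2" where
  "F + G = Abs_h2 (\<lambda>s. h2_fun F s + h2_fun G s)"
definition scaleR_h2 :: "real \<Rightarrow> ('a, 'b) h2 \<Rightarrow> ('a, 'b) h2" where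
  "scaleR_h2 a F = scaleC_h2 (of_real a) F"
definition uminus_h2 :: "('a, 'b) h2 \<Rightarrow> ('a, 'b) h2" where
  "- F = scaleC_h2 (-1) F"
definition minus_h2 :: "('a, 'b) h2 \<Rightarrow> ('a, 'b) h2 \<Rightarrow> ('a, 'b) h2" where
  "F - G = F + - (G :: ('a, 'b) h2)"

lemma h2_fun_zero_h2 [simp]: "h2_fun (0 :: ('a, 'b) h2) s = 0"
  unfolding zero_h2_def by (subst Abs_h2_inverse) (auto simp: hardy_h2_zero)
lemma h2_fun_plus [simp]: "h2_fun (F + G :: ('a, 'b) h2) s = h2_fun F s + h2_fun G s"
  unfolding plus_h2_def by (subst Abs_h2_inverse) (auto intro: hardy_h2_add h2_fun)
lemma h2_fun_scaleC [simp]: "h2_fun (scaleC_h2 c F :: ('a, 'b) h2) s = (\<chi> i j. c * h2_fun F s $ i $ j)"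
  unfolding scaleC_h2_def by (subst Abs_h2_inverse) (auto intro: hardy_h2_scale h2_fun)
lemma h2_fun_scaleR [simp]: "h2_fun (a *\<^sub>R F :: ('a, 'b) h2) s = a *\<^sub>R h2_fun F s"
  unfolding scaleR_h2_def by (simp add: vec_eq_iff scaleR_conv_of_real[where 'a=complex])
lemma h2_fun_uminus [simp]: "h2_fun (- F :: ('a, 'b) h2) s = - h2_fun F s"
  unfolding uminus_h2_def by (simp add: vec_eq_iff)
lemma h2_fun_minus [simp]: "h2_fun (F - G :: ('a, 'b) h2) s = h2_fun F s - h2_fun G s"
  unfolding minus_h2_def by simp
lemma h2_eqI: "(\<And>s. h2_fun F s = h2_fun G s) \<Longrightarrow> F = (G :: ('a, 'b) h2)"
  by (metis ext h2_fun_inject)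

instance
  by standard (auto intro!: h2_eqI simp: algebra_simps)
end

lemma boundary_value:
  fixes F :: "('m::finite, 'p::finite) h2"
  shows boundary_measurable [measurable]: "boundary_value F \<in> borel_measurable borel"
    and boundary_L2_limit: "((\<lambda>\<xi>. \<integral>\<^sup>+\<omega>. ennreal ((norm (h2_fun F (Complex \<xi> \<omega>) - boundary_value F \<omega>))\<^sup>2) \<partial>lborel) \<longlongrightarrow> 0) (at_right 0)"
proof -
  have "boundary_value F \<in> borel_measurable lborel \<and>
     ((\<lambda>\<xi>. \<integral>\<^sup>+\<omega>. ennreal ((norm (h2_fun F (Complex \<xi> \<omega>) - boundary_value F \<omega>))\<^sup>2) \<partial>lborel) \<longlongrightarrow> 0) (at_right 0)"
    unfolding boundary_value_def by (rule someI_ex[OF hardy_h2_boundary_exists[OF h2_fun[of F]]])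
  thus "boundary_value F \<in> borel_measurable borel"
    and "((\<lambda>\<xi>. \<integral>\<^sup>+\<omega>. ennreal ((norm (h2_fun F (Complex \<xi> \<omega>) - boundary_value F \<omega>))\<^sup>2) \<partial>lborel) \<longlongrightarrow> 0) (at_right 0)"
    by simp_all
qed

lemma h2_fun_measurable: "x > 0 \<Longrightarrow> (\<lambda>t. h2_fun F (Complex x t)) \<in> borel_measurable borel"
  by (rule hardy_h2_measurable[OF h2_fun])

lemma boundary_unique:
  fixes F :: "('m::finite, 'p::finite) h2"
  assumes b: "b \<in> borel_measurable borel"
    and lim: "((\<lambda>\<xi>. \<integral>\<^sup>+\<omega>. ennreal ((norm (h2_fun F (Complex \<xi> \<omega>) - b \<omega>))\<^sup>2) \<partial>lborel) \<longlongrightarrow> 0) (at_right 0)"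
  shows "AE \<omega> in lborel. boundary_value F \<omega> = b \<omega>"
proof -
  note b [measurable]
  let ?I = "\<lambda>\<xi> c. \<integral>\<^sup>+\<omega>. ennreal ((norm (h2_fun F (Complex \<xi> \<omega>) - c \<omega>))\<^sup>2) \<partial>lborel"
  let ?J = "\<integral>\<^sup>+\<omega>. ennreal ((norm (boundary_value F \<omega> - b \<omega>))\<^sup>2) \<partial>lborel"
  have "((\<lambda>\<xi>. 2 * ?I \<xi> (boundary_value F) + 2 * ?I \<xi> b) \<longlongrightarrow> 2 * 0 + 2 * 0) (at_right 0)"
    by (intro tendsto_add ennreal_tendsto_cmult lim boundary_L2_limit) auto
  moreover have "\<forall>\<^sub>F \<xi> in at_right 0. ?J \<le> 2 * ?I \<xi> (boundary_value F) + 2 * ?I \<xi> b"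
    using eventually_at_right_less[of 0]
  proof eventually_elim
    case (elim x)
    note h2_fun_measurable[OF elim, of F, measurable]
    have "?J = (\<integral>\<^sup>+\<omega>. ennreal ((norm ((boundary_value F \<omega> - h2_fun F (Complex x \<omega>)) + (h2_fun F (Complex x \<omega>) - b \<omega>)))\<^sup>2) \<partial>lborel)"
      by simp
    also have "\<dots> \<le> 2 * (\<integral>\<^sup>+\<omega>. ennreal ((norm (boundary_value F \<omega> - h2_fun F (Complex x \<omega>)))\<^sup>2) \<partial>lborel) + 2 * ?I x b"
      by (rule nn_integral_power2_norm_add_le) measurable
    finally show ?case by (simp add: norm_minus_commute)
  qed
  ultimately have "?J \<le> 2 * 0 + 2 * 0"
    by (intro tendsto_lowerbound) auto
  hence "?J = 0" by simp
  hence "AE \<omega> in lborel. ennreal ((norm (boundary_value F \<omega> - b \<omega>))\<^sup>2) = 0"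
    by (subst (asm) nn_integral_0_iff_AE) auto
  thus ?thesis by eventually_elim simp
qed

lemma boundary_add: "AE \<omega> in lborel. boundary_value (F + G) \<omega> = boundary_value F \<omega> + boundary_value G \<omega>"
proof (rule boundary_unique)
  let ?I = "\<lambda>\<xi> F. \<integral>\<^sup>+\<omega>. ennreal ((norm (h2_fun F (Complex \<xi> \<omega>) - boundary_value F \<omega>))\<^sup>2) \<partial>lborel"
  have l0: "((\<lambda>\<xi>. 2 * ?I \<xi> F + 2 * ?I \<xi> G) \<longlongrightarrow> 2 * 0 + 2 * 0) (at_right 0)"
    by (intro tendsto_add ennreal_tendsto_cmult boundary_L2_limit) auto
  show "((\<lambda>\<xi>. \<integral>\<^sup>+\<omega>. ennreal ((norm (h2_fun (F + G) (Complex \<xi> \<omega>) - (boundary_value F \<omega> + boundary_value G \<omega>)))\<^sup>2) \<partial>lborel) \<longlongrightarrow> 0) (at_right 0)"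
  proof (rule tendsto_sandwich[OF _ _ tendsto_const])
    show "\<forall>\<^sub>F \<xi> in at_right 0. (\<integral>\<^sup>+\<omega>. ennreal ((norm (h2_fun (F + G) (Complex \<xi> \<omega>) - (boundary_value F \<omega> + boundary_value G \<omega>)))\<^sup>2) \<partial>lborel) \<le> 2 * ?I \<xi> F + 2 * ?I \<xi> G"
      using eventually_at_right_less[of 0]
    proof eventually_elim
      case (elim x)
      note h2_fun_measurable[OF elim, of F, measurable] h2_fun_measurable[OF elim, of G, measurable]
      show ?case unfolding h2_fun_plus add_diff_add
        by (rule nn_integral_power2_norm_add_le) measurable
    qed
  qed (use l0 in simp_all)
qed measurable

lemma boundary_scaleR: "AE \<omega> in lborel. boundary_value (a *\<^sub>R F) \<omega> = a *\<^sub>R boundary_value F \<omega>"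
proof (rule boundary_unique)
  let ?I = "\<lambda>\<xi>. \<integral>\<^sup>+\<omega>. ennreal ((norm (h2_fun F (Complex \<xi> \<omega>) - boundary_value F \<omega>))\<^sup>2) \<partial>lborel"
  have l0: "((\<lambda>\<xi>. ennreal (a\<^sup>2) * ?I \<xi>) \<longlongrightarrow> ennreal (a\<^sup>2) * 0) (at_right 0)"
    by (intro ennreal_tendsto_cmult boundary_L2_limit) auto
  have eq: "\<forall>\<^sub>F \<xi> in at_right 0. (\<integral>\<^sup>+\<omega>. ennreal ((norm (h2_fun (a *\<^sub>R F) (Complex \<xi> \<omega>) - (a *\<^sub>R boundary_value F \<omega>)))\<^sup>2) \<partial>lborel) = ennreal (a\<^sup>2) * ?I \<xi>"
    using eventually_at_right_less[of 0]
  proof eventually_elim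
    case (elim x)
    note h2_fun_measurable[OF elim, of F, measurable]
    show ?case
      by (simp add: power_mult_distrib ennreal_mult nn_integral_cmult flip: scaleR_diff_right)
  qed
  show "((\<lambda>\<xi>. \<integral>\<^sup>+\<omega>. ennreal ((norm (h2_fun (a *\<^sub>R F) (Complex \<xi> \<omega>) - (a *\<^sub>R boundary_value F \<omega>)))\<^sup>2) \<partial>lborel) \<longlongrightarrow> 0) (at_right 0)"
    using tendsto_cong[OF eq] l0 by simp
qed measurable

lemma boundary_square_integrable: "integrable lborel (\<lambda>\<omega>. (norm (boundary_value F \<omega>))\<^sup>2)"
proof -
  let ?I = "\<lambda>\<xi>. \<integral>\<^sup>+\<omega>. ennreal ((norm (h2_fun F (Complex \<xi> \<omega>) - boundary_value F \<omega>))\<^sup>2) \<partial>lborel"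
  have "\<forall>\<^sub>F \<xi> in at_right 0. ?I \<xi> < 1"
    using order_tendstoD(2)[OF boundary_L2_limit, of 1] by simp
  hence "\<forall>\<^sub>F \<xi> in at_right 0. ?I \<xi> < 1 \<and> \<xi> > 0"
    using eventually_at_right_less[of 0] by (rule eventually_conj)
  then obtain x where x: "?I x < 1" "x > 0"
    using eventually_happens'[OF trivial_limit_at_right_real] by blast
  obtain K where K: "(\<integral>\<^sup>+\<omega>. ennreal ((norm (h2_fun F (Complex x \<omega>)))\<^sup>2) \<partial>lborel) \<le> ennreal K"
    using h2_fun[of F] x(2) unfolding hardy_h2_alt by blast
  note h2_fun_measurable[OF x(2), of F, measurable]
  have "(\<integral>\<^sup>+\<omega>. ennreal ((norm (boundary_value F \<omega>))\<^sup>2) \<partial>lborel)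
      = (\<integral>\<^sup>+\<omega>. ennreal ((norm ((boundary_value F \<omega> - h2_fun F (Complex x \<omega>)) + h2_fun F (Complex x \<omega>)))\<^sup>2) \<partial>lborel)"
    by simp
  also have "\<dots> \<le> 2 * (\<integral>\<^sup>+\<omega>. ennreal ((norm (boundary_value F \<omega> - h2_fun F (Complex x \<omega>)))\<^sup>2) \<partial>lborel)
      + 2 * (\<integral>\<^sup>+\<omega>. ennreal ((norm (h2_fun F (Complex x \<omega>)))\<^sup>2) \<partial>lborel)"
    by (rule nn_integral_power2_norm_add_le) measurable
  also have "\<dots> \<le> 2 * 1 + 2 * ennreal K"
    using x(1) K by (intro add_mono mult_left_mono) (auto simp: norm_minus_commute)
  also have "\<dots> < \<infinity>" by (simp add: ennreal_mult_less_top)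
  finally show ?thesis by (intro integrableI_bounded) auto
qed

lemma integrable_boundary_inner: "integrable lborel (\<lambda>\<omega>. boundary_value F \<omega> \<bullet> boundary_value G \<omega>)"
proof (rule Bochner_Integration.integrable_bound)
  show "integrable lborel (\<lambda>\<omega>. (norm (boundary_value F \<omega>))\<^sup>2 + (norm (boundary_value G \<omega>))\<^sup>2)"
    by (intro Bochner_Integration.integrable_add boundary_square_integrable)
  show "AE \<omega> in lborel. norm (boundary_value F \<omega> \<bullet> boundary_value G \<omega>) \<le> norm ((norm (boundary_value F \<omega>))\<^sup>2 + (norm (boundary_value G \<omega>))\<^sup>2)"
  proof (rule AE_I2)
    fix \<omega>
    show "norm (boundary_value F \<omega> \<bullet> boundary_value G \<omega>) \<le> norm ((norm (boundary_value F \<omega>))\<^sup>2 + (norm (boundary_value G \<omega>))\<^sup>2)"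
      using Cauchy_Schwarz_ineq2[of "boundary_value F \<omega>" "boundary_value G \<omega>"]
        sum_squares_bound[of "norm (boundary_value F \<omega>)" "norm (boundary_value G \<omega>)"]
        zero_le_power2[of "norm (boundary_value F \<omega>)"] zero_le_power2[of "norm (boundary_value G \<omega>)"]
      unfolding real_norm_def by linarith
  qed
qed measurable

lemma trace_conj_transpose_mult:
  "trace (conj_transpose A ** B) = (\<Sum>j\<in>UNIV. \<Sum>i\<in>UNIV. cnj (A $ i $ j) * B $ i $ j)"
  by (simp add: trace_def conj_transpose_def matrix_matrix_mult_def)

lemma integrable_boundary_trace:
  "integrable lborel (\<lambda>\<omega>. trace (conj_transpose (boundary_value F \<omega>) ** boundary_value G \<omega>))"
  unfolding trace_conj_transpose_mult
proof (intro Bochner_Integration.integrable_sum)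
  fix i j
  show "integrable lborel (\<lambda>\<omega>. cnj (boundary_value F \<omega> $ i $ j) * boundary_value G \<omega> $ i $ j)"
  proof (rule Bochner_Integration.integrable_bound)
    show "integrable lborel (\<lambda>\<omega>. (norm (boundary_value F \<omega>))\<^sup>2 + (norm (boundary_value G \<omega>))\<^sup>2)"
      by (intro Bochner_Integration.integrable_add boundary_square_integrable)
    have nth: "(\<lambda>\<omega>. boundary_value H \<omega> $ i $ j) \<in> borel_measurable borel" for H :: "('a, 'b) h2"
    proof -
      have "(\<lambda>A :: complex^'a^'b. A $ i $ j) \<in> borel_measurable borel"
        by (intro borel_measurable_continuous_onI continuous_intros)
      from measurable_compose[OF boundary_measurable[of H] this] show ?thesis .
    qed
    have "cnj \<in> borel_measurable borel"
      by (intro borel_measurable_continuous_onI continuous_intros)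
    from measurable_compose[OF nth[of F] this] nth[of G]
    show "(\<lambda>\<omega>. cnj (boundary_value F \<omega> $ i $ j) * boundary_value G \<omega> $ i $ j) \<in> borel_measurable lborel"
      by simp
    show "AE \<omega> in lborel. norm (cnj (boundary_value F \<omega> $ i $ j) * boundary_value G \<omega> $ i $ j) \<le> norm ((norm (boundary_value F \<omega>))\<^sup>2 + (norm (boundary_value G \<omega>))\<^sup>2)"
    proof (rule AE_I2)
      fix \<omega>
      have "norm (cnj (boundary_value F \<omega> $ i $ j) * boundary_value G \<omega> $ i $ j) \<le> norm (boundary_value F \<omega>) * norm (boundary_value G \<omega>)"
        unfolding norm_mult complex_mod_cnj
        by (intro mult_mono order_trans[OF Finite_Cartesian_Product.norm_nth_le Finite_Cartesian_Product.norm_nth_le]) auto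
      thus "norm (cnj (boundary_value F \<omega> $ i $ j) * boundary_value G \<omega> $ i $ j) \<le> norm ((norm (boundary_value F \<omega>))\<^sup>2 + (norm (boundary_value G \<omega>))\<^sup>2)"
        using sum_squares_bound[of "norm (boundary_value F \<omega>)" "norm (boundary_value G \<omega>)"]
          zero_le_power2[of "norm (boundary_value F \<omega>)"] zero_le_power2[of "norm (boundary_value G \<omega>)"]
        unfolding real_norm_def by linarith
    qed
  qed
qed

lemma Re_h2_cinner: "Re (h2_cinner F G) = 1 / (2*pi) * (LINT \<omega>|lborel. boundary_value F \<omega> \<bullet> boundary_value G \<omega>)"
proof -
  have eq: "Re (trace (conj_transpose A ** B)) = A \<bullet> B" for A B :: "complex^'a^'b"
    unfolding trace_conj_transpose_mult inner_vec_def
    by (subst sum.swap) (simp add: inner_complex_def)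
  have "Re (h2_cinner F G) = 1 / (2*pi) * Re (LINT \<omega>|lborel. trace (conj_transpose (boundary_value F \<omega>) ** boundary_value G \<omega>))"
  proof -
    have "1 / (2 * of_real pi) = complex_of_real (1 / (2*pi))" by simp
    thus ?thesis unfolding h2_cinner_def by (simp only: times_complex.sel Re_complex_of_real Im_complex_of_real)
  qed
  also have "\<dots> = 1 / (2*pi) * (LINT \<omega>|lborel. boundary_value F \<omega> \<bullet> boundary_value G \<omega>)"
    by (subst integral_Re [symmetric, OF integrable_boundary_trace]) (simp add: eq)
  finally show ?thesis .
qed

lemma h2_eq_0_if_boundary_0:
  fixes F :: "('m::finite, 'p::finite) h2"
  assumes "AE \<omega> in lborel. boundary_value F \<omega> = 0"
  shows "F = 0"
proof (rule h2_eqI)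
  fix s
  let ?N = "\<lambda>x. \<integral>\<^sup>+t. ennreal ((norm (h2_fun F (Complex x t)))\<^sup>2) \<partial>lborel"
  have "(\<integral>\<^sup>+\<omega>. ennreal ((norm (h2_fun F (Complex \<xi> \<omega>) - boundary_value F \<omega>))\<^sup>2) \<partial>lborel) = ?N \<xi>" for \<xi>
    by (rule nn_integral_cong_AE) (use assms in eventually_elim, simp)
  with boundary_L2_limit[of F] have lim: "(?N \<longlongrightarrow> 0) (at_right 0)" by simp
  have N0: "?N x = 0" if "x > 0" for x
  proof -
    have "\<forall>\<^sub>F \<xi> in at_right 0. \<xi> < x" using that by (auto simp: eventually_at_right_field)
    hence "\<forall>\<^sub>F \<xi> in at_right 0. ?N x \<le> ?N \<xi>"
      using eventually_at_right_less[of 0] by eventually_elim (use hardy_h2_antimono[OF h2_fun[of F]] in auto)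
    hence "?N x \<le> 0" by (intro tendsto_lowerbound[OF lim]) auto
    thus ?thesis by simp
  qed
  show "h2_fun F s = h2_fun 0 s"
  proof (cases "Re s > 0")
    case True
    note [measurable] = h2_fun_measurable[OF True, of F]
    have ae: "AE t in lborel. h2_fun F (Complex (Re s) t) = 0"
      using N0[OF True] by (subst (asm) nn_integral_0_iff_AE) (auto elim!: eventually_mono)
    have "h2_fun F s $ i $ j = 0" for i j
    proof -
      have cont: "continuous_on UNIV (\<lambda>t. h2_fun F (Complex (Re s) t) $ i $ j)"
        by (rule hardy_h2_continuous[OF h2_fun True])
      let ?N = "{t. h2_fun F (Complex (Re s) t) $ i $ j \<noteq> 0}"
      have op: "open ?N"
        by (intro open_Collect_neq cont continuous_intros)
      have "?N \<in> null_sets lborel"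
        by (subst AE_iff_null_sets) (use op ae in \<open>auto elim!: eventually_mono\<close>)
      hence "negligible ?N"
        by (simp add: negligible_iff_null_sets null_sets_completionI)
      with op have "?N = {}" using open_not_negligible by blast
      hence "h2_fun F (Complex (Re s) (Im s)) $ i $ j = 0" by blast
      thus ?thesis by simp
    qed
    thus ?thesis by (simp add: vec_eq_iff)
  next
    case False
    thus ?thesis using h2_fun[of F] by (simp add: hardy_h2_def)
  qed
qed

instantiation h2 :: (finite, finite) real_inner
begin
definition inner_h2 :: "('a, 'b) h2 \<Rightarrow> ('a, 'b) h2 \<Rightarrow> real" where
  "F \<bullet> G = Re (h2_cinner F G)"
definition norm_h2 :: "('a, 'b) h2 \<Rightarrow> real" where
  "norm (F :: ('a, 'b) h2) = sqrt (F \<bullet> F)"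
definition sgn_h2 :: "('a, 'b) h2 \<Rightarrow> ('a, 'b) h2" where
  "sgn (F :: ('a, 'b) h2) = F /\<^sub>R norm F"
definition dist_h2 :: "('a, 'b) h2 \<Rightarrow> ('a, 'b) h2 \<Rightarrow> real" where
  "dist (F :: ('a, 'b) h2) G = norm (F - G)"
definition uniformity_h2 :: "(('a, 'b) h2 \<times> ('a, 'b) h2) filter" where
  "(uniformity :: (('a, 'b) h2 \<times> ('a, 'b) h2) filter) = (INF e\<in>{0 <..}. principal {(F, G). dist F G < e})"
definition open_h2 :: "('a, 'b) h2 set \<Rightarrow> bool" where
  "open (U :: ('a, 'b) h2 set) \<longleftrightarrow> (\<forall>F\<in>U. eventually (\<lambda>(F', G). F' = F \<longrightarrow> G \<in> U) uniformity)"

instance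
proof
  fix F G H :: "('a, 'b) h2" and a :: real
  show "dist F G = norm (F - G)" by (rule dist_h2_def)
  show "sgn F = F /\<^sub>R norm F" by (rule sgn_h2_def)
  show "uniformity = (INF e\<in>{0<..}. principal {(F, G :: ('a, 'b) h2). dist F G < e})"
    by (rule uniformity_h2_def)
  show "open U \<longleftrightarrow> (\<forall>F\<in>U. eventually (\<lambda>(F', G). F' = F \<longrightarrow> G \<in> U) uniformity)" for U :: "('a, 'b) h2 set"
    by (rule open_h2_def)
  show "norm F = sqrt (F \<bullet> F)" by (rule norm_h2_def)
  show "F \<bullet> G = G \<bullet> F"
    by (simp add: inner_h2_def Re_h2_cinner inner_commute)
  show "(F + G) \<bullet> H = F \<bullet> H + G \<bullet> H"
  proof -
    have "(LINT \<omega>|lborel. boundary_value (F + G) \<omega> \<bullet> boundary_value H \<omega>)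
        = (LINT \<omega>|lborel. boundary_value F \<omega> \<bullet> boundary_value H \<omega> + boundary_value G \<omega> \<bullet> boundary_value H \<omega>)"
      by (rule integral_cong_AE)
         (measurable, use boundary_add[of F G] in eventually_elim, simp add: inner_add_left)
    also have "\<dots> = (LINT \<omega>|lborel. boundary_value F \<omega> \<bullet> boundary_value H \<omega>) + (LINT \<omega>|lborel. boundary_value G \<omega> \<bullet> boundary_value H \<omega>)"
      by (intro Bochner_Integration.integral_add integrable_boundary_inner)
    finally show ?thesis by (simp add: inner_h2_def Re_h2_cinner add_divide_distrib)
  qed
  show "(a *\<^sub>R F) \<bullet> G = a * (F \<bullet> G)"
  proof -
    have "(LINT \<omega>|lborel. boundary_value (a *\<^sub>R F) \<omega> \<bullet> boundary_value G \<omega>)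
        = (LINT \<omega>|lborel. a * (boundary_value F \<omega> \<bullet> boundary_value G \<omega>))"
      by (rule integral_cong_AE)
         (measurable, use boundary_scaleR[of a F] in eventually_elim, simp)
    thus ?thesis by (simp add: inner_h2_def Re_h2_cinner)
  qed
  have FF: "F \<bullet> F = 1 / (2*pi) * (LINT \<omega>|lborel. (norm (boundary_value F \<omega>))\<^sup>2)"
    by (simp add: inner_h2_def Re_h2_cinner power2_norm_eq_inner)
  show "0 \<le> F \<bullet> F" unfolding FF by simp
  show "F \<bullet> F = 0 \<longleftrightarrow> F = 0"
  proof
    assume "F \<bullet> F = 0"
    hence "(LINT \<omega>|lborel. (norm (boundary_value F \<omega>))\<^sup>2) = 0" unfolding FF by simp
    hence "AE \<omega> in lborel. (norm (boundary_value F \<omega>))\<^sup>2 = 0"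
      by (subst (asm) integral_nonneg_eq_0_iff_AE) (auto intro: boundary_square_integrable)
    thus "F = 0" by (intro h2_eq_0_if_boundary_0) (auto elim!: eventually_mono)
  next
    assume "F = 0"
    have "AE \<omega> in lborel. boundary_value (0 :: ('a, 'b) h2) \<omega> = 0"
      by (rule boundary_unique) simp_all
    hence "(LINT \<omega>|lborel. (norm (boundary_value F \<omega>))\<^sup>2) = (LINT \<omega>|(lborel :: real measure). 0)"
      unfolding \<open>F = 0\<close> by (intro integral_cong_AE) (auto elim!: eventually_mono)
    thus "F \<bullet> F = 0" unfolding FF by simp
  qed
qed
end

section \<open>State-space realizations\<close>

type_synonym ('k, 'r, 'm, 'p) triple = "('k^'r^'r) \<times> ('k^'m^'r) \<times> ('k^'r^'p)"

text \<open>Below, \<open>e\<close> is the inclusion of the scalar field \<open>'k\<close> into the complex numbers: the identity for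
complex systems and \<^const>\<open>complex_of_real\<close> for real ones.\<close>

definition map_triple :: "('k \<Rightarrow> 'l) \<Rightarrow> ('k, 'r::finite, 'm::finite, 'p::finite) triple \<Rightarrow> ('l, 'r, 'm, 'p) triple" where
  "map_triple e = (\<lambda>(A, B, C). (map_matrix e A, map_matrix e B, map_matrix e C))"

definition hurwitz :: "complex^'n^'n \<Rightarrow> bool" where
  "hurwitz A \<longleftrightarrow> (\<forall>l v. v \<noteq> 0 \<and> A *v v = l *s v \<longrightarrow> Re l < 0)"

definition transfer_function :: "(complex, 'r::finite, 'm::finite, 'p::finite) triple \<Rightarrow> complex \<Rightarrow> complex^'m^'p" where
  "transfer_function = (\<lambda>(A, B, C) s. C ** matrix_inv (mat s - A) ** B)"

definition strictly_proper_on_rhp :: "(complex \<Rightarrow> complex) \<Rightarrow> bool" where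
  "strictly_proper_on_rhp g \<longleftrightarrow> g holomorphic_on {s. 0 < Re s} \<and>
     (\<exists>K. \<forall>s. 0 < Re s \<longrightarrow> norm (g s) \<le> K / (1 + norm s))"

lemma strictly_proper_on_rhp_0: "strictly_proper_on_rhp (\<lambda>s. 0)"
  unfolding strictly_proper_on_rhp_def by (auto intro!: exI[of _ 0])

lemma strictly_proper_on_rhp_cmult:
  assumes "strictly_proper_on_rhp g"
  shows "strictly_proper_on_rhp (\<lambda>s. c * g s)"
proof -
  obtain K where K: "\<And>s. 0 < Re s \<Longrightarrow> norm (g s) \<le> K / (1 + norm s)"
    using assms unfolding strictly_proper_on_rhp_def by blast
  have "norm (c * g s) \<le> norm c * K / (1 + norm s)" if "0 < Re s" for s
    using mult_left_mono[OF K[OF that], of "norm c"] by (simp add: norm_mult)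
  thus ?thesis using assms unfolding strictly_proper_on_rhp_def by (auto intro!: holomorphic_intros)
qed

lemma strictly_proper_on_rhp_add:
  assumes "strictly_proper_on_rhp f" "strictly_proper_on_rhp g"
  shows "strictly_proper_on_rhp (\<lambda>s. f s + g s)"
proof -
  obtain K L where K: "\<And>s. 0 < Re s \<Longrightarrow> norm (f s) \<le> K / (1 + norm s)"
    and L: "\<And>s. 0 < Re s \<Longrightarrow> norm (g s) \<le> L / (1 + norm s)"
    using assms unfolding strictly_proper_on_rhp_def by blast
  have "norm (f s + g s) \<le> (K + L) / (1 + norm s)" if "0 < Re s" for s
    using norm_triangle_le[of "f s" "g s"] K[OF that] L[OF that] by (simp add: add_divide_distrib)
  thus ?thesis using assms unfolding strictly_proper_on_rhp_def by (auto intro!: holomorphic_intros)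
qed

lemma strictly_proper_on_rhp_sum:
  assumes "finite I" "\<And>i. i \<in> I \<Longrightarrow> strictly_proper_on_rhp (g i)"
  shows "strictly_proper_on_rhp (\<lambda>s. \<Sum>i\<in>I. g i s)"
  using assms by (induction I) (auto intro: strictly_proper_on_rhp_0 strictly_proper_on_rhp_add)

lemma hurwitz_imp_invertible:
  assumes "hurwitz (A :: complex^'n^'n)" "0 \<le> Re s"
  shows "invertible (mat s - A)"
  unfolding invertible_left_inverse matrix_left_invertible_ker
proof (intro allI impI, rule ccontr)
  fix v :: "complex^'n" assume v: "(mat s - A) *v v = 0" "v \<noteq> 0"
  have "mat s *v v = s *s v"
    by (simp add: vec_eq_iff matrix_vector_mult_def mat_def if_distrib if_distribR cong: if_cong)
  hence "A *v v = s *s v" using v(1) by (simp add: matrix_vector_mult_diff_rdistrib)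
  thus False using assms v(2) unfolding hurwitz_def by fastforce
qed

lemma strictly_proper_resolvent:
  assumes A: "hurwitz (A :: complex^'r^'r)"
  shows "strictly_proper_on_rhp (\<lambda>s. matrix_inv (mat s - A) $ k $ l)"
proof -
  define N where "N = (\<lambda>s. mat s - A)"
  define b :: "complex^'r" where "b = axis l 1"
  define x where "x = (\<lambda>s. column l (matrix_inv (N s)))"
  have inv: "invertible (N s)" if "0 \<le> Re s" for s
    using hurwitz_imp_invertible[OF A that] by (simp add: N_def)
  hence det: "det (N s) \<noteq> 0" if "0 \<le> Re s" for s
    using that by (simp add: invertible_det_nz)
  have Nx: "N s *v x s = b" if "0 \<le> Re s" for s
  proof -
    have "N s ** matrix_inv (N s) = mat 1" using inv[OF that] unfolding invertible_def matrix_inv_def by (rule someI2_ex) simp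
    moreover have "x s = matrix_inv (N s) *v b" by (simp add: x_def b_def vec_eq_iff column_def matrix_vector_mult_def axis_def if_distrib cong: if_cong)
    ultimately show ?thesis by (simp add: matrix_vector_mul_assoc)
  qed
  have holN: "(\<lambda>s. N s $ i $ j) holomorphic_on S" for i j S
    by (cases "i = j") (auto simp: N_def mat_def intro!: holomorphic_intros)
  have holdet: "(\<lambda>s. det (M s)) holomorphic_on S"
    if "\<And>i j. (\<lambda>s. M s $ i $ j) holomorphic_on S" for M :: "complex \<Rightarrow> complex^'r^'r" and S
    unfolding det_def by (intro holomorphic_intros that)
  define y where "y = (\<lambda>s. det (\<chi> i j. if j = k then b $ i else N s $ i $ j) / det (N s))"
  have xy: "matrix_inv (mat s - A) $ k $ l = y s" if "0 \<le> Re s" for s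
  proof -
    have "matrix_inv (mat s - A) $ k $ l = x s $ k" by (simp add: x_def N_def column_def)
    thus ?thesis using Nx[OF that] unfolding cramer[OF det[OF that]] y_def by simp
  qed
  have "(\<lambda>s. det (\<chi> i j. if j = k then b $ i else N s $ i $ j)) holomorphic_on UNIV"
  proof (rule holdet)
    show "(\<lambda>s. (\<chi> i j. if j = k then b $ i else N s $ i $ j) $ i $ j) holomorphic_on UNIV" for i j
      by (cases "j = k") (auto intro: holN)
  qed
  moreover have "(\<lambda>s. det (N s)) holomorphic_on UNIV"
    by (rule holdet) (rule holN)
  ultimately have hol0: "y holomorphic_on {s. 0 \<le> Re s}"
    unfolding y_def by (intro holomorphic_on_divide) (auto intro: holomorphic_on_subset simp: det)
  hence holy: "y holomorphic_on {s. 0 < Re s}" and conty: "continuous_on {s. 0 \<le> Re s} y"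
    by (auto intro: holomorphic_on_subset holomorphic_on_imp_continuous_on)
  obtain a where a: "a > 0" "\<And>v. norm (A *v v) \<le> norm v * a"
    using bounded_linear.pos_bounded[OF matrix_vector_mul_bounded_linear[of A]] by blast
  define R where "R = 2 * a + 1"
  have far: "norm (y s) \<le> 4 * norm b / (1 + norm s)" if s: "0 \<le> Re s" "norm s \<ge> R" for s
  proof -
    have "mat s *v x s = s *s x s"
      by (simp add: vec_eq_iff matrix_vector_mult_def mat_def if_distrib if_distribR cong: if_cong)
    hence e1: "s *s x s = A *v x s + b"
      using Nx[OF s(1)] by (simp add: N_def matrix_vector_mult_diff_rdistrib algebra_simps)
    have e2: "norm (s *s x s) = norm s * norm (x s)"
      by (simp add: norm_vec_def norm_mult L2_set_right_distrib)
    have "norm s * norm (x s) \<le> norm (x s) * a + norm b"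
      unfolding e2[symmetric] e1 using norm_triangle_ineq[of "A *v x s" b] a(2)[of "x s"] by linarith
    moreover have "norm (x s) + 2 * (norm (x s) * a) \<le> norm s * norm (x s)"
      using mult_right_mono[OF s(2), of "norm (x s)"] by (simp add: R_def algebra_simps)
    moreover have "0 \<le> norm (x s) * a" using a(1) by simp
    ultimately have "norm (x s) + norm s * norm (x s) \<le> 4 * norm b"
      using norm_ge_zero[of "x s"] norm_ge_zero[of b] by linarith
    hence "(1 + norm s) * norm (x s) \<le> 4 * norm b"
      by (simp add: algebra_simps)
    moreover have "norm (y s) \<le> norm (x s)"
      using xy[OF s(1)] Finite_Cartesian_Product.norm_nth_le[of "x s" k] by (simp add: x_def N_def column_def)
    ultimately have "(1 + norm s) * norm (y s) \<le> 4 * norm b"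
      by (meson add_nonneg_nonneg mult_left_mono norm_ge_zero order_trans zero_le_one)
    thus ?thesis by (simp add: pos_le_divide_eq add_pos_nonneg mult.commute)
  qed
  have "compact (y ` ({s. 0 \<le> Re s} \<inter> cball 0 R))"
    by (intro compact_continuous_image continuous_on_subset[OF conty] closed_Int_compact closed_halfspace_Re_ge) auto
  then obtain K where "\<forall>z\<in>y ` ({s. 0 \<le> Re s} \<inter> cball 0 R). norm z \<le> K"
    using compact_imp_bounded bounded_iff by blast
  hence K: "norm (y s) \<le> K" if "0 \<le> Re s" "norm s \<le> R" for s
    using that by auto
  have "norm (y s) \<le> max (4 * norm b) (K * (1 + R)) / (1 + norm s)" if s: "0 \<le> Re s" for s
  proof (cases "norm s \<ge> R")
    case True
    have "4 * norm b / (1 + norm s) \<le> max (4 * norm b) (K * (1 + R)) / (1 + norm s)"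
      by (intro divide_right_mono) auto
    thus ?thesis using far[OF s True] by linarith
  next
    case False
    have "norm (y s) * (1 + norm s) \<le> K * (1 + R)"
      using K[OF s] False by (intro mult_mono) (auto intro: order_trans[OF norm_ge_zero])
    also have "\<dots> \<le> max (4 * norm b) (K * (1 + R))" by simp
    finally show ?thesis by (simp add: pos_le_divide_eq add_pos_nonneg)
  qed
  with holy have "strictly_proper_on_rhp y"
    unfolding strictly_proper_on_rhp_def by (meson less_imp_le)
  moreover have "strictly_proper_on_rhp (\<lambda>s. matrix_inv (mat s - A) $ k $ l) \<longleftrightarrow> strictly_proper_on_rhp y"
    unfolding strictly_proper_on_rhp_def
    by (intro conj_cong holomorphic_cong refl) (auto simp: xy)
  ultimately show ?thesis by simp
qed

lemma nn_integral_inverse_square_less_top: "(\<integral>\<^sup>+t. ennreal (1 / (1 + t\<^sup>2)) \<partial>lborel) < \<infinity>"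
proof -
  have half: "(\<integral>\<^sup>+t. ennreal (1 / (1 + t\<^sup>2)) * indicator {0..} t \<partial>lborel) = ennreal (pi/2 - arctan 0)"
    by (rule nn_integral_FTC_atLeast)
       (auto intro!: derivative_eq_intros tendsto_arctan_at_top simp: inverse_eq_divide add_nonneg_eq_0_iff)
  have refl: "(\<integral>\<^sup>+t. ennreal (1 / (1 + t\<^sup>2)) * indicator {..0} t \<partial>lborel) = (\<integral>\<^sup>+t. ennreal (1 / (1 + t\<^sup>2)) * indicator {0..} t \<partial>lborel)"
  proof -
    have "indicator {..0} (- t) = (indicator {0..} t :: ennreal)" for t :: real by (auto simp: indicator_def)
    thus ?thesis
      using nn_integral_real_affine[of "\<lambda>t. ennreal (1 / (1 + t\<^sup>2)) * indicator {..0} t" "-1" 0] by simp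
  qed
  have "(\<integral>\<^sup>+t. ennreal (1 / (1 + t\<^sup>2)) \<partial>lborel)
      \<le> (\<integral>\<^sup>+t. ennreal (1 / (1 + t\<^sup>2)) * indicator {0..} t + ennreal (1 / (1 + t\<^sup>2)) * indicator {..0} t \<partial>lborel)"
    by (intro nn_integral_mono) (auto simp: indicator_def)
  also have "\<dots> = ennreal (pi/2 - arctan 0) + ennreal (pi/2 - arctan 0)"
    by (subst nn_integral_add) (auto simp: half refl)
  also have "\<dots> < \<infinity>" by simp
  finally show ?thesis .
qed

lemma transfer_in_hardy_h2:
  fixes A :: "complex^'r^'r" and B :: "complex^'m^'r" and C :: "complex^'r^'p"
  assumes A: "hurwitz A"
  shows "(\<lambda>s. if 0 < Re s then transfer_function (A, B, C) s else 0) \<in> hardy_h2"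
proof -
  let ?F = "\<lambda>s. if 0 < Re s then transfer_function (A, B, C) s else 0"
  have "strictly_proper_on_rhp (\<lambda>s. \<Sum>q\<in>UNIV. \<Sum>k\<in>UNIV. (C $ i $ k * B $ q $ j) * matrix_inv (mat s - A) $ k $ q)" for i j
    by (intro strictly_proper_on_rhp_sum strictly_proper_on_rhp_cmult strictly_proper_resolvent A) auto
  moreover have "transfer_function (A, B, C) s $ i $ j = (\<Sum>q\<in>UNIV. \<Sum>k\<in>UNIV. (C $ i $ k * B $ q $ j) * matrix_inv (mat s - A) $ k $ q)" for s i j
    by (simp add: transfer_function_def matrix_matrix_mult_def sum_distrib_right sum_distrib_left mult_ac)
  ultimately have sp: "strictly_proper_on_rhp (\<lambda>s. transfer_function (A, B, C) s $ i $ j)" for i j by simp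
  have "\<forall>i j. \<exists>K. \<forall>s. 0 < Re s \<longrightarrow> norm (transfer_function (A, B, C) s $ i $ j) \<le> K / (1 + norm s)"
    using sp unfolding strictly_proper_on_rhp_def by blast
  then obtain K where K: "\<And>i j s. 0 < Re s \<Longrightarrow> norm (transfer_function (A, B, C) s $ i $ j) \<le> K i j / (1 + norm s)"
    by metis
  define L where "L = (\<Sum>i\<in>UNIV. \<Sum>j\<in>UNIV. (K i j)\<^sup>2)"
  have L0: "L \<ge> 0" by (simp add: L_def sum_nonneg)
  have bound: "(norm (?F (Complex x t)))\<^sup>2 \<le> L * (1 / (1 + t\<^sup>2))" if x: "x > 0" for x t
  proof -
    let ?s = "Complex x t"
    have "(norm (transfer_function (A, B, C) ?s))\<^sup>2 \<le> (\<Sum>i\<in>UNIV. \<Sum>j\<in>UNIV. (K i j / (1 + norm ?s))\<^sup>2)"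
      unfolding power2_norm_matrix by (intro sum_mono power_mono K) (use x in auto)
    also have "\<dots> = L * (1 / (1 + norm ?s)\<^sup>2)"
      by (simp add: L_def power_divide sum_divide_distrib)
    also have "\<dots> \<le> L * (1 / (1 + t\<^sup>2))"
    proof (intro mult_left_mono divide_left_mono L0)
      have "t\<^sup>2 \<le> (norm ?s)\<^sup>2" by (simp add: cmod_power2)
      thus "1 + t\<^sup>2 \<le> (1 + norm ?s)\<^sup>2"
        using norm_ge_zero[of ?s] unfolding power2_sum power_one by linarith
    qed (auto intro!: mult_pos_pos zero_less_power add_pos_nonneg)
    finally show ?thesis using x by simp
  qed
  show ?thesis
    unfolding hardy_h2_alt
  proof (intro conjI allI impI)
    fix i j
    have "(\<lambda>s. transfer_function (A, B, C) s $ i $ j) holomorphic_on {s. 0 < Re s}"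
      using sp unfolding strictly_proper_on_rhp_def by blast
    thus "(\<lambda>s. ?F s $ i $ j) holomorphic_on {s. 0 < Re s}"
      by (rule holomorphic_transform) auto
  next
    obtain J where J: "(\<integral>\<^sup>+t. ennreal (1 / (1 + t\<^sup>2)) \<partial>lborel) = ennreal J" "J \<ge> 0"
      using nn_integral_inverse_square_less_top by (auto simp: less_top_ennreal)
    show "\<exists>K. \<forall>\<xi>>0. (\<integral>\<^sup>+\<omega>. ennreal ((norm (?F (Complex \<xi> \<omega>)))\<^sup>2) \<partial>lborel) \<le> ennreal K"
    proof (intro exI allI impI)
      fix x :: real assume x: "x > 0"
      have "(\<integral>\<^sup>+\<omega>. ennreal ((norm (?F (Complex x \<omega>)))\<^sup>2) \<partial>lborel) \<le> (\<integral>\<^sup>+\<omega>. ennreal L * ennreal (1 / (1 + \<omega>\<^sup>2)) \<partial>lborel)"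
        using bound[OF x] L0 by (intro nn_integral_mono) (simp flip: ennreal_mult add: ennreal_leI)
      also have "\<dots> = ennreal L * ennreal J" by (simp add: nn_integral_cmult J)
      also have "\<dots> = ennreal (L * J)" using L0 J by (simp add: ennreal_mult)
      finally show "(\<integral>\<^sup>+\<omega>. ennreal ((norm (?F (Complex x \<omega>)))\<^sup>2) \<partial>lborel) \<le> ennreal (L * J)" .
    qed
  qed auto
qed

text \<open>A realization of order \<open>k \<le> r\<close> is encoded as a triple of order \<open>r\<close> that is padded with zeros
outside the rows and columns (of states) in an index set of cardinality \<open>k\<close>. The padding
contributes nothing to the transfer function. Only orders below \<open>r\<close> matter for minimality of a
triple of order \<open>r\<close>.\<close>

definition supported_on :: "'r set \<Rightarrow> ('k::zero, 'r::finite, 'm::finite, 'p::finite) triple \<Rightarrow> bool" where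
  "supported_on I = (\<lambda>(A, B, C).
     (\<forall>i j. A $ i $ j \<noteq> 0 \<longrightarrow> i \<in> I \<and> j \<in> I) \<and>
     (\<forall>i j. B $ i $ j \<noteq> 0 \<longrightarrow> i \<in> I) \<and>
     (\<forall>i j. C $ i $ j \<noteq> 0 \<longrightarrow> j \<in> I))"

text \<open>Equality as rational functions: the excluded points are the finitely many eigenvalues of the
two state matrices (including 0 for a padded one), where the formula for the transfer function
is not meaningful.\<close>

definition same_transfer ::
    "(complex, 'r::finite, 'm::finite, 'p::finite) triple \<Rightarrow> (complex, 'r, 'm, 'p) triple \<Rightarrow> bool" where
  "same_transfer X Y \<longleftrightarrow>
     (\<forall>s. invertible (mat s - fst X) \<and> invertible (mat s - fst Y) \<longrightarrow> transfer_function X s = transfer_function Y s)"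

definition minimal :: "('k::zero \<Rightarrow> complex) \<Rightarrow> ('k, 'r::finite, 'm::finite, 'p::finite) triple \<Rightarrow> bool" where
  "minimal e X \<longleftrightarrow>
     \<not> (\<exists>I Y. card I < CARD('r) \<and> supported_on I Y \<and> same_transfer (map_triple e X) (map_triple e Y))"

definition stable_minimal :: "('k::zero \<Rightarrow> complex) \<Rightarrow> ('k, 'r::finite, 'm::finite, 'p::finite) triple set" where
  "stable_minimal e = {X. minimal e X \<and> hurwitz (fst (map_triple e X))}"

definition transfer_h2 :: "('k \<Rightarrow> complex) \<Rightarrow> ('k, 'r::finite, 'm::finite, 'p::finite) triple \<Rightarrow> ('m, 'p) h2" where
  "transfer_h2 e X = Abs_h2 (\<lambda>s. if 0 < Re s then transfer_function (map_triple e X) s else 0)"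

lemma h2_fun_transfer_h2:
  assumes "hurwitz (fst (map_triple e X))" "0 < Re s"
  shows "h2_fun (transfer_h2 e X) s = transfer_function (map_triple e X) s"
proof -
  obtain A B C where X: "map_triple e X = (A, B, C)" by (cases "map_triple e X")
  have "(\<lambda>s. if 0 < Re s then transfer_function (A, B, C) s else 0) \<in> hardy_h2"
    using assms(1) by (intro transfer_in_hardy_h2) (simp add: X)
  thus ?thesis
    unfolding transfer_h2_def X using assms(2) by (simp add: Abs_h2_inverse)
qed

definition h2_real :: "('m::finite, 'p::finite) h2 set" where
  "h2_real = {H. \<forall>s. 0 < Re s \<longrightarrow> map_matrix cnj (h2_fun H s) = h2_fun H (cnj s)}"

definition state_space_equivalent ::
    "('k::semiring_1, 'r::finite, 'm::finite, 'p::finite) triple \<Rightarrow> ('k, 'r, 'm, 'p) triple \<Rightarrow> bool" where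
  "state_space_equivalent = (\<lambda>(A, B, C) Y.
     \<exists>T. invertible T \<and> Y = (T ** A ** matrix_inv T, T ** B, C ** matrix_inv T))"

section \<open>Smooth maps, manifolds and embedded submanifolds\<close>

text \<open>Differentiability over \<open>'k\<close>: \<open>sa\<close> and \<open>sb\<close> are the multiplications by scalars in \<open>'k\<close> on domain
and codomain, and the real Frechet derivative has to commute with them, so that for complex
scalars the maps are complex differentiable. As the domain is finite-dimensional, a derivative
is of class $C^n$ iff it is so in each direction.\<close>

primrec ck_on ::
    "nat \<Rightarrow> ('k \<Rightarrow> 'a::euclidean_space \<Rightarrow> 'a) \<Rightarrow> ('k \<Rightarrow> 'b::real_normed_vector \<Rightarrow> 'b) \<Rightarrow>
       'a set \<Rightarrow> ('a \<Rightarrow> 'b) \<Rightarrow> bool" where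
  "ck_on 0 sa sb U f \<longleftrightarrow> continuous_on U f"
| "ck_on (Suc n) sa sb U f \<longleftrightarrow>
     (\<exists>D. (\<forall>x\<in>U. (f has_derivative D x) (at x) \<and> (\<forall>c v. D x (sa c v) = sb c (D x v))) \<and>
          (\<forall>v. ck_on n sa sb U (\<lambda>x. D x v)))"

definition smooth_on ::
    "('k \<Rightarrow> 'a::euclidean_space \<Rightarrow> 'a) \<Rightarrow> ('k \<Rightarrow> 'b::real_normed_vector \<Rightarrow> 'b) \<Rightarrow> 'a set \<Rightarrow> ('a \<Rightarrow> 'b) \<Rightarrow> bool" where
  "smooth_on sa sb U f \<longleftrightarrow> open U \<and> (\<forall>n. ck_on n sa sb U f)"

abbreviation differential :: "('a::euclidean_space \<Rightarrow> 'b::real_normed_vector) \<Rightarrow> 'a \<Rightarrow> 'a \<Rightarrow> 'b" where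
  "differential f x \<equiv> frechet_derivative f (at x)"

type_synonym ('x, 'a) chart = "'x set \<times> ('x \<Rightarrow> 'a)"

definition is_chart :: "'x topology \<Rightarrow> ('x, 'a::euclidean_space) chart \<Rightarrow> bool" where
  "is_chart X = (\<lambda>(U, \<phi>). openin X U \<and> open (\<phi> ` U) \<and>
     homeomorphic_map (subtopology X U) (top_of_set (\<phi> ` U)) \<phi>)"

definition smooth_manifold ::
    "('k \<Rightarrow> 'a::euclidean_space \<Rightarrow> 'a) \<Rightarrow> 'x topology \<Rightarrow> ('x, 'a) chart set \<Rightarrow> bool" where
  "smooth_manifold sa X \<A> \<longleftrightarrow>
     Hausdorff_space X \<and> second_countable X \<and>
     (\<Union>(U, \<phi>)\<in>\<A>. U) = topspace X \<and> (\<forall>c\<in>\<A>. is_chart X c) \<and>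
     (\<forall>(U, \<phi>)\<in>\<A>. \<forall>(V, \<psi>)\<in>\<A>. smooth_on sa sa (\<phi> ` (U \<inter> V)) (\<psi> \<circ> inv_into U \<phi>))"

text \<open>The target of the maps below is a closed \<open>'k\<close>-linear subspace \<open>E\<close> of a normed space, with the
identity chart. Derivatives of maps into \<open>E\<close> automatically take values in \<open>E\<close>.\<close>

definition smooth_immersion ::
    "('k \<Rightarrow> 'a::euclidean_space \<Rightarrow> 'a) \<Rightarrow> ('k \<Rightarrow> 'b::real_normed_vector \<Rightarrow> 'b) \<Rightarrow>
       'x topology \<Rightarrow> ('x, 'a) chart set \<Rightarrow> 'b set \<Rightarrow> ('x \<Rightarrow> 'b) \<Rightarrow> bool" where
  "smooth_immersion sa sb X \<A> E f \<longleftrightarrow>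
     f ` topspace X \<subseteq> E \<and>
     (\<forall>(U, \<phi>)\<in>\<A>. smooth_on sa sb (\<phi> ` U) (f \<circ> inv_into U \<phi>) \<and>
        (\<forall>y\<in>\<phi> ` U. inj (differential (f \<circ> inv_into U \<phi>) y) \<and>
           closedin (top_of_set E) (range (differential (f \<circ> inv_into U \<phi>) y))))"

definition smooth_embedding ::
    "('k \<Rightarrow> 'a::euclidean_space \<Rightarrow> 'a) \<Rightarrow> ('k \<Rightarrow> 'b::real_normed_vector \<Rightarrow> 'b) \<Rightarrow>
       'x topology \<Rightarrow> ('x, 'a) chart set \<Rightarrow> 'b set \<Rightarrow> ('x \<Rightarrow> 'b) \<Rightarrow> bool" where
  "smooth_embedding sa sb X \<A> E f \<longleftrightarrow>
     smooth_immersion sa sb X \<A> E f \<and> homeomorphic_map X (top_of_set (f ` topspace X)) f"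

text \<open>\<open>N\<close> is a manifold with topology \<open>X\<close> and atlas \<open>\<A>\<close>; the condition \<open>X = top_of_set N\<close> is that the
manifold topology is the subspace topology.\<close>

definition embedded_submanifold ::
    "('k \<Rightarrow> 'a::euclidean_space \<Rightarrow> 'a) \<Rightarrow> ('k \<Rightarrow> 'b::real_normed_vector \<Rightarrow> 'b) \<Rightarrow>
       'b set \<Rightarrow> 'b set \<Rightarrow> 'b topology \<Rightarrow> ('b, 'a) chart set \<Rightarrow> bool" where
  "embedded_submanifold sa sb E N X \<A> \<longleftrightarrow>
     N \<subseteq> E \<and> X = top_of_set N \<and> smooth_manifold sa X \<A> \<and> smooth_embedding sa sb X \<A> E (\<lambda>x. x)"

section \<open>The quotient manifold structure\<close>

definition quotient_topology :: "'a::topological_space set \<Rightarrow> ('a \<Rightarrow> 'x) \<Rightarrow> 'x topology" where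
  "quotient_topology S q = topology (\<lambda>U. U \<subseteq> q ` S \<and> openin (top_of_set S) {x \<in> S. q x \<in> U})"

lemma openin_quotient_topology:
  "openin (quotient_topology S q) U \<longleftrightarrow> U \<subseteq> q ` S \<and> openin (top_of_set S) {x \<in> S. q x \<in> U}"
proof -
  have "istopology (\<lambda>U. U \<subseteq> q ` S \<and> openin (top_of_set S) {x \<in> S. q x \<in> U})"
    unfolding istopology_def
  proof (intro conjI allI impI)
    fix U V assume "U \<subseteq> q ` S \<and> openin (top_of_set S) {x \<in> S. q x \<in> U}"
      "V \<subseteq> q ` S \<and> openin (top_of_set S) {x \<in> S. q x \<in> V}"
    moreover have "{x \<in> S. q x \<in> U \<inter> V} = {x \<in> S. q x \<in> U} \<inter> {x \<in> S. q x \<in> V}" by auto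
    ultimately show "U \<inter> V \<subseteq> q ` S" "openin (top_of_set S) {x \<in> S. q x \<in> U \<inter> V}"
      by (auto simp only: openin_Int)
  next
    fix \<K> assume *: "\<forall>K\<in>\<K>. K \<subseteq> q ` S \<and> openin (top_of_set S) {x \<in> S. q x \<in> K}"
    have "{x \<in> S. q x \<in> \<Union>\<K>} = (\<Union>K\<in>\<K>. {x \<in> S. q x \<in> K})" by auto
    with * show "openin (top_of_set S) {x \<in> S. q x \<in> \<Union>\<K>}" by (auto intro!: openin_Union)
    show "\<Union>\<K> \<subseteq> q ` S" using * by blast
  qed
  thus ?thesis by (simp add: quotient_topology_def)
qed

lemma topspace_quotient_topology: "topspace (quotient_topology S q) = q ` S"
proof
  show "topspace (quotient_topology S q) \<subseteq> q ` S"
    using openin_topspace[of "quotient_topology S q"] by (simp only: openin_quotient_topology)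
  have "{x \<in> S. q x \<in> q ` S} = S" by auto
  hence "openin (quotient_topology S q) (q ` S)" by (simp add: openin_quotient_topology)
  thus "q ` S \<subseteq> topspace (quotient_topology S q)" by (rule openin_subset)
qed

text \<open>The maximal atlas of the quotient manifold: the structure on the image of \<open>q\<close> for which \<open>q\<close> is a
smooth submersion is unique if it exists, and its charts are then exactly those homeomorphisms
onto open subsets of the model space whose composite with \<open>q\<close> is a smooth submersion.\<close>

definition quotient_atlas ::
    "('k \<Rightarrow> 'a::euclidean_space \<Rightarrow> 'a) \<Rightarrow> ('k \<Rightarrow> 'b::euclidean_space \<Rightarrow> 'b) \<Rightarrow> 'a set \<Rightarrow> ('a \<Rightarrow> 'x) \<Rightarrow> ('x, 'b) chart set" where
  "quotient_atlas sa sb S q =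
     {(U, \<phi>). is_chart (quotient_topology S q) (U, \<phi>) \<and>
        smooth_on sa sb {x \<in> S. q x \<in> U} (\<phi> \<circ> q) \<and>
        (\<forall>x\<in>S. q x \<in> U \<longrightarrow> surj (differential (\<phi> \<circ> q) x))}"

definition quotient_by :: "('a \<Rightarrow> 'a \<Rightarrow> bool) \<Rightarrow> 'a set \<Rightarrow> ('a \<Rightarrow> 'x) \<Rightarrow> bool" where
  "quotient_by R S q \<longleftrightarrow> (\<forall>x\<in>S. \<forall>y\<in>S. q x = q y \<longleftrightarrow> R x y)"

text \<open>The Hazewinkel-Kalman structure on the set of transfer functions of the triples in \<open>S\<close>. The
index type \<open>'r \<times> ('m + 'p)\<close> of the model space makes the dimension $r(m+p)$.\<close>

definition HK_topology ::
    "('k::{real_normed_field, euclidean_space} \<Rightarrow> complex) \<Rightarrow> ('k, 'r::finite, 'm::finite, 'p::finite) triple set \<Rightarrow> ('m, 'p) h2 topology" where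
  "HK_topology e S = quotient_topology S (transfer_h2 e)"

definition HK_atlas ::
    "('k::{real_normed_field, euclidean_space} \<Rightarrow> complex) \<Rightarrow> ('k, 'r::finite, 'm::finite, 'p::finite) triple set \<Rightarrow>
       (('m, 'p) h2, 'k^('r \<times> ('m + 'p))) chart set" where
  "HK_atlas e S = quotient_atlas (\<lambda>c. map_triple ((*) c)) vector_scalar_mult S (transfer_h2 e)"

end

theory Submission
  imports Defs "HOL-Complex_Analysis.Cauchy_Integral_Formula"
begin

text \<open>Real points \<open>\<sigma>\<close> and \<open>\<mu>\<close> of the right half-plane can be chosen so that \<open>r\<close> rows of
\<open>C (\<sigma> - A)\<^sup>-\<^sup>1\<close> and \<open>r\<close> columns of \<open>(\<mu> - A)\<^sup>-\<^sup>1 B\<close> are bases; the product of the two matrices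
is the Loewner matrix of divided differences of the transfer function \<open>H\<close>. In the state coordinates
where the rows form the identity matrix, \<open>A\<close> is affine in the remaining data, and \<open>r (m + p)\<close>
tangential values of \<open>H\<close> determine the realization rationally. Since evaluation is a bounded linear
map on the Hardy space, these values are coordinates that are continuous, and even smooth, for the
ambient norm. They give local sections of the transfer map, so that the quotient topology is the
subspace topology, and a bounded left inverse of the differential of the inclusion, which is
therefore injective with closed image.\<close>

section \<open>Calculus of smooth maps\<close>

text \<open>A priori the quotient topology is finer than that of the Hardy norm, and the atlas holds
  every chart whose composite with the transfer map is a submersion. So coordinates are needed that
  make sense on the ambient space. Invertibility of the Loewner matrix is a condition on finitely
  many values of \<open>H\<close>, hence open for the norm, and it forces both factors, the
  observability and the controllability matrix, to be invertible. The nodes are positive reals: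
  stability makes every resolvent exist there, and real systems take real values there, so one
  argument serves both scalar fields. No \<open>\<sigma>\<close> may equal a \<open>\<mu>\<close>,
  since the divided differences have the denominators \<open>\<mu> - \<sigma>\<close>. As the
  realization is an explicit rational function of the data, its smoothness comes down to
  determinants and Cramer's rule. Only the comparison with an arbitrary chart inverts a map that is
  not explicit; there the submersion condition makes the differential of the transition map
  surjective, hence bijective because both sides have dimension \<open>r (m + p)\<close>.\<close>

locale normed_scalars = bounded_bilinear s
  for s :: "'k::real_normed_field \<Rightarrow> 'b::real_normed_vector \<Rightarrow> 'b" +
  assumes assoc: "s (a * b) v = s a (s b v)"
begin

lemma commute: "s a (s b v) = s b (s a v)"
  by (metis assoc mult.commute)

end

lemma normed_scalars_mult: "normed_scalars ((*) :: 'k::real_normed_field \<Rightarrow> 'k \<Rightarrow> 'k)"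
  by (simp add: normed_scalars_def bounded_bilinear_mult normed_scalars_axioms_def)

lemma norm_vector_scalar_mult:
  fixes v :: "'k::real_normed_field^'n"
  shows "norm (c *s v) = norm c * norm v"
  by (simp add: norm_vec_def norm_mult L2_set_right_distrib)

lemma normed_scalars_vector_scalar_mult:
  "normed_scalars ((*s) :: 'k::real_normed_field \<Rightarrow> 'k^'n \<Rightarrow> 'k^'n)"
proof (unfold_locales, goal_cases)
  case 5
  show ?case by (rule exI[of _ 1]) (simp add: norm_vector_scalar_mult)
qed (simp_all add: vec_eq_iff algebra_simps)

lemma ck_on_SucE:
  assumes "ck_on (Suc n) sa sb U f"
  obtains D where "\<And>x. x \<in> U \<Longrightarrow> (f has_derivative D x) (at x)"
    "\<And>x c v. x \<in> U \<Longrightarrow> D x (sa c v) = sb c (D x v)" "\<And>v. ck_on n sa sb U (\<lambda>x. D x v)"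
  using assms by auto

lemma ck_on_cong:
  assumes "open U" "\<And>x. x \<in> U \<Longrightarrow> f x = g x"
  shows "ck_on n sa sb U f \<longleftrightarrow> ck_on n sa sb U g"
proof (cases n)
  case 0
  show ?thesis unfolding 0 using assms by (simp cong: continuous_on_cong)
next
  case (Suc n)
  have *: "(f has_derivative D) (at x) \<longleftrightarrow> (g has_derivative D) (at x)" if "x \<in> U" for D x
    using has_derivative_transform_within_open[OF _ assms(1) that] assms(2) by metis
  show ?thesis unfolding Suc ck_on.simps by (simp add: * cong: ball_cong)
qed

lemma ck_on_eqI:
  assumes "ck_on n sa sb U g" "open U" "\<And>x. x \<in> U \<Longrightarrow> f x = g x"
  shows "ck_on n sa sb U f"
  using ck_on_cong[of U f g] assms by blast

lemma ck_on_subset: "ck_on n sa sb U f \<Longrightarrow> V \<subseteq> U \<Longrightarrow> ck_on n sa sb V f"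
proof (induction n arbitrary: f)
  case 0
  then show ?case by (auto intro: continuous_on_subset)
next
  case (Suc n)
  from Suc.prems(1) obtain D where "\<And>x. x \<in> U \<Longrightarrow> (f has_derivative D x) (at x)"
    "\<And>x c v. x \<in> U \<Longrightarrow> D x (sa c v) = sb c (D x v)" "\<And>v. ck_on n sa sb U (\<lambda>x. D x v)"
    by (rule ck_on_SucE) blast
  with Suc show ?case by (auto intro!: exI[of _ D])
qed

text \<open>Derivatives at interior points are unique, so the existentially quantified
  \<open>D\<close> can be taken to be \<open>differential f\<close>. Only in this form, free of
  choices, can the property be glued over an open cover.\<close>

lemma ck_on_Suc_iff:
  assumes "open U"
  shows "ck_on (Suc n) sa sb U f \<longleftrightarrow>
    (\<forall>x\<in>U. f differentiable (at x) \<and> (\<forall>c v. differential f x (sa c v) = sb c (differential f x v))) \<and>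
    (\<forall>v. ck_on n sa sb U (\<lambda>x. differential f x v))" (is "?L \<longleftrightarrow> ?R")
proof
  assume ?L
  then obtain D where D: "\<And>x. x \<in> U \<Longrightarrow> (f has_derivative D x) (at x)"
    "\<And>x c v. x \<in> U \<Longrightarrow> D x (sa c v) = sb c (D x v)" "\<And>v. ck_on n sa sb U (\<lambda>x. D x v)" by (rule ck_on_SucE) blast
  have eq: "differential f x = D x" if "x \<in> U" for x
    using D(1)[OF that] frechet_derivative_at by metis
  have "ck_on n sa sb U (\<lambda>x. differential f x v)" for v
    using D(3)[of v] by (subst ck_on_cong[OF assms, where g="\<lambda>x. D x v"]) (simp_all add: eq)
  with D show ?R by (auto simp: eq differentiable_def)
next
  assume ?R
  then show ?L
    by (auto intro!: exI[of _ "differential f"] simp: frechet_derivative_works)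
qed

lemma ck_on_localI:
  assumes "open U" "\<And>x. x \<in> U \<Longrightarrow> \<exists>V. open V \<and> x \<in> V \<and> ck_on n sa sb V f"
  shows "ck_on n sa sb U f"
  using assms(2)
proof (induction n arbitrary: f)
  case 0
  show ?case unfolding ck_on.simps
  proof (rule continuous_at_imp_continuous_on, intro ballI)
    fix x assume "x \<in> U"
    from 0[OF this] show "isCont f x" by (auto simp: continuous_on_eq_continuous_at)
  qed
next
  case (Suc n)
  have *: "f differentiable (at x) \<and> (\<forall>c v. differential f x (sa c v) = sb c (differential f x v)) \<and>
      (\<exists>V. open V \<and> x \<in> V \<and> (\<forall>v. ck_on n sa sb V (\<lambda>x. differential f x v)))" if "x \<in> U" for x
  proof -
    obtain V where V: "open V" "x \<in> V" "ck_on (Suc n) sa sb V f" using Suc.prems[OF \<open>x \<in> U\<close>] by blast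
    thus ?thesis using V(3)[unfolded ck_on_Suc_iff[OF V(1)]] by blast
  qed
  have "ck_on n sa sb U (\<lambda>x. differential f x v)" for v
    by (rule Suc.IH) (use * in blast)
  with * show ?case unfolding ck_on_Suc_iff[OF assms(1)] by blast
qed

lemma ck_on_imp_continuous_on: "ck_on n sa sb U f \<Longrightarrow> continuous_on U f"
  by (cases n) (auto intro!: continuous_at_imp_continuous_on dest: has_derivative_continuous)

lemma ck_on_SucD: "ck_on (Suc n) sa sb U f \<Longrightarrow> ck_on n sa sb U f"
proof (induction n arbitrary: f)
  case 0
  from ck_on_imp_continuous_on[OF 0] show ?case by simp
next
  case (Suc n)
  from Suc.prems show ?case
    by (subst (asm) ck_on.simps(2)) (auto intro!: Suc.IH)
qed

lemma ck_on_linear_comp: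
  assumes L: "bounded_linear L" "\<And>c v. L (sb c v) = sc c (L v)"
  shows "ck_on n sa sb U f \<Longrightarrow> ck_on n sa sc U (\<lambda>x. L (f x))"
proof (induction n arbitrary: f)
  case 0
  then show ?case using bounded_linear.continuous_on[OF L(1)] by simp
next
  case (Suc n)
  from Suc.prems(1) obtain D where D: "\<And>x. x \<in> U \<Longrightarrow> (f has_derivative D x) (at x)"
    "\<And>x c v. x \<in> U \<Longrightarrow> D x (sa c v) = sb c (D x v)" "\<And>v. ck_on n sa sb U (\<lambda>x. D x v)" by (rule ck_on_SucE) blast
  show ?case unfolding ck_on.simps
    by (rule exI[of _ "\<lambda>x v. L (D x v)"])
      (auto intro!: bounded_linear.has_derivative[OF L(1)] D Suc.IH simp: D L)
qed

text \<open>The map \<open>h\<close> links the scalars of the two domains: with the inclusion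
  \<open>e\<close> it restricts complex smoothness to triples over \<open>'k\<close>. The offset
  \<open>a\<close> is there for \<open>observable_form\<close>, which is affine and not
  linear.\<close>

lemma ck_on_comp_affine:
  assumes L: "bounded_linear L" "\<And>c v. L (sa c v) = sb (h c) (L v)"
    and UV: "\<And>x. x \<in> U \<Longrightarrow> a + L x \<in> V"
  shows "ck_on n sb sc V f \<Longrightarrow> ck_on n sa (\<lambda>c. sc (h c)) U (\<lambda>x. f (a + L x))"
proof (induction n arbitrary: f)
  case 0
  have "continuous_on U (\<lambda>x. a + L x)"
    by (intro continuous_intros bounded_linear.continuous_on[OF L(1)])
  with 0 UV show ?case by (auto intro: continuous_on_compose2)
next
  case (Suc n)
  from Suc.prems(1) obtain D where D: "\<And>x. x \<in> V \<Longrightarrow> (f has_derivative D x) (at x)"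
    "\<And>x c v. x \<in> V \<Longrightarrow> D x (sb c v) = sc c (D x v)" "\<And>v. ck_on n sb sc V (\<lambda>x. D x v)" by (rule ck_on_SucE) blast
  have "((\<lambda>x. a + L x) has_derivative L) (at x)" for x
    by (auto intro!: derivative_eq_intros bounded_linear_imp_has_derivative L)
  from has_derivative_compose[OF this] D(1)[OF UV]
  have "((\<lambda>x. f (a + L x)) has_derivative (\<lambda>v. D (a + L x) (L v))) (at x)" if "x \<in> U" for x
    using that by blast
  then show ?case unfolding ck_on.simps
    by (intro exI[of _ "\<lambda>x v. D (a + L x) (L v)"])
      (auto intro!: D Suc.IH simp: L D UV)
qed

lemma ck_on_const: "(\<And>c. sb c 0 = 0) \<Longrightarrow> ck_on n sa sb U (\<lambda>x. b)"
  by (induction n arbitrary: b) (auto intro!: exI[of _ "\<lambda>_ _. 0"])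

lemma ck_on_linear:
  assumes L: "bounded_linear L" "\<And>c v. L (sa c v) = sb c (L v)" and "\<And>c. sb c 0 = 0"
  shows "ck_on n sa sb U L"
proof (cases n)
  case 0
  then show ?thesis using linear_continuous_on[OF L(1)] by simp
next
  case (Suc n)
  show ?thesis unfolding Suc ck_on.simps
    by (rule exI[of _ "\<lambda>_. L"]) (auto intro!: ck_on_const bounded_linear_imp_has_derivative assms)
qed

lemma ck_on_add:
  assumes sb: "\<And>c u v. sb c (u + v) = sb c u + sb c v"
  shows "ck_on n sa sb U f \<Longrightarrow> ck_on n sa sb U g \<Longrightarrow> ck_on n sa sb U (\<lambda>x. f x + g x)"
proof (induction n arbitrary: f g)
  case 0
  then show ?case by (auto intro: continuous_on_add)
next
  case (Suc n)
  from Suc.prems(1) obtain D where D: "\<And>x. x \<in> U \<Longrightarrow> (f has_derivative D x) (at x)"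
    "\<And>x c v. x \<in> U \<Longrightarrow> D x (sa c v) = sb c (D x v)" "\<And>v. ck_on n sa sb U (\<lambda>x. D x v)" by (rule ck_on_SucE) blast
  from Suc.prems(2) obtain E where E: "\<And>x. x \<in> U \<Longrightarrow> (g has_derivative E x) (at x)"
    "\<And>x c v. x \<in> U \<Longrightarrow> E x (sa c v) = sb c (E x v)" "\<And>v. ck_on n sa sb U (\<lambda>x. E x v)" by (rule ck_on_SucE) blast
  show ?case unfolding ck_on.simps
    by (rule exI[of _ "\<lambda>x v. D x v + E x v"])
      (auto intro!: has_derivative_add Suc.IH D E simp: sb D E)
qed

lemma ck_on_sum:
  assumes sb: "\<And>c u v. sb c (u + v) = sb c u + sb c v" "\<And>c. sb c 0 = 0"
    and "finite I" "\<And>i. i \<in> I \<Longrightarrow> ck_on n sa sb U (f i)"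
  shows "ck_on n sa sb U (\<lambda>x. \<Sum>i\<in>I. f i x)"
  using assms(3,4)
  by (induction I) (auto intro!: ck_on_add[of sb] ck_on_const[of sb] simp: sb)

lemma ck_on_bilinear:
  assumes P: "bounded_bilinear P" "\<And>c u v. P (sb c u) v = sd c (P u v)" "\<And>c u v. P u (sc c v) = sd c (P u v)"
    and sd: "\<And>c u v. sd c (u + v) = sd c u + sd c v"
  shows "ck_on n sa sb U f \<Longrightarrow> ck_on n sa sc U g \<Longrightarrow> ck_on n sa sd U (\<lambda>x. P (f x) (g x))"
proof (induction n arbitrary: f g)
  case 0
  then show ?case by (auto intro: bounded_bilinear.continuous_on[OF P(1)])
next
  case (Suc n)
  from Suc.prems(1) obtain D where D: "\<And>x. x \<in> U \<Longrightarrow> (f has_derivative D x) (at x)"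
    "\<And>x c v. x \<in> U \<Longrightarrow> D x (sa c v) = sb c (D x v)" "\<And>v. ck_on n sa sb U (\<lambda>x. D x v)" by (rule ck_on_SucE) blast
  from Suc.prems(2) obtain E where E: "\<And>x. x \<in> U \<Longrightarrow> (g has_derivative E x) (at x)"
    "\<And>x c v. x \<in> U \<Longrightarrow> E x (sa c v) = sc c (E x v)" "\<And>v. ck_on n sa sc U (\<lambda>x. E x v)" by (rule ck_on_SucE) blast
  note fg = Suc.prems[THEN ck_on_SucD]
  show ?case unfolding ck_on.simps
    by (rule exI[of _ "\<lambda>x v. P (f x) (E x v) + P (D x v) (g x)"])
      (auto intro!: bounded_bilinear.FDERIV[OF P(1)] Suc.IH ck_on_add[of sd] D E fg simp: sd P D E)
qed

lemma ck_on_mult: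
  fixes f g :: "'a::euclidean_space \<Rightarrow> 'k::real_normed_field"
  shows "ck_on n sa (*) U f \<Longrightarrow> ck_on n sa (*) U g \<Longrightarrow> ck_on n sa (*) U (\<lambda>x. f x * g x)"
  by (rule ck_on_bilinear[OF bounded_bilinear_mult]) (auto simp: algebra_simps)

lemma ck_on_uminus:
  fixes f :: "'a::euclidean_space \<Rightarrow> 'k::real_normed_field"
  shows "ck_on n sa (*) U f \<Longrightarrow> ck_on n sa (*) U (\<lambda>x. - f x)"
  by (rule ck_on_linear_comp[of uminus]) (auto intro: bounded_linear_minus bounded_linear_ident)

lemma ck_on_prod:
  fixes f :: "'i \<Rightarrow> 'a::euclidean_space \<Rightarrow> 'k::real_normed_field"
  assumes "finite I" "\<And>i. i \<in> I \<Longrightarrow> ck_on n sa (*) U (f i)"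
  shows "ck_on n sa (*) U (\<lambda>x. \<Prod>i\<in>I. f i x)"
  using assms by (induction I) (auto intro: ck_on_const ck_on_mult)

text \<open>The derivative contains \<open>inverse (g x)\<close> itself, but only with one order of
  smoothness less, which the induction hypothesis supplies.\<close>

lemma ck_on_inverse:
  fixes g :: "'a::euclidean_space \<Rightarrow> 'k::real_normed_field"
  assumes nz: "\<And>x. x \<in> U \<Longrightarrow> g x \<noteq> 0"
  shows "ck_on n sa (*) U g \<Longrightarrow> ck_on n sa (*) U (\<lambda>x. inverse (g x))"
proof (induction n)
  case 0
  then show ?case using nz by (auto intro: continuous_on_inverse)
next
  case (Suc n)
  from Suc.prems(1) obtain D where D: "\<And>x. x \<in> U \<Longrightarrow> (g has_derivative D x) (at x)"
    "\<And>x c v. x \<in> U \<Longrightarrow> D x (sa c v) = c * (D x v)" "\<And>v. ck_on n sa (*) U (\<lambda>x. D x v)" by (rule ck_on_SucE) blast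
  note IH = Suc.IH[OF ck_on_SucD[OF Suc.prems]]
  show ?case unfolding ck_on.simps
    by (rule exI[of _ "\<lambda>x v. - (inverse (g x) * D x v * inverse (g x))"])
      (auto intro!: has_derivative_inverse ck_on_uminus ck_on_mult D IH simp: D nz)
qed

lemma ck_on_det:
  fixes M :: "'a::euclidean_space \<Rightarrow> 'k::real_normed_field^'n^'n"
  assumes "\<And>i j. ck_on n sa (*) U (\<lambda>x. M x $ i $ j)"
  shows "ck_on n sa (*) U (\<lambda>x. det (M x))"
  unfolding det_def
  by (intro ck_on_sum ck_on_mult ck_on_prod ck_on_const assms) (auto simp: algebra_simps)

section \<open>Matrix inversion and its smoothness\<close>

lemma matrix_inv:
  assumes "invertible A"
  shows "A ** matrix_inv A = mat 1" "matrix_inv A ** A = mat 1"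
  using assms unfolding invertible_def matrix_inv_def by (metis (mono_tags, lifting) someI_ex)+

lemma matrix_inv_unique:
  fixes A :: "'a::field^'n^'n"
  assumes "A ** B = mat 1"
  shows "matrix_inv A = B"
proof -
  have "invertible A" using assms invertible_right_inverse by blast
  from matrix_inv(2)[OF this] show ?thesis
    by (metis assms matrix_mul_assoc matrix_mul_lid matrix_mul_rid)
qed

text \<open>Cramer's rule for the right-hand side \<open>axis l 1\<close>. It makes each entry of
  the inverse a polynomial in the entries of \<open>A\<close> times the inverse of
  \<open>det A\<close>, so that smoothness follows from the scalar rules.\<close>

lemma matrix_inv_component:
  fixes A :: "'a::field^'n^'n"
  assumes "det A \<noteq> 0"
  shows "matrix_inv A $ k $ l = det (\<chi> i j. if j = k then axis l 1 $ i else A $ i $ j) * inverse (det A)"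
proof -
  have "A *v (matrix_inv A *v axis l 1) = axis l 1"
    using assms matrix_inv(1)[of A] by (simp add: matrix_vector_mul_assoc invertible_det_nz)
  hence "(matrix_inv A *v axis l 1) $ k = det (\<chi> i j. if j = k then axis l 1 $ i else A $ i $ j) * inverse (det A)"
    unfolding cramer[OF assms] by (simp add: divide_inverse)
  thus ?thesis
    by (simp add: matrix_vector_mult_def axis_def if_distrib cong: if_cong)
qed

lemma ck_on_matrix_inv:
  fixes M :: "'a::euclidean_space \<Rightarrow> 'k::real_normed_field^'n^'n"
  assumes U: "open U" and M: "\<And>i j. ck_on n sa (*) U (\<lambda>x. M x $ i $ j)" and nz: "\<And>x. x \<in> U \<Longrightarrow> det (M x) \<noteq> 0"
  shows "ck_on n sa (*) U (\<lambda>x. matrix_inv (M x) $ k $ l)"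
proof -
  have "ck_on n sa (*) U (\<lambda>x. (\<chi> i j. if j = k then axis l 1 $ i else M x $ i $ j) $ i $ j)" for i j
    by (cases "j = k") (auto intro: ck_on_const M)
  hence "ck_on n sa (*) U (\<lambda>x. det (\<chi> i j. if j = k then axis l 1 $ i else M x $ i $ j) * inverse (det (M x)))"
    by (intro ck_on_mult ck_on_inverse ck_on_det M nz)
  thus ?thesis by (rule ck_on_eqI) (simp_all add: U matrix_inv_component nz)
qed

lemma norm_axis: "norm (axis i x) = norm x"
  by (simp add: norm_vec_def L2_set_def axis_def if_distrib[of norm] if_distrib[of "\<lambda>x. x\<^sup>2"] cong: if_cong)

lemma bounded_linear_axis: "bounded_linear (axis i :: 'k::real_normed_vector \<Rightarrow> 'k^'n)"
  by (rule bounded_linear_intro[of _ 1]) (auto simp: axis_def vec_eq_iff norm_axis[unfolded axis_def])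

lemma ck_on_vecI:
  fixes f :: "'a::euclidean_space \<Rightarrow> 'k::real_normed_field^'n"
  assumes "\<And>i. ck_on n sa (*) U (\<lambda>x. f x $ i)"
  shows "ck_on n sa (*s) U f"
proof -
  have *: "f = (\<lambda>x. \<Sum>i\<in>UNIV. axis i (f x $ i))"
  proof
    fix x show "f x = (\<Sum>i\<in>UNIV. axis i (f x $ i))"
      by (simp add: vec_eq_iff axis_def if_distrib cong: if_cong)
  qed
  show ?thesis
    by (subst *) (intro ck_on_sum ck_on_linear_comp[OF bounded_linear_axis _ assms],
        auto simp: vec_eq_iff axis_def algebra_simps)
qed

lemma ck_on_vec_nth:
  fixes f :: "'a::euclidean_space \<Rightarrow> 'k::real_normed_field^'n"
  shows "ck_on n sa (*s) U f \<Longrightarrow> ck_on n sa (*) U (\<lambda>x. f x $ i)"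
  by (rule ck_on_linear_comp) (auto intro: bounded_linear_vec_nth)

section \<open>Chain rule and inverse maps over the scalar field\<close>

lemma K_linear_expansion:
  fixes D :: "'k::real_normed_field^'n \<Rightarrow> 'b::real_vector"
  assumes D: "linear D" "\<And>c v. D (c *s v) = sb c (D v)"
  shows "D w = (\<Sum>i\<in>UNIV. sb (w $ i) (D (axis i 1)))"
proof -
  have "D w = D (\<Sum>i\<in>UNIV. (w $ i) *s axis i 1)" by (simp add: basis_expansion)
  also have "\<dots> = (\<Sum>i\<in>UNIV. sb (w $ i) (D (axis i 1)))"
    by (subst linear_sum[OF D(1)]) (simp add: D(2))
  finally show ?thesis .
qed

text \<open>\<open>ck_on\<close> controls the derivative of \<open>g\<close> in fixed directions
  only, while the chain rule needs it in the moving direction \<open>D x v\<close>. Expanding this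
  direction in the standard basis over \<open>'k\<close> gives a finite sum of products, to which
  the product rule and the induction hypothesis apply. For this the middle space has to be of the
  form \<open>'k^'n\<close>.\<close>

lemma ck_on_compose:
  fixes f :: "'a::euclidean_space \<Rightarrow> 'k::{real_normed_field,euclidean_space}^'n"
  assumes sb: "normed_scalars sb" and U: "open U" and V: "open V" and fV: "f ` U \<subseteq> V"
  shows "ck_on n (*s) sb V g \<Longrightarrow> ck_on n sa (*s) U f \<Longrightarrow> ck_on n sa sb U (\<lambda>x. g (f x))"
proof (induction n arbitrary: g)
  case 0
  then show ?case using fV by (auto intro: continuous_on_compose2)
next
  case (Suc n)
  interpret normed_scalars sb by (rule sb)
  from Suc.prems(2) obtain D where D: "\<And>x. x \<in> U \<Longrightarrow> (f has_derivative D x) (at x)"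
    "\<And>x c v. x \<in> U \<Longrightarrow> D x (sa c v) = c *s (D x v)" "\<And>v. ck_on n sa (*s) U (\<lambda>x. D x v)" by (rule ck_on_SucE) blast
  from Suc.prems(1) obtain E where E: "\<And>x. x \<in> V \<Longrightarrow> (g has_derivative E x) (at x)"
    "\<And>x c v. x \<in> V \<Longrightarrow> E x (c *s v) = sb c (E x v)" "\<And>v. ck_on n (*s) sb V (\<lambda>x. E x v)" by (rule ck_on_SucE) blast
  have f: "ck_on n sa (*s) U f" using Suc.prems ck_on_SucD by blast
  have V': "f x \<in> V" if "x \<in> U" for x using fV that by auto
  have der: "((\<lambda>x. g (f x)) has_derivative (\<lambda>v. E (f x) (D x v))) (at x)" if "x \<in> U" for x
    using has_derivative_compose[OF D(1)[OF that] E(1)[OF V'[OF that]]] .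
  have "E (f x) (D x v) = (\<Sum>i\<in>UNIV. sb (D x v $ i) (E (f x) (axis i 1)))" if "x \<in> U" for x v
    using E(1)[OF V'[OF that]] has_derivative_linear
    by (intro K_linear_expansion) (auto simp: E(2) V' that)
  moreover have "ck_on n sa sb U (\<lambda>x. \<Sum>i\<in>UNIV. sb (D x v $ i) (E (f x) (axis i 1)))" for v
  proof (intro ck_on_sum)
    show "ck_on n sa sb U (\<lambda>x. sb (D x v $ i) (E (f x) (axis i 1)))" for i
      by (rule ck_on_bilinear[where sb="(*)" and sc=sb and P=sb])
        (auto intro!: ck_on_vec_nth D Suc.IH[OF E(3) f] bounded_bilinear_axioms simp: assoc commute add_right)
  qed (auto simp: add_right zero_right)
  ultimately have "ck_on n sa sb U (\<lambda>x. E (f x) (D x v))" for v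
    by (subst ck_on_cong[OF U]) auto
  with der show ?case unfolding ck_on.simps
    by (intro exI[of _ "\<lambda>x v. E (f x) (D x v)"]) (auto simp: D E V')
qed

lemma bounded_linear_matrix_vector_mult:
  fixes M :: "'k::{real_normed_field,euclidean_space}^'n^'m"
  shows "bounded_linear ((*v) M)"
  by (rule linear_conv_bounded_linear[THEN iffD1])
    (auto intro!: linearI simp: matrix_vector_right_distrib vec_eq_iff matrix_vector_mult_def scaleR_right.sum)

text \<open>A surjective endomorphism of a finite-dimensional space is invertible, so the continuous
  inverse \<open>g\<close> is differentiable with derivative \<open>matrix_inv (M (g y))\<close>.
  This formula lifts \<open>g\<close> from one order of smoothness to the next, starting from
  continuity.\<close>

lemma smooth_on_inverse:
  fixes f :: "'k::{real_normed_field,euclidean_space}^'n \<Rightarrow> 'k^'n"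
  assumes f: "smooth_on (*s) (*s) U f" and fU: "open (f ` U)" and g: "continuous_on (f ` U) g"
    and gf: "\<And>x. x \<in> U \<Longrightarrow> g (f x) = x" and surj: "\<And>x. x \<in> U \<Longrightarrow> surj (differential f x)"
  shows "smooth_on (*s) (*s) (f ` U) g"
    and "x \<in> U \<Longrightarrow> differential f x (differential g (f x) v) = v"
proof -
  define M where "M x = matrix (differential f x)" for x
  have U: "open U" and fn: "ck_on n (*s) (*s) U f" for n
    using f by (auto simp: smooth_on_def)
  from fn[of "Suc 0"] have fd: "f differentiable (at x)" and "differential f x (c *s v) = c *s differential f x v"
    if "x \<in> U" for x c v unfolding ck_on_Suc_iff[OF U] using that by auto
  hence "Vector_Spaces.linear (*s) (*s) (differential f x)" if "x \<in> U" for x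
    using linear_frechet_derivative[OF fd[OF that]] that
    by unfold_locales (auto simp: linear_add)
  from matrix_works[OF this] have Mv: "differential f x = (*v) (M x)" if "x \<in> U" for x
    using that by (auto simp: M_def)
  have inv: "invertible (M x)" if "x \<in> U" for x
    using surj[OF that] Mv[OF that] by (simp add: invertible_right_inverse matrix_right_invertible_surjective)
  have fder: "(f has_derivative (*v) (M x)) (at x)" if "x \<in> U" for x
    using fd[OF that] Mv[OF that] by (simp add: frechet_derivative_works)
  have gder: "(g has_derivative (*v) (matrix_inv (M (g y)))) (at y)" if "y \<in> f ` U" for y
  proof (rule has_derivative_inverse_basic[where f=f and T="f ` U"])
    have gy: "g y \<in> U" using that gf by auto
    show "(f has_derivative (*v) (M (g y))) (at (g y))" by (rule fder[OF gy])
    show "(*v) (matrix_inv (M (g y))) \<circ> (*v) (M (g y)) = id"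
      by (auto simp: matrix_vector_mul_assoc matrix_inv(2)[OF inv[OF gy]])
    show "continuous (at y) g" using continuous_on_eq_continuous_at[OF fU] g that by blast
  qed (use that fU gf in \<open>auto intro: bounded_linear_matrix_vector_mult\<close>)
  have gU: "g ` f ` U \<subseteq> U" using gf by auto
  have Mn: "ck_on n (*s) (*) U (\<lambda>x. M x $ i $ j)" for n i j
  proof -
    have "ck_on n (*s) (*s) U (\<lambda>x. differential f x (axis j 1))"
      using fn[of "Suc n"] unfolding ck_on_Suc_iff[OF U] by blast
    from ck_on_vec_nth[OF this, of i] show ?thesis by (simp add: M_def matrix_def)
  qed
  have "ck_on n (*s) (*s) (f ` U) g" for n
  proof (induction n)
    case 0
    then show ?case using g by simp
  next
    case (Suc n)
    have "ck_on n (*s) (*) (f ` U) (\<lambda>y. M (g y) $ i $ j)" for i j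
      by (rule ck_on_compose[OF normed_scalars_mult fU U gU Mn Suc])
    hence "ck_on n (*s) (*) (f ` U) (\<lambda>y. matrix_inv (M (g y)) $ i $ j)" for i j
      by (rule ck_on_matrix_inv[OF fU]) (use inv gf in \<open>auto simp: invertible_det_nz\<close>)
    hence "ck_on n (*s) (*s) (f ` U) (\<lambda>y. matrix_inv (M (g y)) *v v)" for v
      by (intro ck_on_vecI) (auto simp: matrix_vector_mult_def algebra_simps intro!: ck_on_sum ck_on_mult ck_on_const)
    then show ?case unfolding ck_on.simps using gder
      by (intro exI[of _ "\<lambda>y. (*v) (matrix_inv (M (g y)))"]) (auto simp: vec.scale)
  qed
  thus "smooth_on (*s) (*s) (f ` U) g" using fU by (simp add: smooth_on_def)
  show "differential f x (differential g (f x) v) = v" if "x \<in> U"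
  proof -
    have "differential g (f x) = (*v) (matrix_inv (M x))"
      using gder[of "f x"] that gf by (auto simp: frechet_derivative_at[symmetric])
    thus ?thesis using that by (simp add: Mv matrix_vector_mul_assoc matrix_inv(1)[OF inv])
  qed
qed

section \<open>Norm estimates in the Hardy space\<close>

text \<open>The boundary function is an \<open>L2\<close> limit of the restrictions to lines.
  Splitting it into the restriction and the error by \<open>nn_integral_power2_norm_add_le\<close>
  loses a factor 2 against the sharp \<open>K / (2 * pi)\<close>; only boundedness matters in the
  sequel.\<close>

lemma h2_norm_le:
  fixes F :: "('m::finite, 'p::finite) h2"
  assumes K: "\<And>x. x > 0 \<Longrightarrow> (\<integral>\<^sup>+t. ennreal ((norm (h2_fun F (Complex x t)))\<^sup>2) \<partial>lborel) \<le> ennreal K" and "K \<ge> 0"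
  shows "(norm F)\<^sup>2 \<le> K / pi"
proof -
  let ?I = "\<lambda>\<xi>. \<integral>\<^sup>+\<omega>. ennreal ((norm (h2_fun F (Complex \<xi> \<omega>) - boundary_value F \<omega>))\<^sup>2) \<partial>lborel"
  let ?J = "\<integral>\<^sup>+\<omega>. ennreal ((norm (boundary_value F \<omega>))\<^sup>2) \<partial>lborel"
  have "((\<lambda>\<xi>. 2 * ?I \<xi> + 2 * ennreal K) \<longlongrightarrow> 2 * 0 + 2 * ennreal K) (at_right 0)"
    by (intro tendsto_add ennreal_tendsto_cmult boundary_L2_limit) auto
  moreover have "\<forall>\<^sub>F \<xi> in at_right 0. ?J \<le> 2 * ?I \<xi> + 2 * ennreal K"
    using eventually_at_right_less[of 0]
  proof eventually_elim
    case (elim x)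
    note h2_fun_measurable[OF elim, of F, measurable]
    have "?J = (\<integral>\<^sup>+\<omega>. ennreal ((norm ((boundary_value F \<omega> - h2_fun F (Complex x \<omega>)) + h2_fun F (Complex x \<omega>)))\<^sup>2) \<partial>lborel)"
      by simp
    also have "\<dots> \<le> 2 * (\<integral>\<^sup>+\<omega>. ennreal ((norm (boundary_value F \<omega> - h2_fun F (Complex x \<omega>)))\<^sup>2) \<partial>lborel)
        + 2 * (\<integral>\<^sup>+\<omega>. ennreal ((norm (h2_fun F (Complex x \<omega>)))\<^sup>2) \<partial>lborel)"
      by (rule nn_integral_power2_norm_add_le) measurable
    also have "\<dots> \<le> 2 * ?I x + 2 * ennreal K"
      using K[OF elim] by (intro add_mono mult_left_mono) (auto simp: norm_minus_commute)
    finally show ?case .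
  qed
  ultimately have "?J \<le> 2 * 0 + 2 * ennreal K"
    by (intro tendsto_lowerbound) auto
  hence J: "?J \<le> ennreal (2 * K)" using \<open>K \<ge> 0\<close> by (simp add: ennreal_mult)
  have "ennreal (LINT \<omega>|lborel. (norm (boundary_value F \<omega>))\<^sup>2) = ?J"
    by (rule nn_integral_eq_integral[symmetric]) (auto intro: boundary_square_integrable)
  hence "(LINT \<omega>|lborel. (norm (boundary_value F \<omega>))\<^sup>2) \<le> 2 * K"
    using J \<open>K \<ge> 0\<close> by (metis ennreal_le_iff mult_nonneg_nonneg zero_le_numeral)
  moreover have "(norm F)\<^sup>2 = 1 / (2*pi) * (LINT \<omega>|lborel. (norm (boundary_value F \<omega>))\<^sup>2)"
    by (simp add: power2_norm_eq_inner inner_h2_def Re_h2_cinner)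
  ultimately show ?thesis by (simp add: field_simps)
qed

text \<open>The line norms grow towards the axis, so the line at \<open>x\<close> is dominated by
  lines at \<open>\<xi> < x\<close>, and these converge to the boundary function. The crude
  splitting turns the sharp \<open>2 * pi\<close> into \<open>4 * pi\<close>.\<close>

lemma h2_line_norm_le:
  fixes F :: "('m::finite, 'p::finite) h2"
  assumes x: "x > 0"
  shows "(\<integral>\<^sup>+t. ennreal ((norm (h2_fun F (Complex x t)))\<^sup>2) \<partial>lborel) \<le> ennreal (4 * pi * (norm F)\<^sup>2)"
proof -
  let ?N = "\<lambda>x. \<integral>\<^sup>+t. ennreal ((norm (h2_fun F (Complex x t)))\<^sup>2) \<partial>lborel"
  let ?I = "\<lambda>\<xi>. \<integral>\<^sup>+\<omega>. ennreal ((norm (h2_fun F (Complex \<xi> \<omega>) - boundary_value F \<omega>))\<^sup>2) \<partial>lborel"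
  let ?J = "\<integral>\<^sup>+\<omega>. ennreal ((norm (boundary_value F \<omega>))\<^sup>2) \<partial>lborel"
  have "((\<lambda>\<xi>. 2 * ?I \<xi> + 2 * ?J) \<longlongrightarrow> 2 * 0 + 2 * ?J) (at_right 0)"
    by (intro tendsto_add ennreal_tendsto_cmult boundary_L2_limit) auto
  moreover have "\<forall>\<^sub>F \<xi> in at_right 0. \<xi> < x" using x by (auto simp: eventually_at_right_field)
  hence "\<forall>\<^sub>F \<xi> in at_right 0. ?N x \<le> 2 * ?I \<xi> + 2 * ?J"
    using eventually_at_right_less[of 0]
  proof eventually_elim
    case (elim \<xi>)
    note h2_fun_measurable[OF elim(2), of F, measurable]
    have "?N x \<le> ?N \<xi>" using hardy_h2_antimono[OF h2_fun[of F]] elim by auto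
    also have "?N \<xi> = (\<integral>\<^sup>+\<omega>. ennreal ((norm ((h2_fun F (Complex \<xi> \<omega>) - boundary_value F \<omega>) + boundary_value F \<omega>))\<^sup>2) \<partial>lborel)"
      by simp
    also have "\<dots> \<le> 2 * ?I \<xi> + 2 * ?J"
      by (rule nn_integral_power2_norm_add_le) measurable
    finally show ?case .
  qed
  ultimately have "?N x \<le> 2 * 0 + 2 * ?J"
    by (rule tendsto_lowerbound) simp
  also have "?J = ennreal (LINT \<omega>|lborel. (norm (boundary_value F \<omega>))\<^sup>2)"
    by (rule nn_integral_eq_integral) (auto intro: boundary_square_integrable)
  also have "(LINT \<omega>|lborel. (norm (boundary_value F \<omega>))\<^sup>2) = 2 * pi * (norm F)\<^sup>2"
    by (simp add: power2_norm_eq_inner inner_h2_def Re_h2_cinner)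
  finally show ?thesis by (simp add: ennreal_mult mult_ac)
qed

lemma norm_matrix_scale:
  fixes A :: "complex^'m^'p"
  shows "(norm (\<chi> i j. c * A $ i $ j))\<^sup>2 = (norm c)\<^sup>2 * (norm A)\<^sup>2"
  by (simp add: power2_norm_matrix norm_mult power_mult_distrib sum_distrib_left)

text \<open>The factor 2 is the square root of \<open>4 * pi / pi\<close>, left over from composing
  the two crude estimates through the line integrals.\<close>

lemma norm_scaleC_h2: "norm (scaleC_h2 c F) \<le> 2 * norm c * norm F"
proof -
  have "(norm (scaleC_h2 c F))\<^sup>2 \<le> ((norm c)\<^sup>2 * (4 * pi * (norm F)\<^sup>2)) / pi"
  proof (rule h2_norm_le)
    fix x :: real assume x: "x > 0"
    note h2_fun_measurable[OF x, of F, measurable]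
    have "(\<integral>\<^sup>+t. ennreal ((norm (h2_fun (scaleC_h2 c F) (Complex x t)))\<^sup>2) \<partial>lborel)
        = ennreal ((norm c)\<^sup>2) * (\<integral>\<^sup>+t. ennreal ((norm (h2_fun F (Complex x t)))\<^sup>2) \<partial>lborel)"
      by (simp add: norm_matrix_scale ennreal_mult nn_integral_cmult)
    also have "\<dots> \<le> ennreal ((norm c)\<^sup>2) * ennreal (4 * pi * (norm F)\<^sup>2)"
      by (intro mult_left_mono h2_line_norm_le x) auto
    finally show "(\<integral>\<^sup>+t. ennreal ((norm (h2_fun (scaleC_h2 c F) (Complex x t)))\<^sup>2) \<partial>lborel)
        \<le> ennreal ((norm c)\<^sup>2 * (4 * pi * (norm F)\<^sup>2))"
      by (simp add: ennreal_mult)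
  qed simp
  also have "\<dots> = (2 * norm c * norm F)\<^sup>2" by (simp add: power_mult_distrib)
  finally show ?thesis by (rule power2_le_imp_le) simp
qed

lemma normed_scalars_scaleC_h2: "normed_scalars scaleC_h2"
proof (unfold_locales, goal_cases)
  case 5
  show ?case by (rule exI[of _ 2]) (use norm_scaleC_h2 in \<open>auto simp: mult_ac\<close>)
qed (auto intro!: h2_eqI simp: vec_eq_iff algebra_simps scaleR_conv_of_real[where 'a=complex])

section \<open>Boundedness of point evaluation\<close>

lemma ennreal_plus_mult:
  "0 \<le> a \<Longrightarrow> 0 \<le> b \<Longrightarrow> 0 \<le> c \<Longrightarrow> ennreal a + ennreal b * ennreal c = ennreal (a + b * c)"
  by (simp add: ennreal_mult ennreal_plus)

text \<open>The increment of \<open>P\<close> is the integral of \<open>f\<close> over a vertical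
  segment of length \<open>h \<le> 1\<close>. The inequality \<open>u \<le> 1/2 + u^2 / 2\<close>
  bounds this integral by half the length plus half of \<open>K\<close>.\<close>

lemma half_plane_line_difference_bound:
  fixes f :: "complex \<Rightarrow> complex"
  assumes P: "\<And>s. 0 < Re s \<Longrightarrow> (P has_field_derivative f s) (at s)"
    and meas: "(\<lambda>t. f (Complex (Re z) t)) \<in> borel_measurable borel"
    and K: "(\<integral>\<^sup>+t. ennreal ((norm (f (Complex (Re z) t)))\<^sup>2) \<partial>lborel) \<le> ennreal K" and "K \<ge> 0"
    and z: "0 < Re z" and h: "0 \<le> h" "h \<le> 1"
    and cont: "continuous_on UNIV (\<lambda>t. f (Complex (Re z) t))"
  shows "norm (P (z + \<i> * of_real h) - P z) \<le> (1 + K) / 2"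
proof -
  define a where "a = Im z"
  define g where "g = (\<lambda>t. f (Complex (Re z) t))"
  note meas[folded g_def, measurable]
  have "(LINT t|lborel. indicator {a..a+h} t *\<^sub>R (g t * \<i>)) = P (Complex (Re z) (a + h)) - P (Complex (Re z) a)"
  proof (rule integral_FTC_atLeastAtMost[of a "a + h" "\<lambda>t. P (Complex (Re z) t)"])
    show "((\<lambda>t. P (Complex (Re z) t)) has_vector_derivative g t * \<i>) (at t within {a..a+h})" for t
    proof -
      have "((\<lambda>t. Complex (Re z) t) has_vector_derivative \<i>) (at t within {a..a+h})"
        unfolding Complex_eq by (auto intro!: derivative_eq_intros)
      from field_vector_diff_chain_within[OF this, of P "g t"]
      show ?thesis using P[of "Complex (Re z) t"] z
        by (auto simp: g_def o_def mult.commute intro: has_field_derivative_at_within)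
    qed
    show "continuous_on {a..a+h} (\<lambda>t. g t * \<i>)"
      unfolding g_def by (intro continuous_intros continuous_on_subset[OF cont]) auto
  qed (use h in auto)
  moreover have "Complex (Re z) (a + h) = z + \<i> * of_real h" "Complex (Re z) a = z"
    by (auto simp: a_def complex_eq_iff)
  ultimately have eq: "P (z + \<i> * of_real h) - P z = (LINT t|lborel. indicator {a..a+h} t *\<^sub>R (g t * \<i>))" by simp
  have "integrable lborel (\<lambda>t. indicator {a..a+h} t *\<^sub>R (g t * \<i>))"
    by (rule borel_integrable_compact)
      (auto simp: g_def intro!: continuous_intros continuous_on_subset[OF cont])
  from integral_norm_bound_ennreal[OF this]
  have "ennreal (norm (P (z + \<i> * of_real h) - P z)) \<le> (\<integral>\<^sup>+t. ennreal (norm (indicator {a..a+h} t *\<^sub>R (g t * \<i>))) \<partial>lborel)"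
    unfolding eq .
  also have "\<dots> \<le> (\<integral>\<^sup>+t. ennreal (1/2) * indicator {a..a+h} t + ennreal (1/2) * ennreal ((norm (g t))\<^sup>2) \<partial>lborel)"
  proof (rule nn_integral_mono)
    fix t
    have "norm (g t) \<le> 1/2 + 1/2 * (norm (g t))\<^sup>2"
      using sum_squares_bound[of "norm (g t)" 1] by simp
    hence "ennreal (norm (g t)) \<le> ennreal (1/2) + ennreal (1/2) * ennreal ((norm (g t))\<^sup>2)"
      by (subst ennreal_plus_mult) (simp_all only: ennreal_leI zero_le_power2 divide_nonneg_pos zero_le_one zero_less_numeral)
    note * = this
    show "ennreal (norm (indicator {a..a+h} t *\<^sub>R (g t * \<i>))) \<le> ennreal (1/2) * indicator {a..a+h} t + ennreal (1/2) * ennreal ((norm (g t))\<^sup>2)"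
    proof (cases "t \<in> {a..a+h}")
      case False
      hence "indicator {a..a+h} t = (0 :: real)" by simp
      thus ?thesis by (simp only: scaleR_zero_left norm_zero ennreal_0 zero_le)
    qed (use * in \<open>simp_all only: indicator_simps mult_1_right scaleR_one norm_mult norm_ii\<close>)
  qed
  also have "\<dots> = ennreal (1/2) * ennreal h + ennreal (1/2) * (\<integral>\<^sup>+t. ennreal ((norm (g t))\<^sup>2) \<partial>lborel)"
    using h by (subst nn_integral_add) (auto simp: nn_integral_cmult nn_integral_cmult_indicator)
  also have "\<dots> \<le> ennreal (1/2) * ennreal 1 + ennreal (1/2) * ennreal K"
    using K h by (intro add_mono mult_left_mono) (auto simp: g_def)
  also have "\<dots> = ennreal ((1 + K) / 2)"
    using \<open>K \<ge> 0\<close> ennreal_plus_mult[of "1/2 * 1" "1/2" K]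
    by (simp only: ennreal_mult[symmetric]) (simp add: add_divide_distrib)
  finally show ?thesis using \<open>K \<ge> 0\<close> by (simp add: ennreal_le_iff)
qed

text \<open>The differences of a primitive along vertical segments are bounded, so by Cauchy's estimate
their derivatives \<open>f (s + \<i> h) - f s\<close> are; averaging over \<open>h\<close> then bounds \<open>f s\<close>. This avoids the area
mean value property.\<close>

lemma half_plane_point_bound:
  fixes f :: "complex \<Rightarrow> complex"
  assumes hol: "f holomorphic_on {s. 0 < Re s}"
    and K: "\<And>x. 0 < x \<Longrightarrow> (\<integral>\<^sup>+t. ennreal ((norm (f (Complex x t)))\<^sup>2) \<partial>lborel) \<le> ennreal K" and "K \<ge> 0"
    and s: "0 < Re s"
  shows "norm (f s) \<le> (1 + K) / 2 * (1 + 2 / Re s)"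
proof -
  define S where "S = {s. 0 < Re s}"
  have S: "convex S" "open S"
    unfolding S_def by (auto intro: convex_halfspace_Re_gt open_halfspace_Re_gt)
  obtain P where "\<And>s. s \<in> S \<Longrightarrow> (P has_field_derivative f s) (at s within S)"
    using holomorphic_convex_primitive'[OF S hol[folded S_def]] by blast
  hence P: "(P has_field_derivative f s) (at s)" if "0 < Re s" for s
    using that at_within_open[OF _ S(2)] by (auto simp: S_def)
  have contf: "continuous_on S f"
    using hol holomorphic_on_imp_continuous_on by (auto simp: S_def)
  have contv: "continuous_on UNIV (\<lambda>t. f (Complex x t))" if "0 < x" for x
    unfolding Complex_eq
    by (rule continuous_on_compose2[OF contf]) (use that in \<open>auto simp: S_def intro!: continuous_intros\<close>)
  have meas: "(\<lambda>t. f (Complex x t)) \<in> borel_measurable borel" if "0 < x" for x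
    by (rule borel_measurable_continuous_onI[OF contv[OF that]])
  \<comment> \<open>\<open>r\<close> is half the distance from \<open>s\<close> to the axis, so that
    the closed disc stays in the half-plane; \<open>B\<close> is the bound on the vertical
    increments of the primitive.\<close>
  define r B where "r = Re s / 2" and "B = (1 + K) / 2"
  have r: "r > 0" "r < Re s" using s by (auto simp: r_def)
  have near: "0 < Re z" if "z \<in> cball s r" for z
    using that abs_Re_le_cmod[of "s - z"] r by (auto simp: dist_norm)
  have diff: "norm (f (s + \<i> * of_real h) - f s) \<le> B / r" if h: "0 \<le> h" "h \<le> 1" for h
  proof -
    define Q where "Q = (\<lambda>z. P (z + \<i> * of_real h) - P z)"
    have Q: "(Q has_field_derivative f (z + \<i> * of_real h) - f z) (at z)" if "0 < Re z" for z
      unfolding Q_def using P[of "z + \<i> * of_real h"] P[OF that] that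
      by (auto intro!: derivative_eq_intros simp: DERIV_shift[of P _ _ "\<i> * of_real h"] add.commute)
    have "norm ((deriv ^^ 1) Q s) \<le> fact 1 * B / r ^ 1"
    proof (rule Cauchy_inequality)
      show "Q holomorphic_on ball s r"
        unfolding holomorphic_on_def field_differentiable_def
        by (meson Q near ball_subset_cball subsetD has_field_derivative_at_within)
      show "continuous_on (cball s r) Q"
        by (meson Q near continuous_at_imp_continuous_on DERIV_isCont)
      show "norm (Q z) \<le> B" if "norm (s - z) = r" for z
      proof -
        have z: "0 < Re z" using near[of z] that by (auto simp: dist_norm)
        show ?thesis unfolding Q_def B_def
          by (rule half_plane_line_difference_bound[OF P meas[OF z] K[OF z] \<open>K \<ge> 0\<close> z h contv[OF z]])
      qed
    qed (rule r)
    thus ?thesis using DERIV_imp_deriv[OF Q[OF s]] by simp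
  qed
  define g where "g = (\<lambda>t. f (Complex (Re s) t))"
  note meas[OF s, folded g_def, measurable]
  have B0: "B \<ge> 0" using \<open>K \<ge> 0\<close> by (simp add: B_def)
  have "ennreal (norm (f s)) = (\<integral>\<^sup>+t. ennreal (norm (f s)) * indicator {Im s..Im s + 1} t \<partial>lborel)"
    by (simp add: nn_integral_cmult_indicator)
  also have "\<dots> \<le> (\<integral>\<^sup>+t. ennreal (1/2 + B / r) * indicator {Im s..Im s + 1} t + ennreal (1/2) * ennreal ((norm (g t))\<^sup>2) \<partial>lborel)"
  proof (rule nn_integral_mono)
    fix t
    have "norm (f s) \<le> 1/2 + B / r + 1/2 * (norm (g t))\<^sup>2" if "Im s \<le> t" "t \<le> Im s + 1"
    proof -
      have "s + \<i> * of_real (t - Im s) = Complex (Re s) t" by (simp add: complex_eq_iff)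
      with diff[of "t - Im s"] that have "norm (g t - f s) \<le> B / r" by (simp add: g_def)
      moreover have "norm (g t) \<le> 1/2 + 1/2 * (norm (g t))\<^sup>2"
        using sum_squares_bound[of "norm (g t)" 1] by simp
      moreover have "norm (f s) \<le> norm (g t) + norm (g t - f s)"
        using norm_triangle_ineq3[of "f s" "g t"] by (simp add: norm_minus_commute)
      ultimately show ?thesis by linarith
    qed
    hence "ennreal (norm (f s)) \<le> ennreal (1/2 + B / r) + ennreal (1/2) * ennreal ((norm (g t))\<^sup>2)"
      if "Im s \<le> t" "t \<le> Im s + 1"
      using that B0 r by (subst ennreal_plus_mult) (simp_all only: ennreal_leI, simp_all)
    thus "ennreal (norm (f s)) * indicator {Im s..Im s + 1} t
      \<le> ennreal (1/2 + B / r) * indicator {Im s..Im s + 1} t + ennreal (1/2) * ennreal ((norm (g t))\<^sup>2)"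
      by (cases "t \<in> {Im s..Im s + 1}") (simp_all only: indicator_simps mult_1_right mult_zero_right atLeastAtMost_iff zero_le add_0_left, simp_all)
  qed
  also have "\<dots> = ennreal (1/2 + B / r) + ennreal (1/2) * (\<integral>\<^sup>+t. ennreal ((norm (g t))\<^sup>2) \<partial>lborel)"
    by (subst nn_integral_add) (auto simp: nn_integral_cmult nn_integral_cmult_indicator)
  also have "\<dots> \<le> ennreal (1/2 + B / r) + ennreal (1/2) * ennreal K"
    using K[OF s] by (intro add_mono mult_left_mono) (auto simp: g_def)
  also have "\<dots> = ennreal (1/2 + B / r + K / 2)"
    using \<open>K \<ge> 0\<close> B0 r by (subst ennreal_plus_mult) auto
  finally have "norm (f s) \<le> 1/2 + B / r + K / 2"
    by (subst (asm) ennreal_le_iff) (use \<open>K \<ge> 0\<close> B0 r in auto)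
  also have "\<dots> = (1 + K) / 2 * (1 + 2 / Re s)"
    using s by (simp add: B_def r_def field_simps)
  finally show ?thesis .
qed

text \<open>The bound of \<open>half_plane_point_bound\<close> is not homogeneous in the function.
  It is applied on the unit ball, where \<open>h2_line_norm_le\<close> allows
  \<open>K = 4 * pi\<close>, and extended by scaling.\<close>

lemma bounded_linear_h2_eval:
  assumes s: "0 < Re s"
  shows "bounded_linear (\<lambda>F :: ('m::finite, 'p::finite) h2. h2_fun F s $ i $ j)"
proof -
  define c where "c = (1 + 4 * pi) / 2 * (1 + 2 / Re s)"
  have unit: "norm (h2_fun F s $ i $ j) \<le> c" if "norm F \<le> 1" for F :: "('m, 'p) h2"
    unfolding c_def
  proof (rule half_plane_point_bound)
    show "(\<lambda>s. h2_fun F s $ i $ j) holomorphic_on {s. 0 < Re s}"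
      using h2_fun[of F] by (simp add: hardy_h2_def)
    fix x :: real assume x: "0 < x"
    have "(\<integral>\<^sup>+t. ennreal ((norm (h2_fun F (Complex x t) $ i $ j))\<^sup>2) \<partial>lborel)
        \<le> (\<integral>\<^sup>+t. ennreal ((norm (h2_fun F (Complex x t)))\<^sup>2) \<partial>lborel)"
      by (intro nn_integral_mono ennreal_leI power_mono)
        (auto intro: order_trans[OF Finite_Cartesian_Product.norm_nth_le Finite_Cartesian_Product.norm_nth_le])
    also have "\<dots> \<le> ennreal (4 * pi * (norm F)\<^sup>2)" by (rule h2_line_norm_le[OF x])
    also have "\<dots> \<le> ennreal (4 * pi)"
      using power_mono[OF that, of 2] by (intro ennreal_leI) (simp add: mult_left_le)
    finally show "(\<integral>\<^sup>+t. ennreal ((norm (h2_fun F (Complex x t) $ i $ j))\<^sup>2) \<partial>lborel) \<le> ennreal (4 * pi)" .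
  qed (use s in auto)
  show ?thesis
  proof (rule bounded_linear_intro[of _ c])
    fix F :: "('m, 'p) h2"
    show "norm (h2_fun F s $ i $ j) \<le> norm F * c"
    proof (cases "F = 0")
      case False
      have "norm (h2_fun (F /\<^sub>R norm F) s $ i $ j) \<le> c" by (rule unit) (use False in simp)
      thus ?thesis using False by (simp add: field_simps)
    qed simp
  qed auto
qed

section \<open>The algebra of strictly proper functions\<close>

text \<open>In the norm below, multiplication is continuous, which it is not on the Hardy space. So the
resolvent is first differentiated here.\<close>

typedef sprop = "{g. strictly_proper_on_rhp g \<and> (\<forall>s. Re s \<le> 0 \<longrightarrow> g s = 0)}"
  morphisms sprop_fun Abs_sprop
  using strictly_proper_on_rhp_0 by blast

lemma strictly_proper_on_rhp_mult:
  assumes "strictly_proper_on_rhp f" "strictly_proper_on_rhp g"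
  shows "strictly_proper_on_rhp (\<lambda>s. f s * g s)"
proof -
  obtain K L where K: "\<And>s. 0 < Re s \<Longrightarrow> norm (f s) \<le> K / (1 + norm s)"
    and L: "\<And>s. 0 < Re s \<Longrightarrow> norm (g s) \<le> L / (1 + norm s)"
    using assms unfolding strictly_proper_on_rhp_def by blast
  have "norm (f s * g s) \<le> K * L / (1 + norm s)" if s: "0 < Re s" for s
  proof -
    have "0 \<le> K / (1 + norm s)" "0 \<le> L / (1 + norm s)"
      using K[OF s] L[OF s] norm_ge_zero order_trans by blast+
    moreover have "0 < 1 + norm s" by (simp add: add_pos_nonneg)
    ultimately have KL: "0 \<le> K" "0 \<le> L" by (auto simp: zero_le_divide_iff)
    have "norm (f s * g s) \<le> (K / (1 + norm s)) * (L / (1 + norm s))"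
      unfolding norm_mult by (intro mult_mono K L s) (use KL in \<open>auto intro: add_nonneg_nonneg\<close>)
    also have "\<dots> \<le> (K / (1 + norm s)) * L"
      using KL by (intro mult_left_mono) (auto simp: divide_le_eq mult_left_le add_pos_nonneg algebra_simps)
    finally show ?thesis by simp
  qed
  thus ?thesis using assms unfolding strictly_proper_on_rhp_def by (auto intro!: holomorphic_intros)
qed

definition scaleC_sprop :: "complex \<Rightarrow> sprop \<Rightarrow> sprop" where
  "scaleC_sprop c g = Abs_sprop (\<lambda>s. c * sprop_fun g s)"

definition times_sprop :: "sprop \<Rightarrow> sprop \<Rightarrow> sprop" where
  "times_sprop f g = Abs_sprop (\<lambda>s. sprop_fun f s * sprop_fun g s)"

lemma sprop_fun_scaleC [simp]: "sprop_fun (scaleC_sprop c g) s = c * sprop_fun g s"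
  unfolding scaleC_sprop_def using sprop_fun[of g]
  by (subst Abs_sprop_inverse) (auto intro: strictly_proper_on_rhp_cmult)

lemma sprop_fun_times [simp]: "sprop_fun (times_sprop f g) s = sprop_fun f s * sprop_fun g s"
  unfolding times_sprop_def using sprop_fun[of f] sprop_fun[of g]
  by (subst Abs_sprop_inverse) (auto intro: strictly_proper_on_rhp_mult)

lemma sprop_eqI: "(\<And>s. sprop_fun f s = sprop_fun g s) \<Longrightarrow> f = g"
  by (metis ext sprop_fun_inject)

instantiation sprop :: real_vector
begin
definition "0 = Abs_sprop (\<lambda>s. 0)"
definition "f + g = Abs_sprop (\<lambda>s. sprop_fun f s + sprop_fun g s)"
definition "a *\<^sub>R f = scaleC_sprop (of_real a) f"
definition "- f = scaleC_sprop (-1) f"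
definition "f - g = f + - (g :: sprop)"

lemma sprop_fun_0 [simp]: "sprop_fun 0 s = 0"
  unfolding zero_sprop_def by (subst Abs_sprop_inverse) (auto intro: strictly_proper_on_rhp_0)
lemma sprop_fun_plus [simp]: "sprop_fun (f + g) s = sprop_fun f s + sprop_fun g s"
  unfolding plus_sprop_def using sprop_fun[of f] sprop_fun[of g]
  by (subst Abs_sprop_inverse) (auto intro: strictly_proper_on_rhp_add)
lemma sprop_fun_scaleR [simp]: "sprop_fun (a *\<^sub>R f) s = of_real a * sprop_fun f s"
  by (simp add: scaleR_sprop_def)
lemma sprop_fun_uminus [simp]: "sprop_fun (- f) s = - sprop_fun f s"
  by (simp add: uminus_sprop_def)
lemma sprop_fun_minus [simp]: "sprop_fun (f - g) s = sprop_fun f s - sprop_fun g s"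
  by (simp add: minus_sprop_def)

instance
  by standard (auto intro!: sprop_eqI simp: algebra_simps)
end

instantiation sprop :: real_normed_vector
begin
text \<open>The least constant in the decay bound of \<open>strictly_proper_on_rhp\<close>. The
  weight is at least 1, which makes the norm submultiplicative, and its inverse is square integrable
  on vertical lines, which makes the embedding into the Hardy space bounded.\<close>

definition "norm f = (SUP s. (1 + norm s) * norm (sprop_fun f s))"
definition "sgn f = f /\<^sub>R norm (f :: sprop)"
definition "dist f g = norm (f - g :: sprop)"
definition "(uniformity :: (sprop \<times> sprop) filter) = (INF e\<in>{0 <..}. principal {(f, g). dist f g < e})"
definition "open U \<longleftrightarrow> (\<forall>f\<in>U. eventually (\<lambda>(f', g). f' = f \<longrightarrow> g \<in> U) (uniformity :: (sprop \<times> sprop) filter))"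

lemma norm_sprop_upper: "(1 + norm s) * norm (sprop_fun f s) \<le> norm f"
  unfolding norm_sprop_def
proof (rule cSUP_upper)
  obtain K where K: "\<And>s. 0 < Re s \<Longrightarrow> norm (sprop_fun f s) \<le> K / (1 + norm s)" "\<And>s. Re s \<le> 0 \<Longrightarrow> sprop_fun f s = 0"
    using sprop_fun[of f] unfolding strictly_proper_on_rhp_def by blast
  have "(1 + norm s) * norm (sprop_fun f s) \<le> max K 0" for s
  proof (cases "0 < Re s")
    case True
    with K(1)[OF True] have "(1 + norm s) * norm (sprop_fun f s) \<le> K"
      by (simp add: pos_le_divide_eq add_pos_nonneg mult.commute)
    thus ?thesis by simp
  qed (use K(2) in simp)
  thus "bdd_above (range (\<lambda>s. (1 + norm s) * norm (sprop_fun f s)))" by (rule bdd_aboveI2)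
qed simp

lemma norm_sprop_le: "(\<And>s. (1 + norm s) * norm (sprop_fun f s) \<le> K) \<Longrightarrow> norm f \<le> K"
  unfolding norm_sprop_def by (rule cSUP_least) auto

instance
proof
  fix f g :: sprop and a :: real and U :: "sprop set"
  show "norm f = 0 \<longleftrightarrow> f = 0"
  proof
    assume "norm f = 0"
    have "sprop_fun f s = 0" for s
    proof -
      have "(1 + norm s) * norm (sprop_fun f s) = 0"
        by (rule antisym) (use norm_sprop_upper[of s f] \<open>norm f = 0\<close> in auto)
      moreover have "1 + norm s \<noteq> 0" using norm_ge_zero[of s] by linarith
      ultimately show ?thesis by simp
    qed
    thus "f = 0" by (intro sprop_eqI) simp
  qed (simp add: norm_sprop_def)
  show "norm (f + g) \<le> norm f + norm g"
  proof (rule norm_sprop_le)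
    fix s
    have "(1 + norm s) * norm (sprop_fun f s + sprop_fun g s) \<le> (1 + norm s) * (norm (sprop_fun f s) + norm (sprop_fun g s))"
      by (intro mult_left_mono norm_triangle_ineq) auto
    also have "\<dots> \<le> norm f + norm g"
      using norm_sprop_upper[of s f] norm_sprop_upper[of s g] by (simp add: algebra_simps)
    finally show "(1 + norm s) * norm (sprop_fun (f + g) s) \<le> norm f + norm g" by simp
  qed
  have le: "norm (a *\<^sub>R f) \<le> \<bar>a\<bar> * norm f" for a :: real and f :: sprop
  proof (rule norm_sprop_le)
    fix s
    show "(1 + norm s) * norm (sprop_fun (a *\<^sub>R f) s) \<le> \<bar>a\<bar> * norm f"
      using mult_left_mono[OF norm_sprop_upper[of s f], of "\<bar>a\<bar>"] by (simp add: norm_mult mult_ac)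
  qed
  show "norm (a *\<^sub>R f) = \<bar>a\<bar> * norm f"
  proof (cases "a = 0")
    case True
    thus ?thesis by (simp add: norm_sprop_def)
  next
    case False
    have "\<bar>a\<bar> * norm f = \<bar>a\<bar> * norm (inverse a *\<^sub>R (a *\<^sub>R f))" using False by simp
    also have "\<dots> \<le> \<bar>a\<bar> * (\<bar>inverse a\<bar> * norm (a *\<^sub>R f))" by (intro mult_left_mono le) auto
    also have "\<dots> = norm (a *\<^sub>R f)" using False by (simp add: abs_mult[symmetric] mult.assoc[symmetric])
    finally show ?thesis using le[of a f] by simp
  qed
qed (rule sgn_sprop_def dist_sprop_def uniformity_sprop_def open_sprop_def)+
end

lemma norm_times_sprop: "norm (times_sprop f g) \<le> norm f * norm g"
proof (rule norm_sprop_le)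
  fix s
  have "norm (sprop_fun g s) \<le> (1 + norm s) * norm (sprop_fun g s)"
    by (simp add: algebra_simps)
  also note norm_sprop_upper[of s g]
  finally have "(1 + norm s) * norm (sprop_fun f s) * norm (sprop_fun g s) \<le> norm f * norm g"
    by (intro mult_mono norm_sprop_upper) auto
  thus "(1 + norm s) * norm (sprop_fun (times_sprop f g) s) \<le> norm f * norm g"
    by (simp add: norm_mult mult.assoc)
qed

lemma bounded_bilinear_times_sprop: "bounded_bilinear times_sprop"
  by (unfold_locales; (intro exI[of _ 1])?)
    (auto intro!: sprop_eqI simp: algebra_simps norm_times_sprop)

lemma norm_scaleC_sprop: "norm (scaleC_sprop c f) \<le> norm c * norm f"
proof (rule norm_sprop_le)
  fix s
  show "(1 + norm s) * norm (sprop_fun (scaleC_sprop c f) s) \<le> norm c * norm f"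
    using mult_left_mono[OF norm_sprop_upper[of s f], of "norm c"] by (simp add: norm_mult mult_ac)
qed

lemma normed_scalars_scaleC_sprop: "normed_scalars scaleC_sprop"
  by (unfold_locales; (intro exI[of _ 1])?)
    (auto intro!: sprop_eqI simp: algebra_simps scaleR_conv_of_real norm_scaleC_sprop)

section \<open>Embedding of strictly proper functions into the Hardy space\<close>

definition sprop_h2 :: "'p \<Rightarrow> 'm \<Rightarrow> sprop \<Rightarrow> ('m::finite, 'p::finite) h2" where
  "sprop_h2 i j g = Abs_h2 (\<lambda>s. axis i (axis j (sprop_fun g s)))"

text \<open>On a vertical line \<open>(1 + norm s)^2\<close> is at least \<open>1 + t^2\<close>, so
  the weighted norm controls the square integral; \<open>J\<close> is the integral of
  \<open>1 / (1 + t^2)\<close>.\<close>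

lemma sprop_line_norm_le:
  obtains J where "J \<ge> 0"
    "\<And>g x. 0 < x \<Longrightarrow> (\<integral>\<^sup>+t. ennreal ((norm (sprop_fun g (Complex x t)))\<^sup>2) \<partial>lborel) \<le> ennreal (J * (norm g)\<^sup>2)"
proof -
  obtain J where J: "(\<integral>\<^sup>+t. ennreal (1 / (1 + t\<^sup>2)) \<partial>lborel) = ennreal J" "J \<ge> 0"
    using nn_integral_inverse_square_less_top by (auto simp: less_top_ennreal)
  have "(\<integral>\<^sup>+t. ennreal ((norm (sprop_fun g (Complex x t)))\<^sup>2) \<partial>lborel) \<le> ennreal (J * (norm g)\<^sup>2)" if "0 < x" for g x
  proof -
    have "(norm (sprop_fun g (Complex x t)))\<^sup>2 \<le> (norm g)\<^sup>2 * (1 / (1 + t\<^sup>2))" for t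
    proof -
      let ?s = "Complex x t"
      have "1 + t\<^sup>2 \<le> (1 + norm ?s)\<^sup>2"
        using norm_ge_zero[of ?s] unfolding power2_sum power_one by (simp add: cmod_power2)
      hence "(1 + t\<^sup>2) * (norm (sprop_fun g ?s))\<^sup>2 \<le> (1 + norm ?s)\<^sup>2 * (norm (sprop_fun g ?s))\<^sup>2"
        by (intro mult_right_mono) auto
      also have "\<dots> \<le> (norm g)\<^sup>2"
        unfolding power_mult_distrib[symmetric] by (intro power_mono norm_sprop_upper) auto
      finally show ?thesis by (simp add: field_simps add_pos_nonneg)
    qed
    hence "(\<integral>\<^sup>+t. ennreal ((norm (sprop_fun g (Complex x t)))\<^sup>2) \<partial>lborel)
        \<le> (\<integral>\<^sup>+t. ennreal ((norm g)\<^sup>2) * ennreal (1 / (1 + t\<^sup>2)) \<partial>lborel)"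
      by (intro nn_integral_mono) (simp flip: ennreal_mult add: ennreal_leI)
    also have "\<dots> = ennreal (J * (norm g)\<^sup>2)"
      using J by (simp add: nn_integral_cmult ennreal_mult mult.commute)
    finally show ?thesis .
  qed
  with J(2) show ?thesis by (rule that)
qed

lemma h2_fun_sprop_h2 [simp]:
  "h2_fun (sprop_h2 i j g :: ('m::finite, 'p::finite) h2) s = axis i (axis j (sprop_fun g s))"
  unfolding sprop_h2_def
proof (subst Abs_h2_inverse)
  obtain J where J: "\<And>x. 0 < x \<Longrightarrow> (\<integral>\<^sup>+t. ennreal ((norm (sprop_fun g (Complex x t)))\<^sup>2) \<partial>lborel) \<le> ennreal (J * (norm g)\<^sup>2)"
    by (rule sprop_line_norm_le) blast
  have "(\<lambda>s. axis i (axis j (sprop_fun g s)) $ a $ b) holomorphic_on {s. 0 < Re s}" for a b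
    using sprop_fun[of g] by (cases "a = i"; cases "b = j") (auto simp: axis_def strictly_proper_on_rhp_def)
  thus "(\<lambda>s. axis i (axis j (sprop_fun g s))) \<in> hardy_h2"
    unfolding hardy_h2_alt using J sprop_fun[of g] by (auto simp: norm_axis)
qed simp

lemma bounded_linear_sprop_h2: "bounded_linear (sprop_h2 i j :: sprop \<Rightarrow> ('m::finite, 'p::finite) h2)"
proof -
  obtain J where J: "J \<ge> 0" "\<And>g x. 0 < x \<Longrightarrow> (\<integral>\<^sup>+t. ennreal ((norm (sprop_fun g (Complex x t)))\<^sup>2) \<partial>lborel) \<le> ennreal (J * (norm g)\<^sup>2)"
    by (rule sprop_line_norm_le) blast
  show ?thesis
  proof (rule bounded_linear_intro[of _ "sqrt (J / pi)"])
    fix g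
    have "(norm (sprop_h2 i j g :: ('m, 'p) h2))\<^sup>2 \<le> J * (norm g)\<^sup>2 / pi"
      by (rule h2_norm_le) (use J in \<open>auto simp: norm_axis\<close>)
    also have "\<dots> = (norm g * sqrt (J / pi))\<^sup>2"
      using J(1) by (simp add: power_mult_distrib)
    finally show "norm (sprop_h2 i j g :: ('m, 'p) h2) \<le> norm g * sqrt (J / pi)"
      by (rule power2_le_imp_le) (use J(1) in simp)
  qed (auto intro!: h2_eqI simp: axis_def vec_eq_iff scaleR_conv_of_real[where 'a=complex])
qed

lemma sprop_h2_scaleC: "sprop_h2 i j (scaleC_sprop c g) = scaleC_h2 c (sprop_h2 i j g)"
  by (rule h2_eqI) (auto simp: axis_def vec_eq_iff)

section \<open>Smoothness of the transfer map\<close>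

lemma sprop_fun_sum [simp]: "sprop_fun (\<Sum>i\<in>I. f i) s = (\<Sum>i\<in>I. sprop_fun (f i) s)"
  by (induction I rule: infinite_finite_induct) auto

lemma h2_fun_sum [simp]: "h2_fun (\<Sum>i\<in>I. f i :: ('m::finite, 'p::finite) h2) s = (\<Sum>i\<in>I. h2_fun (f i) s)"
  by (induction I rule: infinite_finite_induct) auto

lemma norm_matrix_vector_mult_le:
  fixes M :: "'k::real_normed_field^'n^'m"
  shows "norm (M *v x) \<le> (\<Sum>i\<in>UNIV. \<Sum>j\<in>UNIV. norm (M $ i $ j)) * norm x"
proof -
  have "norm (M *v x) \<le> (\<Sum>i\<in>UNIV. norm ((M *v x) $ i))"
    unfolding norm_vec_def[of "M *v x"] by (rule L2_set_le_sum) simp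
  also have "\<dots> \<le> (\<Sum>i\<in>UNIV. (\<Sum>j\<in>UNIV. norm (M $ i $ j)) * norm x)"
  proof (rule sum_mono)
    fix i
    have "norm ((M *v x) $ i) \<le> (\<Sum>j\<in>UNIV. norm (M $ i $ j * x $ j))"
      by (simp add: matrix_vector_mult_def norm_sum)
    also have "\<dots> \<le> (\<Sum>j\<in>UNIV. norm (M $ i $ j) * norm x)"
      by (intro sum_mono) (auto simp: norm_mult intro!: mult_left_mono Finite_Cartesian_Product.norm_nth_le)
    finally show "norm ((M *v x) $ i) \<le> (\<Sum>j\<in>UNIV. norm (M $ i $ j)) * norm x"
      by (simp add: sum_distrib_right)
  qed
  finally show ?thesis by (simp add: sum_distrib_right)
qed

lemma norm_matrix_nth_le: "norm (M $ i $ j) \<le> norm M"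
  by (rule order_trans[OF Finite_Cartesian_Product.norm_nth_le Finite_Cartesian_Product.norm_nth_le])

lemma mat_vector_mult:
  fixes x :: "'k::comm_semiring_1^'n"
  shows "mat s *v x = s *s x"
  by (simp add: vec_eq_iff matrix_vector_mult_def mat_def if_distrib if_distribR cong: if_cong)

lemma matrix_diff_ldistrib:
  fixes A :: "'a::ring_1^'n^'m"
  shows "A ** (B - C) = A ** B - A ** C"
  by (simp add: matrix_matrix_mult_def vec_eq_iff right_diff_distrib sum_subtractf)

lemma matrix_diff_rdistrib:
  fixes A :: "'a::ring_1^'n^'m"
  shows "(A - B) ** C = A ** C - B ** C"
  by (simp add: matrix_matrix_mult_def vec_eq_iff left_diff_distrib sum_subtractf)

section \<open>The resolvent as a map into the strictly proper functions\<close>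

definition resolvent :: "complex^'r^'r \<Rightarrow> 'r \<Rightarrow> 'r \<Rightarrow> sprop" where
  "resolvent A k l = Abs_sprop (\<lambda>s. if 0 < Re s then matrix_inv (mat s - A) $ k $ l else 0)"

lemma sprop_fun_resolvent:
  assumes "hurwitz A"
  shows "sprop_fun (resolvent A k l) s = (if 0 < Re s then matrix_inv (mat s - A) $ k $ l else 0)"
proof -
  have "strictly_proper_on_rhp (\<lambda>s. if 0 < Re s then matrix_inv (mat s - A) $ k $ l else 0)"
    using strictly_proper_resolvent[OF assms, of k l] unfolding strictly_proper_on_rhp_def
    by (subst holomorphic_cong[OF refl, where g="\<lambda>s. matrix_inv (mat s - A) $ k $ l"]) auto
  thus ?thesis unfolding resolvent_def by (subst Abs_sprop_inverse) auto
qed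

text \<open>With \<open>R\<close> and \<open>R'\<close> the two resolvents, this is
  \<open>R' - R = R ** (A' - A) ** R'\<close> read entrywise, as an identity in the normed space
  \<open>sprop\<close>, where such products can be estimated uniformly in \<open>s\<close>.\<close>

lemma resolvent_identity:
  assumes A: "hurwitz A" and A': "hurwitz A'"
  shows "resolvent A' k l - resolvent A k l =
    (\<Sum>c\<in>UNIV. \<Sum>d\<in>UNIV. scaleC_sprop ((A' - A) $ c $ d) (times_sprop (resolvent A k c) (resolvent A' d l)))"
    (is "_ = ?F")
proof (rule sprop_eqI)
  fix s
  show "sprop_fun (resolvent A' k l - resolvent A k l) s = sprop_fun ?F s"
  proof (cases "0 < Re s")
    case True
    define R R' where "R = matrix_inv (mat s - A)" and "R' = matrix_inv (mat s - A')"
    have inv: "invertible (mat s - A)" "invertible (mat s - A')"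
      using True A A' by (auto intro: hurwitz_imp_invertible)
    have "R ** (A' - A) ** R' = R ** ((mat s - A) - (mat s - A')) ** R'" by simp
    also have "\<dots> = (R ** (mat s - A)) ** R' - R ** ((mat s - A') ** R')"
      by (simp only: matrix_diff_ldistrib matrix_diff_rdistrib matrix_mul_assoc)
    also have "\<dots> = R' - R"
      using matrix_inv(2)[OF inv(1)] matrix_inv(1)[OF inv(2)] by (simp add: R_def R'_def)
    finally have "(R' - R) $ k $ l = (R ** (A' - A) ** R') $ k $ l" by simp
    also have "\<dots> = (\<Sum>d\<in>UNIV. \<Sum>c\<in>UNIV. (A' - A) $ c $ d * (R $ k $ c * R' $ d $ l))"
      by (simp add: matrix_matrix_mult_def sum_distrib_left sum_distrib_right mult_ac)
    also have "\<dots> = (\<Sum>c\<in>UNIV. \<Sum>d\<in>UNIV. (A' - A) $ c $ d * (R $ k $ c * R' $ d $ l))"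
      by (rule sum.swap)
    finally show ?thesis
      using True by (simp add: sprop_fun_resolvent A A' R_def R'_def)
  qed (simp add: sprop_fun_resolvent A A')
qed

text \<open>A solution of \<open>(s - A) x = b\<close> satisfies
  \<open>(s - A0) x = b + (A - A0) x\<close>. The bound for the resolvent of \<open>A0\<close> holds
  uniformly in \<open>s\<close> with its weight, so a small perturbation is absorbed on the left and
  the bound for \<open>A\<close> is at most twice as large.\<close>

lemma resolvent_locally_bounded:
  fixes A0 :: "complex^'r^'r"
  assumes A0: "hurwitz A0"
  obtains \<delta> K where "\<delta> > 0" "\<And>A. norm (A - A0) < \<delta> \<Longrightarrow> hurwitz A"
    "\<And>A k l. norm (A - A0) < \<delta> \<Longrightarrow> norm (resolvent A k l) \<le> K"
proof -
  define K where "K = (\<Sum>k\<in>UNIV. \<Sum>l\<in>UNIV. norm (resolvent A0 k l)) + 1"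
  define N where "N = real CARD('r) * real CARD('r)"
  have K: "K > 0" unfolding K_def by (intro add_nonneg_pos sum_nonneg) auto
  have N: "N > 0" by (simp add: N_def)
  \<comment> \<open>Chosen so that \<open>K * N * \<delta> = 1/2\<close>, where \<open>N\<close>
    counts the entries of the perturbation. The summand 1 in \<open>K\<close> keeps the denominator
    positive.\<close>
  define \<delta> where "\<delta> = 1 / (2 * N * K)"
  have \<delta>: "\<delta> > 0" using K N by (simp add: \<delta>_def)
  have R0: "norm (matrix_inv (mat s - A0) *v b) * (1 + norm s) \<le> K * norm b" if s: "0 < Re s" for s b
  proof -
    let ?S = "\<Sum>k\<in>UNIV. \<Sum>l\<in>UNIV. norm (matrix_inv (mat s - A0) $ k $ l)"
    have "?S * (1 + norm s) \<le> (\<Sum>k\<in>UNIV. \<Sum>l\<in>UNIV. norm (resolvent A0 k l))"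
      unfolding sum_distrib_right
      by (intro sum_mono) (use norm_sprop_upper[of s "resolvent A0 _ _"] s in \<open>simp add: sprop_fun_resolvent A0 mult.commute\<close>)
    hence "?S * (1 + norm s) * norm b \<le> K * norm b"
      by (intro mult_right_mono) (auto simp: K_def)
    moreover have "norm (matrix_inv (mat s - A0) *v b) * (1 + norm s) \<le> ?S * norm b * (1 + norm s)"
      by (intro mult_right_mono norm_matrix_vector_mult_le) auto
    ultimately show ?thesis by (simp add: mult_ac)
  qed
  have key: "norm x * (1 + norm s) \<le> 2 * K * norm b"
    if A: "norm (A - A0) < \<delta>" and s: "0 < Re s" and x: "(mat s - A) *v x = b" for A s x b
  proof -
    have "(mat s - A0) *v x = b + (A - A0) *v x"
      using x by (simp add: matrix_vector_mult_diff_rdistrib algebra_simps)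
    moreover have "matrix_inv (mat s - A0) *v ((mat s - A0) *v x) = x"
      using matrix_inv(2)[OF hurwitz_imp_invertible[OF A0]] s by (simp add: matrix_vector_mul_assoc)
    ultimately have "norm x * (1 + norm s) \<le> K * norm (b + (A - A0) *v x)"
      using R0[OF s] by metis
    also have "\<dots> \<le> K * (norm b + N * \<delta> * norm x)"
    proof (intro mult_left_mono order_trans[OF norm_triangle_ineq] add_left_mono)
      have "norm ((A - A0) *v x) \<le> (\<Sum>i\<in>UNIV. \<Sum>j\<in>UNIV. norm ((A - A0) $ i $ j)) * norm x"
        by (rule norm_matrix_vector_mult_le)
      also have "\<dots> \<le> (\<Sum>i\<in>(UNIV::'r set). \<Sum>j\<in>(UNIV::'r set). \<delta>) * norm x"
        by (intro mult_right_mono sum_mono order_trans[OF norm_matrix_nth_le less_imp_le[OF A]]) simp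
      finally show "norm ((A - A0) *v x) \<le> N * \<delta> * norm x" by (simp add: N_def)
    qed (use K in auto)
    also have "\<dots> = K * norm b + norm x / 2"
      using K N by (simp add: \<delta>_def field_simps)
    finally have "norm x / 2 + norm x * norm s \<le> K * norm b" by (simp add: algebra_simps)
    moreover have "0 \<le> norm x * norm s" by simp
    ultimately have "norm x + norm x * norm s \<le> 2 * (K * norm b)" by linarith
    thus ?thesis by (simp add: distrib_left mult.assoc)
  qed
  have hur: "hurwitz A" if A: "norm (A - A0) < \<delta>" for A
    unfolding hurwitz_def
  proof (intro allI impI, rule ccontr)
    fix l v assume lv: "v \<noteq> 0 \<and> A *v v = l *s v" and "\<not> Re l < 0"
    \<comment> \<open>The estimate \<open>key\<close> holds only in the open half-plane, and the
      eigenvalue \<open>l\<close> may lie on the axis. At \<open>l + \<epsilon>\<close> the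
      eigenvector solves the equation with right-hand side \<open>\<epsilon> v\<close>, and
      \<open>2 * K * \<epsilon> = 1/2\<close> makes the estimate contradictory.\<close>
    define \<epsilon> where "\<epsilon> = 1 / (4 * K)"
    have \<epsilon>: "\<epsilon> > 0" using K by (simp add: \<epsilon>_def)
    have "(mat (l + of_real \<epsilon>) - A) *v v = of_real \<epsilon> *s v"
      using lv by (simp add: matrix_vector_mult_diff_rdistrib mat_vector_mult vec.scale_left_distrib)
    from key[OF A _ this] \<open>\<not> Re l < 0\<close> \<epsilon>
    have "norm v * (1 + norm (l + of_real \<epsilon>)) \<le> 2 * K * norm (of_real \<epsilon> *s v)" by simp
    also have "\<dots> = norm v / 2"
      using K unfolding norm_vector_scalar_mult norm_of_real by (simp add: \<epsilon>_def)
    finally have "norm v / 2 + norm v * norm (l + of_real \<epsilon>) \<le> 0" by (simp add: algebra_simps)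
    moreover have "0 < norm v / 2" "0 \<le> norm v * norm (l + of_real \<epsilon>)" using lv by auto
    ultimately show False by linarith
  qed
  have "norm (resolvent A k l) \<le> 2 * K" if A: "norm (A - A0) < \<delta>" for A k l
  proof (rule norm_sprop_le)
    fix s
    show "(1 + norm s) * norm (sprop_fun (resolvent A k l) s) \<le> 2 * K"
    proof (cases "0 < Re s")
      case True
      let ?x = "matrix_inv (mat s - A) *v axis l 1"
      have "(mat s - A) *v ?x = axis l 1"
        using matrix_inv(1)[OF hurwitz_imp_invertible[OF hur[OF A]]] True by (simp add: matrix_vector_mul_assoc)
      from key[OF A True this] have "norm ?x * (1 + norm s) \<le> 2 * K" by (simp add: norm_axis)
      moreover have "matrix_inv (mat s - A) $ k $ l = ?x $ k"
        by (simp add: matrix_vector_mult_def axis_def if_distrib cong: if_cong)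
      hence "norm (matrix_inv (mat s - A) $ k $ l) \<le> norm ?x"
        by (metis Finite_Cartesian_Product.norm_nth_le)
      hence "(1 + norm s) * norm (matrix_inv (mat s - A) $ k $ l) \<le> norm ?x * (1 + norm s)"
        by (subst mult.commute) (intro mult_right_mono, auto)
      ultimately show ?thesis using True by (simp add: sprop_fun_resolvent hur[OF A])
    qed (use K in \<open>simp add: sprop_fun_resolvent hur[OF A]\<close>)
  qed
  with \<delta> hur show ?thesis by (rule that)
qed

lemma open_hurwitz: "open {A :: complex^'r^'r. hurwitz A}"
  unfolding open_dist
proof (intro ballI)
  fix A0 :: "complex^'r^'r" assume "A0 \<in> {A. hurwitz A}"
  then obtain \<delta> where "\<delta> > 0" "\<And>A. norm (A - A0) < \<delta> \<Longrightarrow> hurwitz A"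
    using resolvent_locally_bounded by (metis mem_Collect_eq)
  thus "\<exists>e>0. \<forall>A. dist A A0 < e \<longrightarrow> A \<in> {A. hurwitz A}" by (auto simp: dist_norm)
qed

lemma norm_resolvent_sum_le:
  assumes "\<And>c. norm (f c) \<le> K" "\<And>d. norm (g d) \<le> L" "0 \<le> K"
  shows "norm (\<Sum>c\<in>UNIV. \<Sum>d\<in>UNIV. scaleC_sprop ((E :: complex^'r^'r) $ c $ d) (times_sprop (f c) (g d)))
    \<le> real CARD('r) * real CARD('r) * (norm E * (K * L))" (is "norm ?F \<le> _")
proof -
  have "norm ?F \<le> (\<Sum>c\<in>(UNIV::'r set). \<Sum>d\<in>(UNIV::'r set). norm E * (K * L))"
  proof (intro sum_norm_le order_trans[OF norm_sum] sum_mono)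
    fix c d
    have "norm (scaleC_sprop (E $ c $ d) (times_sprop (f c) (g d))) \<le> norm (E $ c $ d) * norm (times_sprop (f c) (g d))"
      by (rule norm_scaleC_sprop)
    also have "\<dots> \<le> norm E * (K * L)"
      by (intro mult_mono norm_matrix_nth_le order_trans[OF norm_times_sprop] assms) auto
    finally show "norm (scaleC_sprop (E $ c $ d) (times_sprop (f c) (g d))) \<le> norm E * (K * L)" .
  qed
  thus ?thesis by simp
qed

lemma bounded_linear_matrix_nth: "bounded_linear (\<lambda>M. M $ i $ j)"
  by (rule bounded_linear_compose[OF bounded_linear_vec_nth bounded_linear_vec_nth])

text \<open>With \<open>E = A' - A\<close>, a second use of the resolvent identity turns the
  remainder \<open>R' - R - R E R\<close> into \<open>R E (R' - R)\<close>, which is quadratic in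
  \<open>E\<close> because the resolvents are locally bounded.\<close>

lemma has_derivative_resolvent:
  assumes A: "hurwitz (A :: complex^'r^'r)"
  shows "((\<lambda>A. resolvent A k l) has_derivative
    (\<lambda>E. \<Sum>c\<in>UNIV. \<Sum>d\<in>UNIV. scaleC_sprop (E $ c $ d) (times_sprop (resolvent A k c) (resolvent A d l)))) (at A)"
    (is "(_ has_derivative ?D) _")
  unfolding has_derivative_at_alt
proof (intro conjI allI impI)
  interpret sc: normed_scalars scaleC_sprop by (rule normed_scalars_scaleC_sprop)
  interpret tm: bounded_bilinear times_sprop by (rule bounded_bilinear_times_sprop)
  show "bounded_linear ?D"
    by (intro bounded_linear_sum bounded_linear_compose[OF sc.bounded_linear_left bounded_linear_matrix_nth])
  obtain \<delta> K where \<delta>: "\<delta> > 0" "\<And>A'. norm (A' - A) < \<delta> \<Longrightarrow> hurwitz A'"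
    and K: "\<And>A' k l. norm (A' - A) < \<delta> \<Longrightarrow> norm (resolvent A' k l) \<le> K"
    using resolvent_locally_bounded[OF A] by metis
  have K0: "0 \<le> K" using order_trans[OF norm_ge_zero K[of A]] \<delta>(1) by simp
  define N where "N = real CARD('r) * real CARD('r)"
  have N: "N \<ge> 0" by (simp add: N_def)
  \<comment> \<open>The constant of the quadratic remainder; 1 is added to make it positive, so that
    the radius \<open>e / M\<close> is meaningful.\<close>
  define M where "M = N * (K * (N * (K * K))) + 1"
  have M: "M > 0" using K0 N unfolding M_def by (intro add_nonneg_pos mult_nonneg_nonneg) auto
  fix e :: real assume e: "0 < e"
  show "\<exists>d>0. \<forall>A'. norm (A' - A) < d \<longrightarrow> norm (resolvent A' k l - resolvent A k l - ?D (A' - A)) \<le> e * norm (A' - A)"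
  proof (intro exI conjI allI impI)
    show "0 < min \<delta> (e / M)" using \<delta> e M by simp
    fix A' assume A': "norm (A' - A) < min \<delta> (e / M)"
    hence near: "norm (A' - A) < \<delta>" and small: "norm (A' - A) * M \<le> e"
      using M by (auto simp: pos_less_divide_eq)
    note id = resolvent_identity[OF A \<delta>(2)[OF near]]
    note id' = id[of k l]
    have first: "norm (resolvent A' d l - resolvent A d l) \<le> N * (norm (A' - A) * (K * K))" for d l
      unfolding id N_def using K[of A] K[OF near] \<delta>(1) K0 by (intro norm_resolvent_sum_le) auto
    have eq: "resolvent A' k l - resolvent A k l - ?D (A' - A) =
      (\<Sum>c\<in>UNIV. \<Sum>d\<in>UNIV. scaleC_sprop ((A' - A) $ c $ d) (times_sprop (resolvent A k c) (resolvent A' d l - resolvent A d l)))"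
      unfolding id' sum_subtractf[symmetric] by (simp add: tm.diff_right sc.diff_right)
    have "norm (resolvent A' k l - resolvent A k l - ?D (A' - A))
        \<le> N * (norm (A' - A) * (K * (N * (norm (A' - A) * (K * K)))))"
      unfolding eq unfolding N_def
      by (rule norm_resolvent_sum_le) (use K[of A] \<delta>(1) K0 first[unfolded N_def] in auto)
    also have "\<dots> = (N * (K * (N * (K * K))) * norm (A' - A)) * norm (A' - A)" by (simp add: mult_ac)
    also have "\<dots> \<le> (norm (A' - A) * M) * norm (A' - A)"
      by (intro mult_right_mono) (auto simp: M_def algebra_simps)
    also have "\<dots> \<le> e * norm (A' - A)" by (intro mult_right_mono small) auto
    finally show "norm (resolvent A' k l - resolvent A k l - ?D (A' - A)) \<le> e * norm (A' - A)" .
  qed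
qed

lemma map_triple_sel [simp]:
  "fst (map_triple e X) = map_matrix e (fst X)"
  "fst (snd (map_triple e X)) = map_matrix e (fst (snd X))"
  "snd (snd (map_triple e X)) = map_matrix e (snd (snd X))"
  by (simp_all add: map_triple_def case_prod_beta)

abbreviation (input) scale_triple where "scale_triple c \<equiv> map_triple ((*) c)"

text \<open>The derivative is a combination of products of resolvent entries. One more order of
  smoothness therefore needs the previous order for all entries at once, hence the induction over
  arbitrary \<open>k\<close> and \<open>l\<close>.\<close>

lemma ck_on_resolvent:
  "ck_on n scale_triple scaleC_sprop
     {X :: (complex, 'r::finite, 'm::finite, 'p::finite) triple. hurwitz (fst X)} (\<lambda>X. resolvent (fst X) k l)"
proof (induction n arbitrary: k l)
  interpret sc: normed_scalars scaleC_sprop by (rule normed_scalars_scaleC_sprop)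
  interpret tm: bounded_bilinear times_sprop by (rule bounded_bilinear_times_sprop)
  define D where "D = (\<lambda>k l. \<lambda>(X :: (complex, 'r, 'm, 'p) triple) V :: (complex, 'r, 'm, 'p) triple. \<Sum>c\<in>UNIV. \<Sum>d\<in>UNIV.
      scaleC_sprop (fst V $ c $ d) (times_sprop (resolvent (fst X) k c) (resolvent (fst X) d l)))"
  have der: "((\<lambda>X. resolvent (fst X) k l) has_derivative D k l X) (at X)" if "hurwitz (fst X)" for k l X
    using has_derivative_compose[OF has_derivative_fst[OF has_derivative_ident] has_derivative_resolvent[OF that]]
    by (simp add: D_def)
  {
    case 0
    show ?case unfolding ck_on.simps
      by (intro continuous_at_imp_continuous_on ballI has_derivative_continuous[OF der]) simp
  next
    case (Suc n)
    have "ck_on n scale_triple scaleC_sprop {X. hurwitz (fst X)} (\<lambda>X. D k l X v)" for v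
      unfolding D_def
      by (intro ck_on_sum ck_on_linear_comp[where L="scaleC_sprop _" and sb=scaleC_sprop] sc.bounded_linear_right
          ck_on_bilinear[where sd=scaleC_sprop, OF bounded_bilinear_times_sprop _ _ _ Suc Suc])
        (auto intro!: sprop_eqI simp: algebra_simps)
    moreover have "D k l X (map_triple ((*) c) v) = scaleC_sprop c (D k l X v)" for X c v
      by (rule sprop_eqI) (simp add: D_def sum_distrib_left mult_ac)
    ultimately show ?case unfolding ck_on.simps using der
      by (intro exI[of _ "D k l"]) auto
  }
qed

lemma axis_0: "axis i 0 = 0"
  by (simp add: axis_def vec_eq_iff)

text \<open>Expands \<open>C (s - A)^-1 B\<close> into single resolvent entries, with coefficients
  that depend on \<open>B\<close> and \<open>C\<close> alone. The Hardy space then enters only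
  through the bounded linear maps \<open>sprop_h2\<close> and the multiplication by scalars, not
  through products of functions.\<close>

lemma transfer_h2_eq_sum:
  fixes X :: "(complex, 'r::finite, 'm::finite, 'p::finite) triple"
  assumes "hurwitz (fst X)"
  shows "transfer_h2 (\<lambda>z. z) X = (\<Sum>i\<in>UNIV. \<Sum>j\<in>UNIV. \<Sum>k\<in>UNIV. \<Sum>l\<in>UNIV.
    scaleC_h2 (snd (snd X) $ i $ k * fst (snd X) $ l $ j) (sprop_h2 i j (resolvent (fst X) k l)))" (is "_ = ?F")
proof (rule h2_eqI)
  fix s
  have id: "map_triple (\<lambda>z. z) X = X" by (simp add: map_triple_def case_prod_beta map_matrix_def)
  show "h2_fun (transfer_h2 (\<lambda>z. z) X) s = h2_fun ?F s"
  proof (cases "0 < Re s")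
    case True
    have "h2_fun (transfer_h2 (\<lambda>z. z) X) s $ a $ b = (\<Sum>i\<in>UNIV. \<Sum>j\<in>UNIV. \<Sum>k\<in>UNIV. \<Sum>l\<in>UNIV.
      (snd (snd X) $ i $ k * fst (snd X) $ l $ j) * (axis i (axis j (matrix_inv (mat s - fst X) $ k $ l)) $ a $ b))" for a b
    proof -
      have ax: "axis i (axis j z) $ a $ b = (if i = a then if j = b then z else 0 else 0)" for i j and z :: complex
        by (simp add: axis_def)
      have "h2_fun (transfer_h2 (\<lambda>z. z) X) s $ a $ b
          = (\<Sum>k\<in>UNIV. \<Sum>l\<in>UNIV. snd (snd X) $ a $ k * fst (snd X) $ l $ b * matrix_inv (mat s - fst X) $ k $ l)"
        using assms True
        by (simp add: h2_fun_transfer_h2 id transfer_function_def case_prod_beta matrix_matrix_mult_def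
            sum_distrib_left sum_distrib_right mult_ac) (rule sum.swap)
      also have "\<dots> = (\<Sum>i\<in>UNIV. \<Sum>j\<in>UNIV. if i = a then if j = b then
          (\<Sum>k\<in>UNIV. \<Sum>l\<in>UNIV. snd (snd X) $ i $ k * fst (snd X) $ l $ j * matrix_inv (mat s - fst X) $ k $ l) else 0 else 0)"
      proof -
        have "(\<Sum>j\<in>UNIV. if i = a then if j = b then f i j else 0 else 0) = (if i = a then f i b else 0)"
          for i and f :: "'p \<Rightarrow> 'm \<Rightarrow> complex" by simp
        hence dd: "(\<Sum>i\<in>UNIV. \<Sum>j\<in>UNIV. if i = a then if j = b then f i j else 0 else 0) = f a b"
          for f :: "'p \<Rightarrow> 'm \<Rightarrow> complex" by simp
        show ?thesis unfolding dd ..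
      qed
      also have "\<dots> = (\<Sum>i\<in>UNIV. \<Sum>j\<in>UNIV. \<Sum>k\<in>UNIV. \<Sum>l\<in>UNIV. snd (snd X) $ i $ k * fst (snd X) $ l $ j *
          (if i = a then if j = b then matrix_inv (mat s - fst X) $ k $ l else 0 else 0))"
        by (intro sum.cong refl) auto
      finally show ?thesis unfolding ax .
    qed
    thus ?thesis using True assms
      by (simp add: vec_eq_iff sprop_fun_resolvent)
  next
    case False
    hence "h2_fun (transfer_h2 (\<lambda>z. z) X) s = 0"
      using h2_fun[of "transfer_h2 (\<lambda>z. z) X"] by (simp add: hardy_h2_def)
    thus ?thesis using False assms by (simp add: sprop_fun_resolvent axis_0) (simp add: vec_eq_iff)
  qed
qed

lemma open_hurwitz_triple: "open {X :: (complex, 'r::finite, 'm::finite, 'p::finite) triple. hurwitz (fst X)}"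
  using open_vimage[OF open_hurwitz continuous_on_fst[OF continuous_on_id]]
  by (simp add: vimage_def)

lemma ck_on_transfer_h2_complex:
  "ck_on n scale_triple scaleC_h2
     {X :: (complex, 'r::finite, 'm::finite, 'p::finite) triple. hurwitz (fst X)} (transfer_h2 (\<lambda>z. z))"
proof -
  interpret normed_scalars scaleC_h2 by (rule normed_scalars_scaleC_h2)
  have nth: "ck_on n scale_triple (*) U (\<lambda>X. fst (snd X) $ i $ j)"
    "ck_on n scale_triple (*) U (\<lambda>X. snd (snd X) $ i' $ j')"
    for i j i' j' and U :: "(complex, 'r, 'm, 'p) triple set"
    by (intro ck_on_linear bounded_linear_compose[OF bounded_linear_matrix_nth bounded_linear_compose[OF bounded_linear_fst bounded_linear_snd]]
        bounded_linear_compose[OF bounded_linear_matrix_nth bounded_linear_compose[OF bounded_linear_snd bounded_linear_snd]]; simp)+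
  have "ck_on n scale_triple scaleC_h2 {X :: (complex, 'r, 'm, 'p) triple. hurwitz (fst X)}
    (\<lambda>X. \<Sum>i\<in>UNIV. \<Sum>j\<in>UNIV. \<Sum>k\<in>UNIV. \<Sum>l\<in>UNIV.
      scaleC_h2 (snd (snd X) $ i $ k * fst (snd X) $ l $ j) (sprop_h2 i j (resolvent (fst X) k l)))"
  proof (intro ck_on_sum)
    fix i :: 'p and j :: 'm and k l :: 'r
    have r: "ck_on n scale_triple scaleC_h2 {X :: (complex, 'r, 'm, 'p) triple. hurwitz (fst X)}
        (\<lambda>X. sprop_h2 i j (resolvent (fst X) k l) :: ('m, 'p) h2)"
      by (rule ck_on_linear_comp[OF bounded_linear_sprop_h2 sprop_h2_scaleC ck_on_resolvent])
    show "ck_on n scale_triple scaleC_h2 {X :: (complex, 'r, 'm, 'p) triple. hurwitz (fst X)}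
        (\<lambda>X. scaleC_h2 (snd (snd X) $ i $ k * fst (snd X) $ l $ j) (sprop_h2 i j (resolvent (fst X) k l)))"
      by (rule ck_on_bilinear[OF bounded_bilinear_axioms assoc commute add_right ck_on_mult[OF nth(2) nth(1)] r])
  qed (auto simp: add_right zero_right)
  thus ?thesis by (rule ck_on_eqI) (simp_all add: open_hurwitz_triple transfer_h2_eq_sum)
qed

section \<open>Realizations over a field\<close>

text \<open>The formula of \<open>transfer_function\<close> over any field, so that a real system
  can be evaluated at real points without complexifying its matrices.\<close>

definition tf :: "('k::field, 'r::finite, 'm::finite, 'p::finite) triple \<Rightarrow> 'k \<Rightarrow> 'k^'m^'p" where
  "tf X s = snd (snd X) ** matrix_inv (mat s - fst X) ** fst (snd X)"

definition change_basis ::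
    "'k^'r^'r \<Rightarrow> ('k::semiring_1, 'r::finite, 'm::finite, 'p::finite) triple \<Rightarrow> ('k, 'r, 'm, 'p) triple" where
  "change_basis T X = (T ** fst X ** matrix_inv T, T ** fst (snd X), snd (snd X) ** matrix_inv T)"

text \<open>The dual system: controllability of a triple is treated as observability of its
  dual.\<close>

definition transpose_triple ::
    "('k, 'r::finite, 'm::finite, 'p::finite) triple \<Rightarrow> ('k, 'r, 'p, 'm) triple" where
  "transpose_triple X = (transpose (fst X), transpose (snd (snd X)), transpose (fst (snd X)))"

lemma change_basis_sel [simp]:
  "fst (change_basis T X) = T ** fst X ** matrix_inv T"
  "fst (snd (change_basis T X)) = T ** fst (snd X)"
  "snd (snd (change_basis T X)) = snd (snd X) ** matrix_inv T"
  by (simp_all add: change_basis_def)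

lemma transpose_triple_sel [simp]:
  "fst (transpose_triple X) = transpose (fst X)"
  "fst (snd (transpose_triple X)) = transpose (snd (snd X))"
  "snd (snd (transpose_triple X)) = transpose (fst (snd X))"
  by (simp_all add: transpose_triple_def)

lemma transpose_transpose_triple [simp]: "transpose_triple (transpose_triple X) = X"
  by (simp add: transpose_triple_def)

lemma tf_eq_transfer_function: "tf X = transfer_function X"
  by (simp add: fun_eq_iff tf_def transfer_function_def case_prod_beta)

lemma state_space_equivalent_iff:
  "state_space_equivalent X Y \<longleftrightarrow> (\<exists>T. invertible T \<and> Y = change_basis T X)"
  by (simp add: state_space_equivalent_def change_basis_def case_prod_beta)

section \<open>Similarity and duality of realizations\<close>

lemma mat_mult_commute: "mat s ** A = A ** (mat s :: 'k::comm_ring_1^'n^'n)"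
  by (simp add: vec_eq_iff matrix_matrix_mult_def mat_def if_distrib if_distribR mult.commute cong: if_cong)

lemma invertible_matrix_inv: "invertible A \<Longrightarrow> invertible (matrix_inv A)"
  using matrix_inv[of A] unfolding invertible_def by blast

lemma matrix_inv_matrix_inv:
  fixes T :: "'k::field^'n^'n"
  shows "invertible T \<Longrightarrow> matrix_inv (matrix_inv T) = T"
  by (rule matrix_inv_unique) (rule matrix_inv)

lemma matrix_inv_mult:
  fixes A B :: "'k::field^'n^'n"
  assumes "invertible A" "invertible B"
  shows "matrix_inv (A ** B) = matrix_inv B ** matrix_inv A"
proof (rule matrix_inv_unique)
  have "A ** B ** (matrix_inv B ** matrix_inv A) = A ** (B ** matrix_inv B) ** matrix_inv A"
    by (simp only: matrix_mul_assoc)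
  thus "A ** B ** (matrix_inv B ** matrix_inv A) = mat 1"
    by (simp add: matrix_inv assms)
qed

lemma transpose_matrix_inv:
  fixes A :: "'k::field^'n^'n"
  shows "invertible A \<Longrightarrow> matrix_inv (transpose A) = transpose (matrix_inv A)"
  by (rule matrix_inv_unique) (simp add: matrix_transpose_mul[symmetric] matrix_inv transpose_mat)

lemma invertible_transpose:
  fixes A :: "'k::field^'n^'n"
  shows "invertible (transpose A) \<longleftrightarrow> invertible A"
  by (simp add: invertible_det_nz)

lemma resolvent_matrix_similar:
  fixes A T :: "'k::field^'n^'n"
  assumes T: "invertible T"
  shows "mat s - T ** A ** matrix_inv T = T ** (mat s - A) ** matrix_inv T"
proof -
  have "T ** mat s ** matrix_inv T = mat s ** (T ** matrix_inv T)"
    by (simp only: mat_mult_commute[of s T, symmetric] matrix_mul_assoc)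
  thus ?thesis
    by (simp add: matrix_diff_ldistrib matrix_diff_rdistrib matrix_inv(1)[OF T])
qed

lemma invertible_resolvent_similar:
  fixes A T :: "'k::field^'n^'n"
  assumes T: "invertible T"
  shows "invertible (mat s - T ** A ** matrix_inv T) \<longleftrightarrow> invertible (mat s - A)"
  using T invertible_matrix_inv[OF T]
  by (simp add: resolvent_matrix_similar[OF T] invertible_det_nz det_mul)

lemma matrix_inv_resolvent_similar:
  fixes A T :: "'k::field^'n^'n"
  assumes T: "invertible T" and s: "invertible (mat s - A)"
  shows "matrix_inv (mat s - T ** A ** matrix_inv T) = T ** matrix_inv (mat s - A) ** matrix_inv T"
  using T s invertible_matrix_inv[OF T]
  by (simp add: resolvent_matrix_similar matrix_inv_mult invertible_mult matrix_inv_matrix_inv matrix_mul_assoc)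

lemma matrix_inv_cancel:
  fixes T :: "'k::field^'n^'n"
  assumes "invertible T"
  shows "matrix_inv T ** (T ** A) = A" "T ** (matrix_inv T ** A) = A"
    "B ** matrix_inv T ** T = B" "B ** T ** matrix_inv T = B"
  using matrix_inv[OF assms] by (simp_all add: matrix_mul_assoc) (simp_all add: matrix_mul_assoc[symmetric])

lemma tf_change_basis:
  assumes T: "invertible T" and s: "invertible (mat s - fst X)"
  shows "tf (change_basis T X) s = tf X s"
  unfolding tf_def change_basis_sel matrix_inv_resolvent_similar[OF assms]
  by (simp add: matrix_mul_assoc[symmetric] matrix_inv_cancel[OF T])

lemma tf_transpose_triple:
  assumes s: "invertible (mat s - fst X)"
  shows "tf (transpose_triple X) s = transpose (tf X s)"
proof -
  have "mat s - transpose (fst X) = transpose (mat s - fst X)"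
    by (simp add: transpose_def mat_def vec_eq_iff)
  thus ?thesis
    by (simp add: tf_def transpose_matrix_inv[OF s] matrix_transpose_mul matrix_mul_assoc)
qed

section \<open>Observability and invariant subspaces\<close>

lemma matrix_mult_nth: "(A ** B) $ i = A $ i v* B"
  by (simp add: vec_eq_iff matrix_matrix_mult_def vector_matrix_mult_def)

lemma linear_vector_matrix_mult:
  fixes A :: "'k::field^'n^'m"
  shows "Vector_Spaces.linear (*s) (*s) (\<lambda>v. v v* A)"
proof -
  have "(*v) (transpose A) = (\<lambda>v. v v* A)" by (simp add: fun_eq_iff)
  thus ?thesis using matrix_vector_mul_linear_gen[of "transpose A"] by simp
qed

lemma vector_mult_mat:
  fixes v :: "'k::comm_semiring_1^'n"
  shows "v v* mat s = s *s v"
  by (metis mat_vector_mult transpose_mat transpose_matrix_vector)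

text \<open>The Kalman rank condition without coordinates: the rows of \<open>C\<close> generate the
  whole row space under right multiplication by \<open>A\<close>. In this form it can be compared
  with spans of resolvent rows as well as with coordinate subspaces.\<close>

definition observable :: "'k::field^'r^'r \<Rightarrow> 'k^'r^'p \<Rightarrow> bool" where
  "observable A C \<longleftrightarrow>
     (\<forall>V. vec.subspace V \<and> (\<forall>i. C $ i \<in> V) \<and> (\<forall>v\<in>V. v v* A \<in> V) \<longrightarrow> V = UNIV)"

text \<open>A basis chosen inside \<open>Q\<close> is extended to a basis of the whole space, whose
  vectors become the rows of \<open>T\<close>; \<open>I\<close> marks the rows that came from
  \<open>Q\<close>.\<close>

lemma invertible_from_subspace:
  fixes Q :: "('k::field^'r) set"
  obtains T :: "'k^'r^'r" and I where "invertible T" "card I = vec.dim Q" "\<And>a. a \<in> I \<Longrightarrow> T $ a \<in> Q"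
    "Q \<subseteq> vec.span ((\<lambda>a. T $ a) ` I)"
proof -
  obtain B where B: "B \<subseteq> Q" "vec.independent B" "Q \<subseteq> vec.span B" "card B = vec.dim Q"
    using vec.basis_exists .
  obtain E where E: "B \<subseteq> E" "vec.independent E" "UNIV \<subseteq> vec.span E"
    using vec.maximal_independent_subset_extend[of B UNIV] B(2) by auto
  have finE: "finite E" using vec.finiteI_independent[OF E(2)] .
  have "card E = CARD('r)"
    using vec.basis_card_eq_dim[of E UNIV] E vec_dim_card by auto
  then obtain f where f: "bij_betw f (UNIV :: 'r set) E"
    using finite_same_card_bij[of "UNIV :: 'r set" E] finE by auto
  define T where "T = (\<chi> a. f a)"
  define I where "I = f -` B"
  have fI: "f ` I = B" using f E(1) by (auto simp: I_def bij_betw_def)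
  have "inj_on f I" using f by (auto simp: bij_betw_def intro: inj_on_subset)
  hence "card I = card B" using fI card_image by fastforce
  moreover have "rows T = E"
    using f by (auto simp: T_def rows_def row_def vec_lambda_eta bij_betw_def)
  hence "invertible T"
    using E(3) by (auto simp: invertible_left_inverse matrix_left_invertible_span_rows_gen)
  moreover have "(\<lambda>a. T $ a) ` I = B" using fI by (simp add: T_def)
  ultimately show ?thesis
    using B fI by (intro that[of T I]) (auto simp: T_def I_def)
qed

lemma invertible_from_spanning:
  fixes Q :: "('k::field^'r) set"
  assumes "vec.span Q = UNIV"
  obtains T :: "'k^'r^'r" where "invertible T" "\<And>a. T $ a \<in> Q"
proof -
  obtain T :: "'k^'r^'r" and I where T: "invertible T" "card I = vec.dim Q" "\<And>a. a \<in> I \<Longrightarrow> T $ a \<in> Q"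
    by (rule invertible_from_subspace[of Q]) blast
  have "vec.dim Q = CARD('r)" using vec.dim_span[of Q] assms vec_dim_card by metis
  hence "I = UNIV" using T(2) by (simp add: card_eq_UNIV_imp_eq_UNIV)
  with T show ?thesis by (intro that[of T]) auto
qed

text \<open>Multiplication by \<open>s - A\<close> maps \<open>V\<close> injectively into itself,
  hence onto itself by dimension, so its inverse preserves \<open>V\<close> too.\<close>

lemma subspace_invariant_resolvent:
  fixes A :: "'k::field^'r^'r"
  assumes V: "vec.subspace V" "\<And>v. v \<in> V \<Longrightarrow> v v* A \<in> V" and s: "invertible (mat s - A)"
    and v: "v \<in> V"
  shows "v v* matrix_inv (mat s - A) \<in> V"
proof -
  let ?N = "mat s - A"
  let ?f = "\<lambda>v. v v* ?N"
  have inj: "w v* ?N v* matrix_inv ?N = w" for w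
    using matrix_inv(1)[OF s] by (simp add: vector_matrix_mul_assoc)
  have N: "w v* ?N = s *s w - w v* A" for w
    by (simp add: vector_matrix_mult_diff_rdistrib vector_mult_mat)
  have sub: "?f ` V \<subseteq> V"
    unfolding N using V by (auto intro!: vec.subspace_diff vec.subspace_scale)
  have "vec.subspace (?f ` V)"
    using linear_vector_matrix_mult[of ?N] V(1) by (rule vec.linear_subspace_image)
  moreover have "vec.dim (?f ` V) = vec.dim V"
    by (rule vec.dim_image_eq[OF linear_vector_matrix_mult]) (metis inj inj_onI)
  ultimately have "?f ` V = V"
    using sub V(1) by (intro vec.subspace_dim_equal) auto
  with v obtain w where "w \<in> V" "v = ?f w" by auto
  thus ?thesis using inj by simp
qed

lemma observable_if_spanning:
  fixes A :: "'k::field^'r^'r" and C :: "'k^'r^'p"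
  assumes span: "vec.span Q = UNIV"
    and Q: "\<And>v. v \<in> Q \<Longrightarrow> \<exists>i s. invertible (mat s - A) \<and> v = C $ i v* matrix_inv (mat s - A)"
  shows "observable A C"
  unfolding observable_def
proof (intro allI impI)
  fix V assume V: "vec.subspace V \<and> (\<forall>i. C $ i \<in> V) \<and> (\<forall>v\<in>V. v v* A \<in> V)"
  have "Q \<subseteq> V"
  proof
    fix v assume "v \<in> Q"
    then obtain i s where "invertible (mat s - A)" "v = C $ i v* matrix_inv (mat s - A)"
      using Q by blast
    thus "v \<in> V" using V by (auto intro: subspace_invariant_resolvent)
  qed
  hence "vec.span Q \<subseteq> V" using V by (intro vec.span_minimal) auto
  thus "V = UNIV" using span by auto
qed

lemma closed_vec_span:
  fixes Q :: "('k::{real_normed_field,euclidean_space}^'r) set"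
  shows "closed (vec.span Q)"
proof (rule closed_subspace)
  have "r *\<^sub>R x = of_real r *s x" for r and x :: "'k^'r"
    by (simp add: vec_eq_iff scaleR_conv_of_real[where 'a='k])
  thus "subspace (vec.span Q)"
    by (auto simp: subspace_def intro: vec.span_zero vec.span_add vec.span_scale)
qed

text \<open>As \<open>s\<close> tends to infinity, \<open>s c (s - A)\<^sup>-\<^sup>1\<close> tends to \<open>c\<close>, so that the span contains the rows of \<open>C\<close>.\<close>

lemma observable_imp_spanning:
  fixes A :: "'k::{real_normed_field,euclidean_space}^'r^'r" and C :: "'k^'r^'p"
  assumes obs: "observable A C"
    and P: "\<And>b. \<exists>x\<in>P. x > (b::real)" "\<And>x. x \<in> P \<Longrightarrow> invertible (mat (of_real x) - A)"
  shows "vec.span {C $ i v* matrix_inv (mat (of_real x) - A) | i x. x \<in> P} = UNIV"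
proof -
  define Q where "Q = {C $ i v* matrix_inv (mat (of_real x) - A) | i x. x \<in> P}"
  define a where "a = (\<Sum>i\<in>UNIV. \<Sum>j\<in>UNIV. norm (A $ j $ i))"
  have a: "norm (v v* A) \<le> a * norm v" for v
    using norm_matrix_vector_mult_le[of "transpose A" v] by (simp add: a_def) (simp add: transpose_def)
  have a0: "a \<ge> 0" by (simp add: a_def sum_nonneg)
  \<comment> \<open>A rearrangement of \<open>R (s - A) = 1\<close>. It serves twice: to approximate
    the rows of \<open>C\<close> for large \<open>x\<close>, and afterwards to show that the span is
    invariant under \<open>A\<close>.\<close>
  have res: "(v v* matrix_inv (mat (of_real x) - A)) v* A = of_real x *s (v v* matrix_inv (mat (of_real x) - A)) - v"
    if "x \<in> P" for v x
  proof -
    let ?R = "matrix_inv (mat (of_real x) - A)"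
    have "v = v v* ?R v* (mat (of_real x) - A)"
      using matrix_inv(2)[OF P(2)[OF that]] by (simp add: vector_matrix_mul_assoc)
    also have "\<dots> = of_real x *s (v v* ?R) - v v* ?R v* A"
      by (simp add: vector_matrix_mult_diff_rdistrib vector_mult_mat)
    finally show ?thesis by (simp add: algebra_simps)
  qed
  have C: "C $ i \<in> vec.span Q" for i
  proof -
    have "C $ i \<in> closure (vec.span Q)"
      unfolding closure_approachable
    proof (intro allI impI)
      fix \<epsilon> :: real assume \<epsilon>: "0 < \<epsilon>"
      \<comment> \<open>The error of the approximation is at most \<open>a * norm v\<close>, and
        \<open>(x - a) * norm v \<le> norm (C $ i)\<close>; this lower bound on \<open>x\<close>
        therefore pushes the error below \<open>\<epsilon>\<close>.\<close>
      obtain x where x: "x \<in> P" "x > a + a * norm (C $ i) / \<epsilon>" using P(1) by blast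
      define v where "v = C $ i v* matrix_inv (mat (of_real x) - A)"
      have x0: "a < x" "0 < x" using x(2) a0 \<epsilon> by (auto intro: le_less_trans[rotated] add_nonneg_nonneg)
      have eq: "v v* A = of_real x *s v - C $ i" using res[OF x(1)] by (simp add: v_def)
      have "x * norm v = norm (v v* A + C $ i)"
        using x0 by (simp add: eq norm_vector_scalar_mult)
      also have "\<dots> \<le> a * norm v + norm (C $ i)"
        using norm_triangle_ineq[of "v v* A" "C $ i"] a[of v] by linarith
      finally have "(x - a) * norm v \<le> norm (C $ i)" by (simp add: algebra_simps)
      hence "a * ((x - a) * norm v) \<le> a * norm (C $ i)" using a0 by (intro mult_left_mono)
      also have "\<dots> < \<epsilon> * (x - a)"
        using x(2) \<epsilon> by (simp add: field_simps)
      finally have "(a * norm v) * (x - a) < \<epsilon> * (x - a)" by (simp add: mult_ac)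
      hence "a * norm v < \<epsilon>" using x0 by (simp add: mult_less_cancel_right)
      hence "dist (of_real x *s v) (C $ i) < \<epsilon>"
        using a[of v] by (simp add: dist_norm eq[symmetric])
      moreover have "of_real x *s v \<in> vec.span Q"
        unfolding v_def Q_def using x(1) by (intro vec.span_scale vec.span_base) blast
      ultimately show "\<exists>y\<in>vec.span Q. dist y (C $ i) < \<epsilon>" by blast
    qed
    thus ?thesis using closed_vec_span closure_closed by blast
  qed
  have "v v* A \<in> vec.span Q" if "v \<in> vec.span Q" for v
    using that
  proof (induction rule: vec.span_induct)
    case base
    show ?case
      using vec.linear_add[OF linear_vector_matrix_mult[of A]] vec.linear_scale[OF linear_vector_matrix_mult[of A]]
      by (auto intro!: vec.subspaceI vec.span_zero vec.span_add vec.span_scale)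
  next
    case (step v)
    then obtain i x where ix: "x \<in> P" "v = C $ i v* matrix_inv (mat (of_real x) - A)"
      by (auto simp: Q_def)
    show ?case unfolding ix(2) res[OF ix(1)]
      by (intro vec.span_diff vec.span_scale C vec.span_base) (use ix in \<open>auto simp: Q_def\<close>)
  qed
  with C obs show ?thesis
    unfolding observable_def Q_def by (metis (no_types, lifting) vec.subspace_span)
qed

text \<open>The hypothesis on \<open>A\<close> says that \<open>D\<close> intertwines the two state
  matrices, \<open>(s - D A) D = D (s - A)\<close>, so that
  \<open>(s - D A)^-1 D = D (s - A)^-1\<close>; then \<open>C D = C\<close> removes the remaining
  \<open>D\<close>. In its use \<open>D\<close> is the projection onto some of the states.\<close>

lemma tf_truncated:
  fixes A D :: "'k::field^'r^'r"
  assumes D: "D ** A ** D = D ** A" "C ** D = C"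
    and s: "invertible (mat s - A)" "invertible (mat s - D ** A)"
  shows "tf (D ** A, D ** B, C) s = tf (A, B, C) s"
proof -
  have "(mat s - D ** A) ** D = D ** (mat s - A)"
    by (simp add: matrix_diff_ldistrib matrix_diff_rdistrib D(1) mat_mult_commute[of s D])
  hence "matrix_inv (mat s - D ** A) ** ((mat s - D ** A) ** D) ** matrix_inv (mat s - A)
      = matrix_inv (mat s - D ** A) ** D ** ((mat s - A) ** matrix_inv (mat s - A))"
    by (simp add: matrix_mul_assoc)
  hence "matrix_inv (mat s - D ** A) ** D = D ** matrix_inv (mat s - A)"
    by (simp add: matrix_inv[OF s(1)] matrix_mul_assoc matrix_inv(2)[OF s(2)])
  thus ?thesis
    by (simp add: tf_def matrix_mul_assoc) (simp add: matrix_mul_assoc[symmetric] D, simp add: matrix_mul_assoc D)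
qed

text \<open>A proper invariant subspace containing the rows of \<open>C\<close> is spanned by the
  rows of \<open>T\<close> in \<open>I\<close>. In the new coordinates its elements vanish outside
  \<open>I\<close>; this applies to the rows of \<open>C\<close> and to the rows of \<open>A\<close>
  with index in \<open>I\<close>. Projecting onto the states in \<open>I\<close> then gives a padded
  triple of smaller order, to which \<open>tf_truncated\<close> applies.\<close>

lemma not_observable_reduction:
  fixes X :: "('k::field, 'r::finite, 'm::finite, 'p::finite) triple"
  assumes "\<not> observable (fst X) (snd (snd X))"
  obtains T D :: "'k^'r^'r" and I A B C where "invertible T" "card I < CARD('r)" "change_basis T X = (A, B, C)"
    "D ** A ** D = D ** A" "C ** D = C" "supported_on I (D ** A, D ** B, C)"
proof -
  obtain V where V: "vec.subspace V" "\<And>i. snd (snd X) $ i \<in> V" "\<And>v. v \<in> V \<Longrightarrow> v v* fst X \<in> V" "V \<noteq> UNIV"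
    using assms unfolding observable_def by blast
  obtain T :: "'k^'r^'r" and I where T: "invertible T" "card I = vec.dim V" "\<And>a. a \<in> I \<Longrightarrow> T $ a \<in> V"
    "V \<subseteq> vec.span ((\<lambda>a. T $ a) ` I)"
    by (rule invertible_from_subspace[of V]) blast
  have "vec.dim V \<noteq> CARD('r)"
    using vec.subspace_dim_equal[OF V(1) vec.subspace_UNIV] V(4) vec_dim_card by (metis order_refl subset_UNIV)
  hence card: "card I < CARD('r)"
    using T(2) dim_subset_UNIV_cart_gen[of V] by linarith
  define A B C where "A = T ** fst X ** matrix_inv T" and "B = T ** fst (snd X)" and "C = snd (snd X) ** matrix_inv T"
  have coord: "(v v* matrix_inv T) $ j = 0" if "v \<in> V" "j \<notin> I" for v j
  proof -
    have "v \<in> vec.span ((\<lambda>a. T $ a) ` I)" using T(4) that(1) by blast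
    thus ?thesis
    proof (induction rule: vec.span_induct)
      case base
      show ?case
        using vec.linear_add[OF linear_vector_matrix_mult[of "matrix_inv T"]] vec.linear_scale[OF linear_vector_matrix_mult[of "matrix_inv T"]]
        by (auto intro!: vec.subspaceI)
    next
      case (step v)
      then obtain a where a: "a \<in> I" "v = T $ a" by auto
      have "v v* matrix_inv T = (mat 1 :: 'k^'r^'r) $ a"
        using matrix_inv(1)[OF T(1)] by (simp add: a matrix_mult_nth[symmetric])
      thus ?case using a(1) that(2) by (auto simp: mat_def)
    qed
  qed
  have C0: "C $ i $ j = 0" if "j \<notin> I" for i j
    using coord[OF V(2) that] by (simp add: C_def matrix_mult_nth)
  have A0: "A $ a $ j = 0" if "a \<in> I" "j \<notin> I" for a j
    using coord[OF V(3)[OF T(3)] that(2)] that(1) by (simp add: A_def matrix_mult_nth)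
  define D :: "'k^'r^'r" where "D = (\<chi> a b. if a = b \<and> a \<in> I then 1 else 0)"
  have Dl: "(D ** M) $ a $ b = (if a \<in> I then M $ a $ b else 0)" for M :: "'k^'n^'r" and a b
    by (simp add: D_def matrix_matrix_mult_def if_distrib[of "\<lambda>x. x * _"] cong: if_cong)
  have Dr: "(M ** D) $ a $ b = (if b \<in> I then M $ a $ b else 0)" for M :: "'k^'r^'n" and a b
    by (simp add: D_def matrix_matrix_mult_def if_distrib[of "\<lambda>x. _ * x"] cong: if_cong conj_cong)
  have "D ** A ** D = D ** A" "C ** D = C"
    by (auto simp: vec_eq_iff Dr Dl A0 C0)
  moreover have "supported_on I (D ** A, D ** B, C)"
    unfolding supported_on_def using A0 C0 by (auto simp: Dl split: if_splits)
  ultimately show ?thesis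
    using T(1) card by (intro that[of T I A B C D]) (auto simp: A_def B_def C_def change_basis_def)
qed

text \<open>Used for the inclusion of the scalars into the complex numbers and for complex
  conjugation. Determinants and inverses, hence transfer functions, are rational in the entries and
  are carried along.\<close>

locale field_hom =
  fixes h :: "'a::field \<Rightarrow> 'b::field"
  assumes hom_add: "h (x + y) = h x + h y" and hom_mult: "h (x * y) = h x * h y" and hom_1: "h 1 = 1"
begin

lemma hom_0: "h 0 = 0"
  using hom_add[of 0 0] unfolding add_0_left by (metis add_cancel_left_left)

lemma hom_minus: "h (- x) = - h x"
  using hom_add[of x "- x"] by (simp add: hom_0 eq_neg_iff_add_eq_0 add.commute)

lemma hom_diff: "h (x - y) = h x - h y"
  using hom_add[of x "- y"] by (simp add: hom_minus)

lemma hom_sum: "h (\<Sum>i\<in>I. f i) = (\<Sum>i\<in>I. h (f i))"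
  by (induction I rule: infinite_finite_induct) (auto simp: hom_0 hom_add)

lemma hom_prod: "h (\<Prod>i\<in>I. f i) = (\<Prod>i\<in>I. h (f i))"
  by (induction I rule: infinite_finite_induct) (auto simp: hom_1 hom_mult)

lemma hom_eq_0_iff: "h x = 0 \<longleftrightarrow> x = 0"
  using hom_mult[of x "inverse x"] by (cases "x = 0") (auto simp: hom_0 hom_1)

lemma hom_eq_iff: "h x = h y \<longleftrightarrow> x = y"
  using hom_eq_0_iff[of "x - y"] by (simp add: hom_diff)

lemma map_matrix_mult: "map_matrix h (A ** B) = map_matrix h A ** map_matrix h B"
  by (simp add: vec_eq_iff matrix_matrix_mult_def hom_sum hom_mult)

lemma map_matrix_diff: "map_matrix h (A - B) = map_matrix h A - map_matrix h B"
  by (simp add: vec_eq_iff hom_diff)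

lemma map_matrix_mat: "map_matrix h (mat x) = mat (h x)"
  by (simp add: vec_eq_iff mat_def hom_0)

lemma map_matrix_transpose: "map_matrix h (transpose A) = transpose (map_matrix h A)"
  by (simp add: vec_eq_iff transpose_def)

lemma det_map_matrix:
  fixes A :: "'a^'n^'n"
  shows "det (map_matrix h A) = h (det A)"
proof -
  have "h (of_int (sign p)) = of_int (sign p)" for p :: "'n \<Rightarrow> 'n"
    by (simp add: sign_def hom_1 hom_minus)
  thus ?thesis by (simp add: det_def hom_sum hom_mult hom_prod)
qed

lemma invertible_map_matrix:
  fixes A :: "'a^'n^'n"
  shows "invertible (map_matrix h A) \<longleftrightarrow> invertible A"
  by (simp add: invertible_det_nz det_map_matrix hom_eq_0_iff)

lemma map_matrix_inv:
  fixes A :: "'a^'n^'n"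
  shows "invertible A \<Longrightarrow> matrix_inv (map_matrix h A) = map_matrix h (matrix_inv A)"
  by (rule matrix_inv_unique) (simp add: map_matrix_mult[symmetric] matrix_inv map_matrix_mat hom_1)

lemma invertible_resolvent_map:
  "invertible (mat (h s) - map_matrix h A) \<longleftrightarrow> invertible (mat s - A)"
  by (simp add: map_matrix_mat[symmetric] map_matrix_diff[symmetric] invertible_map_matrix)

lemma tf_map_triple:
  "invertible (mat s - fst X) \<Longrightarrow> tf (map_triple h X) (h s) = map_matrix h (tf X s)"
  by (simp add: tf_def map_matrix_mult map_matrix_inv[symmetric] map_matrix_diff map_matrix_mat)

lemma map_change_basis:
  "invertible T \<Longrightarrow> map_triple h (change_basis T X) = change_basis (map_matrix h T) (map_triple h X)"
  by (simp add: map_triple_def change_basis_def case_prod_beta map_matrix_mult map_matrix_inv)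

lemma map_transpose_triple: "map_triple h (transpose_triple X) = transpose_triple (map_triple h X)"
  by (simp add: map_triple_def transpose_triple_def case_prod_beta map_matrix_transpose)

end

interpretation cnj: field_hom cnj
  by unfold_locales auto

text \<open>No real eigenvalue exceeds the sum of the norms of the entries. Minimality compares a
  triple with arbitrary ones, possibly unstable or padded with the eigenvalue 0, so nodes for such a
  comparison have to be taken far out.\<close>

lemma matrix_large_shift_invertible:
  fixes A :: "'k::real_normed_field^'n^'n"
  obtains b where "\<And>x. x > (b::real) \<Longrightarrow> invertible (mat (of_real x) - A)"
proof
  define a where "a = (\<Sum>i\<in>UNIV. \<Sum>j\<in>UNIV. norm (A $ i $ j))"
  have a0: "a \<ge> 0" by (simp add: a_def sum_nonneg)
  fix x :: real assume x: "x > a"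
  show "invertible (mat (of_real x) - A)"
    unfolding invertible_left_inverse matrix_left_invertible_ker
  proof (intro allI impI)
    fix v assume "(mat (of_real x) - A) *v v = 0"
    hence "A *v v = of_real x *s v"
      by (simp add: matrix_vector_mult_diff_rdistrib mat_vector_mult)
    hence "x * norm v = norm (A *v v)" using x a0 by (simp add: norm_vector_scalar_mult)
    also have "\<dots> \<le> a * norm v" unfolding a_def by (rule norm_matrix_vector_mult_le)
    finally have "(x - a) * norm v \<le> 0" by (simp add: algebra_simps)
    thus "v = 0" using x by (simp add: mult_le_0_iff)
  qed
qed

text \<open>Rows of the observability matrix and columns of the controllability matrix for the
interpolation points \<open>\<sigma>\<close> and \<open>\<mu>\<close>, which are taken in the directions of the standard basis vectors
given by \<open>p\<close> and \<open>m\<close>.\<close>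

definition obs_matrix ::
    "('r \<Rightarrow> real) \<Rightarrow> ('r \<Rightarrow> 'p) \<Rightarrow> ('k::real_normed_field, 'r::finite, 'm::finite, 'p::finite) triple \<Rightarrow> 'k^'r^'r" where
  "obs_matrix \<sigma> p X = (\<chi> a. snd (snd X) $ p a v* matrix_inv (mat (of_real (\<sigma> a)) - fst X))"

definition ctr_matrix ::
    "('r \<Rightarrow> real) \<Rightarrow> ('r \<Rightarrow> 'm) \<Rightarrow> ('k::real_normed_field, 'r::finite, 'm::finite, 'p::finite) triple \<Rightarrow> 'k^'r^'r" where
  "ctr_matrix \<mu> m X = (\<chi> i b. (matrix_inv (mat (of_real (\<mu> b)) - fst X) ** fst (snd X)) $ i $ m b)"

lemma ctr_matrix_transpose:
  assumes "\<And>b. invertible (mat (of_real (\<mu> b)) - fst X)"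
  shows "ctr_matrix \<mu> m X = transpose (obs_matrix \<mu> m (transpose_triple X))"
proof -
  have "mat s - transpose (fst X) = transpose (mat s - fst X)" for s
    by (simp add: transpose_def mat_def vec_eq_iff)
  hence "matrix_inv (mat (of_real (\<mu> b)) - transpose (fst X)) = transpose (matrix_inv (mat (of_real (\<mu> b)) - fst X))" for b
    by (simp add: transpose_matrix_inv assms)
  thus ?thesis
    by (simp add: ctr_matrix_def obs_matrix_def vec_eq_iff matrix_matrix_mult_def vector_matrix_mult_def matrix_vector_mult_def)
      (simp add: transpose_def mult.commute)
qed

section \<open>Divided differences and the Loewner matrix\<close>

lemma mat_diff: "mat (s - t) = mat s - (mat t :: 'k::group_add^'n^'n)"
  by (simp add: mat_def vec_eq_iff)

lemma resolvent_difference: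
  fixes A :: "'k::field^'n^'n"
  assumes "invertible (mat s - A)" "invertible (mat t - A)"
  shows "matrix_inv (mat s - A) - matrix_inv (mat t - A)
    = mat (t - s) ** (matrix_inv (mat s - A) ** matrix_inv (mat t - A))"
proof -
  let ?R = "matrix_inv (mat s - A)" and ?Q = "matrix_inv (mat t - A)"
  have "?R ** ((mat t - A) - (mat s - A)) ** ?Q = ?R ** ((mat t - A) ** ?Q) - (?R ** (mat s - A)) ** ?Q"
    by (simp only: matrix_diff_ldistrib matrix_diff_rdistrib matrix_mul_assoc)
  also have "\<dots> = ?R - ?Q" by (simp add: matrix_inv assms)
  finally have "?R - ?Q = ?R ** mat (t - s) ** ?Q"
    by (simp add: mat_diff)
  thus ?thesis by (simp add: mat_mult_commute[of "t - s" ?R, symmetric] matrix_mul_assoc)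
qed

text \<open>By the resolvent identity \<open>C (R - Q) B = (\<mu> - \<sigma>) (C R) (Q B)\<close>,
  where \<open>R\<close> and \<open>Q\<close> are the resolvents at \<open>\<sigma>\<close> and
  \<open>\<mu>\<close>: divided differences of the transfer function factor through the state
  space.\<close>

lemma loewner_factorization:
  fixes X :: "('k::real_normed_field, 'r::finite, 'm::finite, 'p::finite) triple"
  assumes "invertible (mat (of_real (\<sigma> a)) - fst X)" "invertible (mat (of_real (\<mu> b)) - fst X)" "\<sigma> a \<noteq> \<mu> b"
  shows "(obs_matrix \<sigma> p X ** ctr_matrix \<mu> m X) $ a $ b
    = (tf X (of_real (\<sigma> a)) - tf X (of_real (\<mu> b))) $ p a $ m b / of_real (\<mu> b - \<sigma> a)"
proof -
  obtain A B C where X: "X = (A, B, C)" by (cases X)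
  let ?R = "matrix_inv (mat (of_real (\<sigma> a)) - A)" and ?Q = "matrix_inv (mat (of_real (\<mu> b)) - A)"
  let ?d = "of_real (\<mu> b) - of_real (\<sigma> a) :: 'k"
  have d: "?d \<noteq> 0" using assms(3) by simp
  have "tf X (of_real (\<sigma> a)) - tf X (of_real (\<mu> b)) = C ** (?R - ?Q) ** B"
    by (simp add: tf_def X matrix_diff_ldistrib matrix_diff_rdistrib)
  also have "?R - ?Q = mat ?d ** (?R ** ?Q)"
    by (rule resolvent_difference) (use assms X in auto)
  also have "C ** (mat ?d ** (?R ** ?Q)) ** B = (\<chi> i j. ?d * ((C ** ?R) ** (?Q ** B)) $ i $ j)"
  proof -
    have "C ** (mat ?d ** (?R ** ?Q)) ** B = C ** mat ?d ** (?R ** ?Q) ** B" by (simp only: matrix_mul_assoc)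
    also have "C ** mat ?d = (\<chi> i j. ?d * C $ i $ j)"
      by (simp add: vec_eq_iff matrix_matrix_mult_def mat_def if_distrib mult.commute cong: if_cong)
    also have "(\<chi> i j. ?d * C $ i $ j) ** (?R ** ?Q) ** B = (\<chi> i j. ?d * (C ** (?R ** ?Q) ** B) $ i $ j)"
      by (simp add: vec_eq_iff matrix_matrix_mult_def sum_distrib_left sum_distrib_right mult.assoc)
    finally show ?thesis by (simp only: matrix_mul_assoc)
  qed
  finally have "(tf X (of_real (\<sigma> a)) - tf X (of_real (\<mu> b))) $ p a $ m b / ?d = ((C ** ?R) ** (?Q ** B)) $ p a $ m b"
    using d by simp
  also have "\<dots> = (obs_matrix \<sigma> p X ** ctr_matrix \<mu> m X) $ a $ b"
    by (simp add: obs_matrix_def ctr_matrix_def X matrix_matrix_mult_def[of "C ** ?R" "?Q ** B"] matrix_mult_nth[of C])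
      (simp add: matrix_matrix_mult_def)
  finally show ?thesis by simp
qed

lemma obs_matrix_change_basis:
  assumes T: "invertible T" and s: "\<And>a. invertible (mat (of_real (\<sigma> a)) - fst X)"
  shows "obs_matrix \<sigma> p (change_basis T X) = obs_matrix \<sigma> p X ** matrix_inv T"
proof -
  have "(snd (snd X) ** matrix_inv T) $ i v* (T ** matrix_inv (mat (of_real (\<sigma> a)) - fst X) ** matrix_inv T)
    = (snd (snd X) $ i v* matrix_inv (mat (of_real (\<sigma> a)) - fst X)) v* matrix_inv T" for i a
    by (simp add: matrix_mult_nth vector_matrix_mul_assoc matrix_mul_assoc[symmetric] matrix_inv_cancel[OF T])
  thus ?thesis
    by (simp add: vec_eq_iff[where 'a="'a^'r"] obs_matrix_def matrix_inv_resolvent_similar[OF T s] matrix_mult_nth)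
qed

lemma ctr_matrix_change_basis:
  assumes T: "invertible T" and s: "\<And>b. invertible (mat (of_real (\<mu> b)) - fst X)"
  shows "ctr_matrix \<mu> m (change_basis T X) = T ** ctr_matrix \<mu> m X"
proof -
  have "T ** matrix_inv (mat (of_real (\<mu> b)) - fst X) ** matrix_inv T ** (T ** fst (snd X))
      = T ** (matrix_inv (mat (of_real (\<mu> b)) - fst X) ** fst (snd X))" for b
    by (simp add: matrix_mul_assoc[symmetric] matrix_inv_cancel[OF T])
  thus ?thesis
    by (simp add: vec_eq_iff ctr_matrix_def matrix_inv_resolvent_similar[OF T s])
      (simp add: matrix_matrix_mult_def)
qed

lemma obs_matrix_imp_observable:
  assumes "invertible (obs_matrix \<sigma> p X)" "\<And>a. invertible (mat (of_real (\<sigma> a)) - fst X)"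
  shows "observable (fst X) (snd (snd X))"
proof (rule observable_if_spanning)
  show "vec.span (rows (obs_matrix \<sigma> p X)) = UNIV"
    using assms(1) unfolding invertible_left_inverse matrix_left_invertible_span_rows_gen .
  fix v assume "v \<in> rows (obs_matrix \<sigma> p X)"
  then obtain a where "v = obs_matrix \<sigma> p X $ a" by (auto simp: rows_def row_def vec_lambda_eta)
  thus "\<exists>i s. invertible (mat s - fst X) \<and> v = snd (snd X) $ i v* matrix_inv (mat s - fst X)"
    using assms(2) by (auto simp: obs_matrix_def)
qed

lemma observable_imp_obs_matrix:
  fixes X :: "('k::{real_normed_field,euclidean_space}, 'r::finite, 'm::finite, 'p::finite) triple"
  assumes "observable (fst X) (snd (snd X))"
    and P: "\<And>b. \<exists>x\<in>P. x > (b::real)" "\<And>x. x \<in> P \<Longrightarrow> invertible (mat (of_real x) - fst X)"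
  obtains \<sigma> p where "range \<sigma> \<subseteq> P" "invertible (obs_matrix \<sigma> p X)"
proof -
  have span: "vec.span {snd (snd X) $ i v* matrix_inv (mat (of_real x) - fst X) | i x. x \<in> P} = UNIV"
    by (rule observable_imp_spanning[OF assms])
  obtain T :: "'k^'r^'r" where T: "invertible T"
    "\<And>a. T $ a \<in> {snd (snd X) $ i v* matrix_inv (mat (of_real x) - fst X) | i x. x \<in> P}"
    by (rule invertible_from_spanning[OF span]) (rule that)
  hence "\<forall>a. \<exists>i x. x \<in> P \<and> T $ a = snd (snd X) $ i v* matrix_inv (mat (of_real x) - fst X)" by blast
  then obtain p \<sigma> where "\<And>a. \<sigma> a \<in> P \<and> T $ a = snd (snd X) $ p a v* matrix_inv (mat (of_real (\<sigma> a)) - fst X)"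
    by metis
  moreover from this have "T = obs_matrix \<sigma> p X" by (simp add: obs_matrix_def vec_eq_iff)
  ultimately show ?thesis using T(1) by (intro that[of \<sigma> p]) auto
qed

lemma transpose_resolvent_invertible:
  fixes A :: "'k::field^'n^'n"
  shows "invertible (mat s - transpose A) \<longleftrightarrow> invertible (mat s - A)"
proof -
  have "mat s - transpose A = transpose (mat s - A)"
    by (simp add: transpose_def mat_def vec_eq_iff)
  thus ?thesis by (simp add: invertible_transpose)
qed

lemma supported_on_transpose_triple: "supported_on I (transpose_triple X) \<longleftrightarrow> supported_on I X"
  by (auto simp: supported_on_def transpose_triple_def case_prod_beta transpose_def)

text \<open>A padding state \<open>j\<close> is in the kernel of \<open>A\<close>, so the resolvent
  only multiplies it by \<open>inverse (\<sigma> a)\<close>, and the column \<open>j\<close> of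
  \<open>C\<close> vanishes. Hence the observability matrix of a padded triple has a zero
  column.\<close>

lemma obs_matrix_supported:
  fixes X :: "('k::real_normed_field, 'r::finite, 'm::finite, 'p::finite) triple"
  assumes I: "supported_on I X" "j \<notin> I" and s: "\<And>a. invertible (mat (of_real (\<sigma> a)) - fst X)" "\<And>a. \<sigma> a \<noteq> 0"
  shows "obs_matrix \<sigma> p X $ a $ j = 0"
proof -
  let ?N = "mat (of_real (\<sigma> a)) - fst X" and ?c = "snd (snd X) $ p a"
  have A: "fst X *v axis j 1 = 0"
    using I by (auto simp: vec_eq_iff matrix_vector_mult_def axis_def supported_on_def if_distrib case_prod_beta cong: if_cong)
  have "matrix_inv ?N *v (?N *v axis j 1) = axis j 1"
    by (simp add: matrix_vector_mul_assoc matrix_inv(2)[OF s(1)])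
  moreover have "?N *v axis j 1 = of_real (\<sigma> a) *s axis j 1"
    by (simp add: matrix_vector_mult_diff_rdistrib mat_vector_mult A)
  ultimately have "of_real (\<sigma> a) *s (matrix_inv ?N *v axis j 1) = axis j 1"
    by (simp add: vec.scale)
  hence "matrix_inv ?N *v axis j 1 = inverse (of_real (\<sigma> a)) *s axis j 1"
    using s(2)[of a] by (metis of_real_eq_0_iff vec.scale_left_imp_eq vec.scale_scale right_inverse vec.scale_one)
  hence R: "matrix_inv ?N $ k $ j = (if k = j then inverse (of_real (\<sigma> a)) else 0)" for k
    by (simp add: vec_eq_iff matrix_vector_mult_def axis_def if_distrib cong: if_cong)
  have "?c $ j = 0" using I by (auto simp: supported_on_def case_prod_beta)
  thus ?thesis
    by (simp add: obs_matrix_def vector_matrix_mult_def R if_distrib cong: if_cong)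
qed

text \<open>Even and odd integers beyond \<open>c\<close>. Disjointness keeps every
  \<open>\<sigma>\<close> apart from every \<open>\<mu>\<close>; unboundedness is what
  \<open>observable_imp_spanning\<close> asks for.\<close>

lemma disjoint_unbounded_sets:
  obtains P Q :: "real set" where "P \<inter> Q = {}" "\<And>t. \<exists>x\<in>P. x > t" "\<And>t. \<exists>x\<in>Q. x > t"
    "\<And>x. x \<in> P \<union> Q \<Longrightarrow> x > c"
proof -
  define P where "P i = {real (2 * n + i) | n. real (2 * n + i) > c}" for i
  have unbounded: "\<exists>x\<in>P i. x > t" for i t
  proof -
    obtain n where "real n > max t (max c 0)" using reals_Archimedean2 by blast
    thus ?thesis unfolding P_def by (intro bexI[of _ "real (2 * n + i)"]) auto
  qed
  have "False" if x: "x \<in> P 0" "x \<in> P 1" for x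
  proof -
    obtain n k where "x = real (2 * n + 0)" "x = real (2 * k + 1)" using x unfolding P_def by blast
    hence "2 * n + 0 = 2 * k + 1" by (metis of_nat_eq_iff)
    thus False by presburger
  qed
  hence "P 0 \<inter> P 1 = {}" by blast
  moreover have "x > c" if "x \<in> P 0 \<union> P 1" for x using that by (auto simp: P_def)
  ultimately show ?thesis using unbounded by (intro that)
qed

text \<open>Repetitions within \<open>\<sigma>\<close> or within \<open>\<mu>\<close> are allowed:
  one node may be used in several directions.\<close>

definition good_points :: "('r \<Rightarrow> real) \<Rightarrow> ('r \<Rightarrow> real) \<Rightarrow> bool" where
  "good_points \<sigma> \<mu> \<longleftrightarrow> (\<forall>a. 0 < \<sigma> a) \<and> (\<forall>b. 0 < \<mu> b) \<and> (\<forall>a b. \<sigma> a \<noteq> \<mu> b)"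

section \<open>Minimal stable realizations\<close>

text \<open>\<open>e\<close> is the inclusion of the scalars into the complex numbers and \<open>pr\<close> a left inverse: the
identity maps in the complex case, \<open>of_real\<close> and \<open>Re\<close> in the real one.\<close>

locale scalar_embedding =
  fixes e :: "'k::{real_normed_field,euclidean_space} \<Rightarrow> complex" and pr :: "complex \<Rightarrow> 'k"
  assumes linear_e: "bounded_linear e" and e_mult: "e (x * y) = e x * e y" and e_1: "e 1 = 1"
    and linear_pr: "bounded_linear pr" and pr_mult: "pr (e c * z) = c * pr z" and pr_1: "pr 1 = 1"
begin

sublocale field_hom e
  using linear_e e_mult e_1 by unfold_locales (auto simp: linear_simps)

lemma pr_e: "pr (e c) = c"
  using pr_mult[of c 1] pr_1 by simp

lemma e_of_real: "e (of_real x) = of_real x"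
  using linear_simps(5)[OF linear_e, of x 1] e_1 by (simp add: of_real_def)

lemma hurwitz_imp_invertible_shift:
  assumes "hurwitz (fst (map_triple e X))" "0 \<le> x"
  shows "invertible (mat (of_real x) - fst X)"
  using hurwitz_imp_invertible[of "map_matrix e (fst X)" "of_real x"] assms
  by (simp add: invertible_resolvent_map[of "of_real x", unfolded e_of_real])

text \<open>Otherwise the truncation of \<open>not_observable_reduction\<close> would be a
  realization of smaller order of the same transfer function.\<close>

lemma minimal_imp_observable:
  fixes X :: "('k, 'r::finite, 'm::finite, 'p::finite) triple"
  assumes "minimal e X"
  shows "observable (fst X) (snd (snd X))"
proof (rule ccontr)
  assume "\<not> observable (fst X) (snd (snd X))"
  then obtain T D :: "'k^'r^'r" and I A B C where T: "invertible T" and I: "card I < CARD('r)"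
    and X: "change_basis T X = (A, B, C)" and D: "D ** A ** D = D ** A" "C ** D = C"
    and supp: "supported_on I (D ** A, D ** B, C)"
    by (rule not_observable_reduction) blast
  have "same_transfer (map_triple e X) (map_triple e (D ** A, D ** B, C))"
    unfolding same_transfer_def tf_eq_transfer_function[symmetric]
  proof (intro allI impI, elim conjE)
    fix s assume s: "invertible (mat s - fst (map_triple e X))" "invertible (mat s - fst (map_triple e (D ** A, D ** B, C)))"
    have T': "invertible (map_matrix e T)" using T by (simp add: invertible_map_matrix)
    have "tf (map_triple e X) s = tf (map_triple e (A, B, C)) s"
      unfolding X[symmetric] map_change_basis[OF T] by (rule tf_change_basis[OF T' s(1), symmetric])
    moreover have "invertible (mat s - fst (map_triple e (A, B, C)))"
      unfolding X[symmetric] map_change_basis[OF T]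
      using s(1) by (simp add: invertible_resolvent_similar[OF T'])
    ultimately show "tf (map_triple e X) s = tf (map_triple e (D ** A, D ** B, C)) s"
      using s(2) tf_truncated[of "map_matrix e D" "map_matrix e A" "map_matrix e C" s "map_matrix e B"]
      by (simp add: map_triple_def map_matrix_mult[symmetric] D)
  qed
  with assms I supp show False unfolding minimal_def by blast
qed

lemma minimal_transpose_triple:
  fixes X :: "('k, 'r::finite, 'm::finite, 'p::finite) triple"
  assumes "minimal e X"
  shows "minimal e (transpose_triple X)"
  unfolding minimal_def
proof (safe)
  fix I and Y :: "('k, 'r, 'p, 'm) triple"
  assume Y: "card I < CARD('r)" "supported_on I Y" "same_transfer (map_triple e (transpose_triple X)) (map_triple e Y)"
  have "same_transfer (map_triple e X) (map_triple e (transpose_triple Y))"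
    unfolding same_transfer_def tf_eq_transfer_function[symmetric] map_transpose_triple
  proof (intro allI impI, elim conjE)
    fix s assume s: "invertible (mat s - fst (map_triple e X))" "invertible (mat s - fst (transpose_triple (map_triple e Y)))"
    hence s': "invertible (mat s - fst (map_triple e Y))" by (simp add: transpose_resolvent_invertible)
    have "tf (transpose_triple (map_triple e X)) s = tf (map_triple e Y) s"
      using Y(3) s s' unfolding same_transfer_def tf_eq_transfer_function[symmetric] map_transpose_triple
      by (simp add: transpose_resolvent_invertible)
    thus "tf (map_triple e X) s = tf (transpose_triple (map_triple e Y)) s"
      using tf_transpose_triple[OF s(1)] tf_transpose_triple[OF s'] by (metis transpose_transpose)
  qed
  with assms Y show False unfolding minimal_def by (metis supported_on_transpose_triple)
qed

text \<open>The Loewner matrix depends only on values of the transfer function, so it is the same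
  for a realization of smaller order. For the given triple it is a product of invertible matrices,
  while for a padded one the observability factor has a zero column; the determinants contradict
  each other.\<close>

lemma observable_controllable_imp_minimal:
  fixes X :: "('k, 'r::finite, 'm::finite, 'p::finite) triple"
  assumes obs: "observable (fst X) (snd (snd X))"
    and ctr: "observable (fst (transpose_triple X)) (snd (snd (transpose_triple X)))"
  shows "minimal e X"
  unfolding minimal_def
proof (safe)
  fix I and Y :: "('k, 'r, 'm, 'p) triple"
  assume I: "card I < CARD('r)" and supp: "supported_on I Y" and same: "same_transfer (map_triple e X) (map_triple e Y)"
  obtain b where b: "\<And>x. x > b \<Longrightarrow> invertible (mat (of_real x) - fst X)" using matrix_large_shift_invertible by blast
  obtain c where c: "\<And>x. x > c \<Longrightarrow> invertible (mat (of_real x) - fst Y)" using matrix_large_shift_invertible by blast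
  obtain P Q :: "real set" where PQ: "P \<inter> Q = {}" "\<And>t. \<exists>x\<in>P. x > t" "\<And>t. \<exists>x\<in>Q. x > t"
    "\<And>x. x \<in> P \<union> Q \<Longrightarrow> x > max 0 (max b c)"
    by (rule disjoint_unbounded_sets) blast
  have inv: "invertible (mat (of_real x) - fst X)" "invertible (mat (of_real x) - fst Y)" "x \<noteq> 0" if "x \<in> P \<union> Q" for x
    using PQ(4)[OF that] b c by auto
  obtain \<sigma> p where \<sigma>: "range \<sigma> \<subseteq> P" "invertible (obs_matrix \<sigma> p X)"
    using observable_imp_obs_matrix[OF obs PQ(2)] inv(1) by blast
  obtain \<mu> m where \<mu>: "range \<mu> \<subseteq> Q" "invertible (obs_matrix \<mu> m (transpose_triple X))"
    using observable_imp_obs_matrix[OF ctr PQ(3)] inv(1) by (auto simp: transpose_resolvent_invertible)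
  have \<sigma>P: "\<sigma> a \<in> P \<union> Q" and \<mu>P: "\<mu> a \<in> P \<union> Q" for a using \<sigma>(1) \<mu>(1) by auto
  have ne: "\<sigma> a \<noteq> \<mu> b" for a b using \<sigma>(1) \<mu>(1) PQ(1) by (metis disjoint_iff rangeI subsetD)
  \<comment> \<open>\<open>same_transfer\<close> compares the complexified triples; as
    \<open>e\<close> is injective, the equality descends to \<open>'k\<close> at the real
    nodes.\<close>
  have same': "tf X (of_real x) = tf Y (of_real x)" if "x \<in> P \<union> Q" for x
  proof -
    have "tf (map_triple e X) (e (of_real x)) = tf (map_triple e Y) (e (of_real x))"
      using same inv(1,2)[OF that] unfolding same_transfer_def tf_eq_transfer_function[symmetric]
      by (simp add: invertible_resolvent_map)
    thus ?thesis using inv(1,2)[OF that] by (simp add: tf_map_triple vec_eq_iff hom_eq_iff)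
  qed
  have "obs_matrix \<sigma> p X ** ctr_matrix \<mu> m X = obs_matrix \<sigma> p Y ** ctr_matrix \<mu> m Y"
    by (simp add: vec_eq_iff loewner_factorization ne inv(1,2)[OF \<sigma>P] inv(1,2)[OF \<mu>P] same'[OF \<sigma>P] same'[OF \<mu>P])
  hence "det (obs_matrix \<sigma> p X) * det (ctr_matrix \<mu> m X) = det (obs_matrix \<sigma> p Y) * det (ctr_matrix \<mu> m Y)"
    by (metis det_mul)
  moreover obtain j where "j \<notin> I" using I by (metis UNIV_eq_I less_irrefl)
  hence "det (obs_matrix \<sigma> p Y) = 0"
    using obs_matrix_supported[OF supp _ inv(2)[OF \<sigma>P] inv(3)[OF \<sigma>P], where j=j and p=p]
    by (intro det_zero_column(1)[of j]) (simp add: column_def vec_eq_iff)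
  moreover have "det (ctr_matrix \<mu> m X) \<noteq> 0"
    using \<mu>(2) inv(1)[OF \<mu>P] by (subst ctr_matrix_transpose) (simp_all add: invertible_det_nz)
  moreover have "det (obs_matrix \<sigma> p X) \<noteq> 0" using \<sigma>(2) by (simp add: invertible_det_nz)
  ultimately show False by simp
qed

text \<open>Replaces the quantification over all realizations of smaller order by the nonvanishing
  of two determinants for suitable nodes. Openness of the set and its invariance under change of
  basis are then visible.\<close>

lemma stable_minimal_iff:
  fixes X :: "('k, 'r::finite, 'm::finite, 'p::finite) triple"
  shows "X \<in> stable_minimal e \<longleftrightarrow> hurwitz (fst (map_triple e X)) \<and>
    (\<exists>\<sigma> p \<mu> m. good_points \<sigma> \<mu> \<and> invertible (obs_matrix \<sigma> p X) \<and> invertible (ctr_matrix \<mu> m X))"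
    (is "_ \<longleftrightarrow> _ \<and> ?E")
proof (cases "hurwitz (fst (map_triple e X))")
  case True
  note inv = hurwitz_imp_invertible_shift[OF True less_imp_le]
  obtain P Q :: "real set" where PQ: "P \<inter> Q = {}" "\<And>t. \<exists>x\<in>P. x > t" "\<And>t. \<exists>x\<in>Q. x > t"
    "\<And>x. x \<in> P \<union> Q \<Longrightarrow> x > 0"
    by (rule disjoint_unbounded_sets) blast
  have "minimal e X \<longleftrightarrow> ?E"
  proof
    assume min: "minimal e X"
    obtain \<sigma> p where \<sigma>: "range \<sigma> \<subseteq> P" "invertible (obs_matrix \<sigma> p X)"
      using observable_imp_obs_matrix[OF minimal_imp_observable[OF min] PQ(2)] inv PQ(4) by blast
    obtain \<mu> m where \<mu>: "range \<mu> \<subseteq> Q" "invertible (obs_matrix \<mu> m (transpose_triple X))"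
      using observable_imp_obs_matrix[OF minimal_imp_observable[OF minimal_transpose_triple[OF min]] PQ(3)] inv PQ(4)
      by (auto simp: transpose_resolvent_invertible)
    have "\<sigma> a \<in> P" "\<mu> a \<in> Q" for a using \<sigma>(1) \<mu>(1) by auto
    hence good: "good_points \<sigma> \<mu>" unfolding good_points_def using PQ(1,4) by (metis UnI1 UnI2 disjoint_iff)
    moreover from good have "invertible (ctr_matrix \<mu> m X)"
      using \<mu>(2) inv by (simp add: ctr_matrix_transpose good_points_def invertible_transpose)
    ultimately show ?E
      using \<sigma>(2) by blast
  next
    assume ?E
    then obtain \<sigma> p \<mu> m where g: "good_points \<sigma> \<mu>" and O: "invertible (obs_matrix \<sigma> p X)" and R: "invertible (ctr_matrix \<mu> m X)"
      by blast
    have inv': "invertible (mat (of_real (\<sigma> a)) - fst X)" "invertible (mat (of_real (\<mu> a)) - fst X)" for a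
      using g inv by (auto simp: good_points_def)
    have "invertible (obs_matrix \<mu> m (transpose_triple X))"
      using R by (simp add: ctr_matrix_transpose inv' invertible_transpose)
    thus "minimal e X"
      using O inv' by (intro observable_controllable_imp_minimal obs_matrix_imp_observable)
        (auto simp: transpose_resolvent_invertible)
  qed
  with True show ?thesis by (simp add: stable_minimal_def)
qed (simp add: stable_minimal_def)

lemma hurwitz_similar:
  fixes A T :: "complex^'n^'n"
  assumes T: "invertible T" and A: "hurwitz A"
  shows "hurwitz (T ** A ** matrix_inv T)"
  unfolding hurwitz_def
proof (intro allI impI)
  fix l v assume v: "v \<noteq> 0 \<and> (T ** A ** matrix_inv T) *v v = l *s v"
  define w where "w = matrix_inv T *v v"
  have Tw: "T *v w = v" by (simp add: w_def matrix_vector_mul_assoc matrix_inv[OF T])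
  hence "w \<noteq> 0" using v by auto
  moreover have "A *v w = matrix_inv T *v ((T ** A ** matrix_inv T) *v v)"
    by (simp add: w_def matrix_vector_mul_assoc matrix_mul_assoc matrix_inv[OF T])
  hence "A *v w = l *s w" using v by (simp add: w_def vec.scale)
  ultimately show "Re l < 0" using A unfolding hurwitz_def by blast
qed

lemma hurwitz_change_basis:
  assumes "invertible T" "hurwitz (fst (map_triple e X))"
  shows "hurwitz (fst (map_triple e (change_basis T X)))"
  using assms by (simp add: map_change_basis hurwitz_similar invertible_map_matrix)

lemma stable_minimal_change_basis:
  fixes X :: "('k, 'r::finite, 'm::finite, 'p::finite) triple"
  assumes T: "invertible T" and X: "X \<in> stable_minimal e"
  shows "change_basis T X \<in> stable_minimal e"
proof -
  obtain \<sigma> p \<mu> m where g: "good_points \<sigma> \<mu>" and O: "invertible (obs_matrix \<sigma> p X)" and R: "invertible (ctr_matrix \<mu> m X)"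
    and hur: "hurwitz (fst (map_triple e X))"
    using X unfolding stable_minimal_iff by blast
  have inv: "invertible (mat (of_real (\<sigma> a)) - fst X)" "invertible (mat (of_real (\<mu> a)) - fst X)" for a
    using g hurwitz_imp_invertible_shift[OF hur] by (auto simp: good_points_def less_imp_le)
  have "invertible (obs_matrix \<sigma> p (change_basis T X))" "invertible (ctr_matrix \<mu> m (change_basis T X))"
    using O R T invertible_matrix_inv[OF T]
    by (simp_all add: obs_matrix_change_basis ctr_matrix_change_basis inv invertible_mult)
  thus ?thesis unfolding stable_minimal_iff using hurwitz_change_basis[OF T hur] g by blast
qed

end

section \<open>Interpolation coordinates\<close>

lemma change_basis_change_basis:
  fixes X :: "('k::field, 'r::finite, 'm::finite, 'p::finite) triple"
  assumes "invertible S" "invertible T"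
  shows "change_basis S (change_basis T X) = change_basis (S ** T) X"
  by (simp add: change_basis_def matrix_inv_mult assms matrix_mul_assoc)

lemma change_basis_mat_1 [simp]:
  fixes X :: "('k::field, 'r::finite, 'm::finite, 'p::finite) triple"
  shows "change_basis (mat 1) X = X"
proof -
  have "matrix_inv (mat 1) = (mat 1 :: 'k^'r^'r)" by (rule matrix_inv_unique) simp
  thus ?thesis by (simp add: change_basis_def)
qed

text \<open>In coordinates where the observability matrix is \<open>mat 1\<close>, this reads
  \<open>B\<close> off the values at the \<open>\<sigma>\<close>. The next lemma gives likewise
  \<open>C\<close> times the controllability matrix from the values at the
  \<open>\<mu>\<close>.\<close>

lemma obs_matrix_mult_nth:
  "(obs_matrix \<sigma> p X ** fst (snd X)) $ a = tf X (of_real (\<sigma> a)) $ p a"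
  by (simp add: obs_matrix_def tf_def matrix_mult_nth vector_matrix_mul_assoc)

lemma mult_ctr_matrix_nth:
  "(snd (snd X) ** ctr_matrix \<mu> m X) $ i $ b = tf X (of_real (\<mu> b)) $ i $ m b"
proof -
  have "(snd (snd X) ** ctr_matrix \<mu> m X) $ i $ b
    = (snd (snd X) ** (matrix_inv (mat (of_real (\<mu> b)) - fst X) ** fst (snd X))) $ i $ m b"
    by (simp add: ctr_matrix_def matrix_matrix_mult_def[of "snd (snd X)"])
  thus ?thesis by (simp add: tf_def matrix_mul_assoc)
qed

text \<open>A realization for which the observability matrix is the identity is determined by its input
and output matrices, affinely. These matrices have \<open>r (m + p)\<close> entries, the dimension of the
manifold.\<close>

definition observable_form ::
    "('r \<Rightarrow> real) \<Rightarrow> ('r \<Rightarrow> 'p) \<Rightarrow> 'k::real_normed_field^('r \<times> ('m + 'p)) \<Rightarrow> ('k, 'r::finite, 'm::finite, 'p::finite) triple" where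
  "observable_form \<sigma> p v =
    ((\<chi> a j. (if a = j then of_real (\<sigma> a) else 0) - v $ (j, Inr (p a))), (\<chi> a j. v $ (a, Inl j)), (\<chi> i a. v $ (a, Inr i)))"

text \<open>The divided differences of \<open>loewner_factorization\<close>, read from a data
  vector: \<open>(a, Inl j)\<close> holds the value at \<open>\<sigma> a\<close> in row
  \<open>p a\<close> and column \<open>j\<close>, and \<open>(b, Inr i)\<close> the value at
  \<open>\<mu> b\<close> in row \<open>i\<close> and column \<open>m b\<close>. It makes sense for
  any vector, whether or not it comes from a system.\<close>

definition loewner_matrix ::
    "('r \<Rightarrow> real) \<Rightarrow> ('r \<Rightarrow> 'p) \<Rightarrow> ('r \<Rightarrow> real) \<Rightarrow> ('r \<Rightarrow> 'm) \<Rightarrow>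
     'k::real_normed_field^('r::finite \<times> ('m::finite + 'p::finite)) \<Rightarrow> 'k^'r^'r" where
  "loewner_matrix \<sigma> p \<mu> m w = (\<chi> a b. (w $ (a, Inl (m b)) - w $ (b, Inr (p a))) / of_real (\<mu> b - \<sigma> a))"

text \<open>The parameters for \<open>observable_form\<close>: \<open>B\<close> is part of the data,
  and \<open>C\<close> is solved from its product with the controllability matrix, which in these
  coordinates is the Loewner matrix.\<close>

definition interpolant ::
    "('r \<Rightarrow> real) \<Rightarrow> ('r \<Rightarrow> 'p) \<Rightarrow> ('r \<Rightarrow> real) \<Rightarrow> ('r \<Rightarrow> 'm) \<Rightarrow>
     'k::real_normed_field^('r::finite \<times> ('m::finite + 'p::finite)) \<Rightarrow> 'k^('r \<times> ('m + 'p))" where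
  "interpolant \<sigma> p \<mu> m w = (\<chi> q. case snd q of Inl j \<Rightarrow> w $ q
     | Inr i \<Rightarrow> ((\<chi> i b. w $ (b, Inr i)) ** matrix_inv (loewner_matrix \<sigma> p \<mu> m w)) $ i $ fst q)"

definition interpolation_data ::
    "('r \<Rightarrow> real) \<Rightarrow> ('r \<Rightarrow> 'p) \<Rightarrow> ('r \<Rightarrow> real) \<Rightarrow> ('r \<Rightarrow> 'm) \<Rightarrow>
     ('k::real_normed_field, 'r::finite, 'm::finite, 'p::finite) triple \<Rightarrow> 'k^('r \<times> ('m + 'p))" where
  "interpolation_data \<sigma> p \<mu> m X = (\<chi> q. case snd q of Inl j \<Rightarrow> tf X (of_real (\<sigma> (fst q))) $ p (fst q) $ j
     | Inr i \<Rightarrow> tf X (of_real (\<mu> (fst q))) $ i $ m (fst q))"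

lemma observable_form_sel:
  "fst (observable_form \<sigma> p v) $ a $ j = (if a = j then of_real (\<sigma> a) else 0) - v $ (j, Inr (p a))"
  "fst (snd (observable_form \<sigma> p v)) $ a $ j' = v $ (a, Inl j')"
  "snd (snd (observable_form \<sigma> p v)) $ i $ a = v $ (a, Inr i)"
  by (simp_all add: observable_form_def)

lemma interpolation_data_nth:
  "interpolation_data \<sigma> p \<mu> m X $ (a, Inl j) = tf X (of_real (\<sigma> a)) $ p a $ j"
  "interpolation_data \<sigma> p \<mu> m X $ (b, Inr i) = tf X (of_real (\<mu> b)) $ i $ m b"
  by (simp_all add: interpolation_data_def)

lemma vec_data_eqI:
  fixes v w :: "'k^('r::finite \<times> ('m::finite + 'p::finite))"
  assumes "\<And>a j. v $ (a, Inl j) = w $ (a, Inl j)" "\<And>a i. v $ (a, Inr i) = w $ (a, Inr i)"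
  shows "v = w"
  unfolding vec_eq_iff using assms by (metis prod.collapse sum.exhaust)

lemma loewner_interpolation_data:
  assumes "\<And>a. invertible (mat (of_real (\<sigma> a)) - fst X)" "\<And>b. invertible (mat (of_real (\<mu> b)) - fst X)"
    "\<And>a b. \<sigma> a \<noteq> \<mu> b"
  shows "loewner_matrix \<sigma> p \<mu> m (interpolation_data \<sigma> p \<mu> m X) = obs_matrix \<sigma> p X ** ctr_matrix \<mu> m X"
  by (simp add: vec_eq_iff loewner_matrix_def interpolation_data_nth loewner_factorization[OF assms])

text \<open>The data determine the realization up to the change of basis by its own observability
  matrix \<open>T\<close>. An invertible product \<open>T ** R\<close> forces \<open>T\<close> and
  \<open>R\<close> to be invertible, and then \<open>A\<close>, \<open>B\<close> and
  \<open>C\<close> in the new coordinates are all expressed by the data.\<close>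

lemma observable_form_interpolant:
  fixes X :: "('k::real_normed_field, 'r::finite, 'm::finite, 'p::finite) triple"
  assumes s: "\<And>a. invertible (mat (of_real (\<sigma> a)) - fst X)" "\<And>b. invertible (mat (of_real (\<mu> b)) - fst X)"
    "\<And>a b. \<sigma> a \<noteq> \<mu> b"
    and inv: "invertible (loewner_matrix \<sigma> p \<mu> m (interpolation_data \<sigma> p \<mu> m X))"
  shows "invertible (obs_matrix \<sigma> p X)"
    and "observable_form \<sigma> p (interpolant \<sigma> p \<mu> m (interpolation_data \<sigma> p \<mu> m X)) = change_basis (obs_matrix \<sigma> p X) X"
proof -
  define A B C T R where "A = fst X" and "B = fst (snd X)" and "C = snd (snd X)"
    and "T = obs_matrix \<sigma> p X" and "R = ctr_matrix \<mu> m X"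
  note defs = A_def B_def C_def T_def R_def
  define w where "w = interpolation_data \<sigma> p \<mu> m X"
  have L: "loewner_matrix \<sigma> p \<mu> m w = T ** R"
    unfolding w_def T_def R_def by (rule loewner_interpolation_data[OF s])
  hence "det (T ** R) \<noteq> 0" using inv by (simp add: w_def invertible_det_nz)
  hence T: "invertible T" and R: "invertible R" by (auto simp: det_mul invertible_det_nz)
  thus "invertible (obs_matrix \<sigma> p X)" by (simp add: T_def)
  have "(\<chi> i b. w $ (b, Inr i)) = C ** R"
    by (simp add: vec_eq_iff w_def interpolation_data_nth C_def R_def mult_ctr_matrix_nth)
  \<comment> \<open>With \<open>K = C ** R\<close> and the Loewner matrix \<open>T ** R\<close>, the
    factor \<open>R\<close> cancels.\<close>
  hence C': "(\<chi> i b. w $ (b, Inr i)) ** matrix_inv (loewner_matrix \<sigma> p \<mu> m w) = C ** matrix_inv T"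
    by (simp add: L matrix_inv_mult[OF T R] matrix_mul_assoc matrix_inv_cancel[OF R])
  \<comment> \<open>Row \<open>a\<close> of \<open>T\<close> is \<open>C $ p a\<close> times a
    resolvent at \<open>\<sigma> a\<close>. Clearing the resolvent gives a relation that, once
    \<open>T\<close> is moved to the identity, expresses \<open>A\<close> affinely by
    \<open>C\<close>.\<close>
  have TA: "T $ a v* A = of_real (\<sigma> a) *s T $ a - C $ p a" for a
  proof -
    have "C $ p a = T $ a v* (mat (of_real (\<sigma> a)) - A)"
      using matrix_inv(2)[OF s(1)] by (simp add: T_def obs_matrix_def A_def C_def vector_matrix_mul_assoc)
    thus ?thesis by (simp add: vector_matrix_mult_diff_rdistrib vector_mult_mat)
  qed
  have "(T ** A ** matrix_inv T) $ a = of_real (\<sigma> a) *s mat 1 $ a - (C ** matrix_inv T) $ p a" for a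
  proof -
    have "(T ** A ** matrix_inv T) $ a = (of_real (\<sigma> a) *s T $ a - C $ p a) v* matrix_inv T"
      by (simp add: matrix_mult_nth TA)
    also have "\<dots> = of_real (\<sigma> a) *s (T ** matrix_inv T) $ a - (C ** matrix_inv T) $ p a"
      by (simp add: vector_matrix_mult_diff_distrib scalar_vector_matrix_assoc matrix_mult_nth)
    finally show ?thesis by (simp add: matrix_inv[OF T])
  qed
  hence A': "(T ** A ** matrix_inv T) $ a $ j = (if a = j then of_real (\<sigma> a) else 0) - (C ** matrix_inv T) $ p a $ j" for a j
    by (simp add: mat_def)
  have v: "interpolant \<sigma> p \<mu> m w $ (a, Inl j) = (T ** B) $ a $ j" "interpolant \<sigma> p \<mu> m w $ (a, Inr i) = (C ** matrix_inv T) $ i $ a"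
    for a i j
    by (simp_all add: interpolant_def C') (simp add: w_def interpolation_data_nth T_def B_def obs_matrix_mult_nth)
  show "observable_form \<sigma> p (interpolant \<sigma> p \<mu> m (interpolation_data \<sigma> p \<mu> m X)) = change_basis (obs_matrix \<sigma> p X) X"
    unfolding w_def[symmetric] T_def[symmetric] change_basis_def
    by (simp add: observable_form_def v vec_eq_iff A'[unfolded A_def C_def] B_def C_def)
qed

text \<open>Conversely, any regular data are attained. The form of \<open>A\<close> makes the
  observability matrix the identity, the definition of the Loewner matrix \<open>L\<close> makes it
  the controllability matrix, and \<open>C ** L\<close> is the prescribed part of the data. The data
  are arbitrary here, so the resolvents at the nodes are assumed to exist.\<close>

lemma interpolation_data_observable_form:
  fixes w :: "'k::real_normed_field^('r::finite \<times> ('m::finite + 'p::finite))"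
    and \<sigma> \<mu> :: "'r \<Rightarrow> real" and p :: "'r \<Rightarrow> 'p" and m :: "'r \<Rightarrow> 'm"
  defines "X \<equiv> observable_form \<sigma> p (interpolant \<sigma> p \<mu> m w)"
  assumes s: "\<And>a. invertible (mat (of_real (\<sigma> a)) - fst X)" "\<And>b. invertible (mat (of_real (\<mu> b)) - fst X)"
    "\<And>a b. \<sigma> a \<noteq> \<mu> b"
    and inv: "invertible (loewner_matrix \<sigma> p \<mu> m w)"
  shows "interpolation_data \<sigma> p \<mu> m X = w"
proof -
  define A B C L where "A = fst X" and "B = fst (snd X)" and "C = snd (snd X)" and "L = loewner_matrix \<sigma> p \<mu> m w"
  define K :: "'k^'r^'p" where "K = (\<chi> i b. w $ (b, Inr i))"
  have C: "C = K ** matrix_inv L"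
    by (simp add: C_def X_def observable_form_def interpolant_def K_def L_def vec_eq_iff)
  have CL: "C ** L = K"
    using matrix_inv_cancel(3)[OF inv[folded L_def]] by (simp add: C)
  have B: "B $ a $ j = w $ (a, Inl j)" for a j
    by (simp add: B_def X_def observable_form_sel interpolant_def)
  have A: "A $ a $ j = (if a = j then of_real (\<sigma> a) else 0) - C $ p a $ j" for a j
    by (simp add: A_def C_def X_def observable_form_sel)
  \<comment> \<open>By construction \<open>C $ p a\<close> is row \<open>a\<close> of
    \<open>\<sigma> a - A\<close>, so the inverse takes it to a standard basis vector.\<close>
  have "C $ p a v* matrix_inv (mat (of_real (\<sigma> a)) - A) = mat 1 $ a" for a
  proof -
    have "(mat (of_real (\<sigma> a)) - A) $ a = C $ p a"
      by (simp add: vec_eq_iff A mat_def)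
    hence "C $ p a = (mat 1 ** (mat (of_real (\<sigma> a)) - A)) $ a" by simp
    hence "C $ p a = mat 1 $ a v* (mat (of_real (\<sigma> a)) - A)" by (simp only: matrix_mult_nth)
    thus ?thesis using matrix_inv(1)[OF s(1)] by (simp add: A_def vector_matrix_mul_assoc)
  qed
  hence O: "obs_matrix \<sigma> p X = mat 1"
    by (simp add: obs_matrix_def vec_eq_iff[where 'a="'k^'r"] A_def C_def)
  have Inl: "interpolation_data \<sigma> p \<mu> m X $ (a, Inl j) = w $ (a, Inl j)" for a j
    using obs_matrix_mult_nth[of \<sigma> p X a] by (simp add: O interpolation_data_nth flip: B B_def)
  have "(matrix_inv (mat (of_real (\<mu> b)) - A) ** B) $ a $ m b = L $ a $ b" for a b
  proof -
    let ?N = "mat (of_real (\<mu> b)) - A"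
    have AL: "(A ** L) $ a $ b = of_real (\<sigma> a) * L $ a $ b - K $ p a $ b" for a
    proof -
      have "(A ** L) $ a $ b = of_real (\<sigma> a) * L $ a $ b - (C ** L) $ p a $ b"
        by (simp add: matrix_matrix_mult_def A left_diff_distrib sum_subtractf if_distrib[of "\<lambda>x. x * _"] cong: if_cong)
      thus ?thesis by (simp add: CL)
    qed
    have tL: "(mat t ** L) $ a $ b = t * L $ a $ b" for t a
      by (simp add: matrix_matrix_mult_def mat_def if_distrib[of "\<lambda>x. x * _"] cong: if_cong)
    \<comment> \<open>The factor \<open>\<mu> b - \<sigma> a\<close> cancels the denominator of
      \<open>L $ a $ b\<close>, which leaves a difference of two data; the term from
      \<open>C ** L\<close> adds the subtracted one back.\<close>
    have "(?N ** L) $ a $ b = B $ a $ m b" for a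
    proof -
      have "(?N ** L) $ a $ b = of_real (\<mu> b - \<sigma> a) * L $ a $ b + K $ p a $ b"
        by (simp add: matrix_diff_rdistrib AL tL algebra_simps)
      also have "of_real (\<mu> b - \<sigma> a) * L $ a $ b = w $ (a, Inl (m b)) - w $ (b, Inr (p a))"
        using s(3)[of a b] by (simp add: L_def loewner_matrix_def)
      finally show ?thesis by (simp add: K_def B)
    qed
    hence "(matrix_inv ?N ** B) $ a $ m b = (matrix_inv ?N ** (?N ** L)) $ a $ b"
      by (simp add: matrix_matrix_mult_def[of "matrix_inv ?N"])
    thus ?thesis by (simp add: matrix_inv_cancel(1) s(2)[folded A_def])
  qed
  hence R: "ctr_matrix \<mu> m X = L" by (simp add: ctr_matrix_def vec_eq_iff A_def B_def)
  have "interpolation_data \<sigma> p \<mu> m X $ (b, Inr i) = w $ (b, Inr i)" for b i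
    using mult_ctr_matrix_nth[of X \<mu> m i b] by (simp add: R interpolation_data_nth CL[unfolded C_def] K_def)
  with Inl show ?thesis by (rule vec_data_eqI)
qed

lemma ck_on_vec_component:
  fixes U :: "('k::{real_normed_field,euclidean_space}^'n) set"
  shows "ck_on n (*s) (*) U (\<lambda>w. w $ i)"
  by (rule ck_on_linear) (auto intro: bounded_linear_vec_nth)

lemma ck_on_loewner_matrix:
  fixes U :: "('k::{real_normed_field,euclidean_space}^('r::finite \<times> ('m::finite + 'p::finite))) set"
  shows "ck_on n (*s) (*) U (\<lambda>w. loewner_matrix \<sigma> p \<mu> m w $ a $ b)"
proof -
  have "(\<lambda>w. loewner_matrix \<sigma> p \<mu> m w $ a $ b)
    = (\<lambda>w :: 'k^('r \<times> ('m + 'p)). (w $ (a, Inl (m b)) + - w $ (b, Inr (p a))) * inverse (of_real (\<mu> b - \<sigma> a)))"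
    by (simp add: loewner_matrix_def divide_inverse)
  thus ?thesis
    by (simp only:) (intro ck_on_mult ck_on_add ck_on_uminus ck_on_vec_component ck_on_const; simp add: distrib_left)
qed

lemma open_loewner_invertible:
  "open {w :: 'k::{real_normed_field,euclidean_space}^('r::finite \<times> ('m::finite + 'p::finite)). invertible (loewner_matrix \<sigma> p \<mu> m w)}"
proof -
  have "continuous_on UNIV (\<lambda>w :: 'k^('r \<times> ('m + 'p)). det (loewner_matrix \<sigma> p \<mu> m w))"
    using ck_on_det[OF ck_on_loewner_matrix, of 0] by simp
  thus ?thesis unfolding invertible_det_nz by (intro open_Collect_neq continuous_intros)
qed

lemma ck_on_interpolant:
  "ck_on n (*s) (*s) {w :: 'k::{real_normed_field,euclidean_space}^('r::finite \<times> ('m::finite + 'p::finite)). invertible (loewner_matrix \<sigma> p \<mu> m w)}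
    (interpolant \<sigma> p \<mu> m)" (is "ck_on n _ _ ?U _")
proof (rule ck_on_vecI)
  fix q :: "'r \<times> ('m + 'p)"
  have "ck_on n (*s) (*) ?U (\<lambda>w. matrix_inv (loewner_matrix \<sigma> p \<mu> m w) $ a $ b)" for a b
    by (rule ck_on_matrix_inv[OF open_loewner_invertible ck_on_loewner_matrix]) (simp add: invertible_det_nz)
  thus "ck_on n (*s) (*) ?U (\<lambda>w. interpolant \<sigma> p \<mu> m w $ q)"
    by (cases "snd q")
      (auto simp: interpolant_def matrix_matrix_mult_def distrib_left intro!: ck_on_vec_component ck_on_sum ck_on_mult)
qed

section \<open>Coordinates on the Hardy space\<close>

context scalar_embedding
begin

abbreviation (input) scale_e :: "'k \<Rightarrow> ('m::finite, 'p::finite) h2 \<Rightarrow> ('m, 'p) h2" where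
  "scale_e c \<equiv> scaleC_h2 (e c)"

lemma linear_map_triple: "bounded_linear (map_triple e :: ('k, 'r::finite, 'm::finite, 'p::finite) triple \<Rightarrow> _)"
  by (rule linear_conv_bounded_linear[THEN iffD1], rule linearI)
    (auto simp: map_triple_def vec_eq_iff hom_add linear_simps(5)[OF linear_e])

lemma transfer_h2_map_triple:
  fixes X :: "('k, 'r::finite, 'm::finite, 'p::finite) triple"
  shows "transfer_h2 e X = transfer_h2 (\<lambda>z. z) (map_triple e X)"
proof -
  have id: "map_triple (\<lambda>z. z) Y = Y" for Y :: "(complex, 'r, 'm, 'p) triple"
    by (simp add: map_triple_def map_matrix_def case_prod_beta)
  show ?thesis unfolding transfer_h2_def id ..
qed

lemma ck_on_transfer_h2:
  "ck_on n scale_triple scale_e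
     {X :: ('k, 'r::finite, 'm::finite, 'p::finite) triple. hurwitz (fst (map_triple e X))} (transfer_h2 e)"
proof -
  have "ck_on n scale_triple scale_e
     {X :: ('k, 'r, 'm, 'p) triple. hurwitz (fst (map_triple e X))} (\<lambda>X. transfer_h2 (\<lambda>z. z) (0 + map_triple e X))"
    by (rule ck_on_comp_affine[where sb="scale_triple", OF linear_map_triple _ _ ck_on_transfer_h2_complex])
      (auto simp: map_triple_def vec_eq_iff hom_mult case_prod_beta)
  thus ?thesis by (simp add: transfer_h2_map_triple[abs_def])
qed

lemma h2_fun_transfer_h2_of_real:
  assumes "hurwitz (fst (map_triple e X))" "0 < x"
  shows "h2_fun (transfer_h2 e X) (of_real x) = map_matrix e (tf X (of_real x))"
proof -
  have "h2_fun (transfer_h2 e X) (of_real x) = tf (map_triple e X) (e (of_real x))"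
    using h2_fun_transfer_h2[OF assms(1)] assms(2) by (simp add: e_of_real tf_eq_transfer_function)
  thus ?thesis
    using hurwitz_imp_invertible_shift[OF assms(1)] assms(2) by (simp add: tf_map_triple)
qed

text \<open>Extends \<open>interpolation_data\<close> from systems to all Hardy functions. Composing
  with \<open>pr\<close> keeps it linear over \<open>'k\<close> and with values in \<open>'k\<close>
  even where the function is not real.\<close>

definition h2_data ::
    "('r \<Rightarrow> real) \<Rightarrow> ('r \<Rightarrow> 'p) \<Rightarrow> ('r \<Rightarrow> real) \<Rightarrow> ('r \<Rightarrow> 'm) \<Rightarrow> ('m::finite, 'p::finite) h2 \<Rightarrow> 'k^('r::finite \<times> ('m + 'p))" where
  "h2_data \<sigma> p \<mu> m H = (\<chi> q. case snd q of Inl j \<Rightarrow> pr (h2_fun H (of_real (\<sigma> (fst q))) $ p (fst q) $ j)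
     | Inr i \<Rightarrow> pr (h2_fun H (of_real (\<mu> (fst q))) $ i $ m (fst q)))"

lemma h2_data_transfer_h2:
  assumes "hurwitz (fst (map_triple e X))" "good_points \<sigma> \<mu>"
  shows "h2_data \<sigma> p \<mu> m (transfer_h2 e X) = interpolation_data \<sigma> p \<mu> m X"
  using assms
  by (auto simp: h2_data_def interpolation_data_def vec_eq_iff h2_fun_transfer_h2_of_real good_points_def pr_e split: sum.splits)

lemma linear_h2_data:
  assumes "good_points \<sigma> \<mu>"
  shows "bounded_linear (h2_data \<sigma> p \<mu> m :: ('m::finite, 'p::finite) h2 \<Rightarrow> 'k^('r::finite \<times> ('m + 'p)))"
proof -
  have eq: "h2_data \<sigma> p \<mu> m = (\<lambda>H :: ('m, 'p) h2. \<Sum>q\<in>UNIV. axis q (h2_data \<sigma> p \<mu> m H $ q))"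
    by (simp add: fun_eq_iff vec_eq_iff axis_def if_distrib cong: if_cong)
  have "bounded_linear (\<lambda>H :: ('m, 'p) h2. h2_data \<sigma> p \<mu> m H $ q)" for q :: "'r \<times> ('m + 'p)"
    using assms
    by (cases "snd q") (auto simp: h2_data_def good_points_def intro!: bounded_linear_compose[OF linear_pr bounded_linear_h2_eval])
  thus ?thesis
    by (subst eq) (intro bounded_linear_sum bounded_linear_compose[OF bounded_linear_axis])
qed

lemma h2_data_scale: "h2_data \<sigma> p \<mu> m (scaleC_h2 (e c) H) = c *s h2_data \<sigma> p \<mu> m H"
  by (auto simp: h2_data_def vec_eq_iff pr_mult split: sum.splits)

lemma open_hurwitz_map: "open {X :: ('k, 'r::finite, 'm::finite, 'p::finite) triple. hurwitz (fst (map_triple e X))}"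
  using open_vimage[OF open_hurwitz_triple linear_continuous_on[OF linear_map_triple]]
  by (simp add: vimage_def)

lemma open_stable_minimal: "open (stable_minimal e :: ('k, 'r::finite, 'm::finite, 'p::finite) triple set)"
proof -
  let ?H = "{X :: ('k, 'r, 'm, 'p) triple. hurwitz (fst (map_triple e X))}"
  let ?sa = "scale_triple :: _ \<Rightarrow> ('k, 'r, 'm, 'p) triple \<Rightarrow> _"
  \<comment> \<open>\<open>ck_on 0\<close> is continuity, so the rules for smooth maps also prove
    the continuity of the two determinants.\<close>
  have lin: "ck_on 0 ?sa (*) ?H (\<lambda>X. fst X $ i $ j)" "ck_on 0 ?sa (*) ?H (\<lambda>X. fst (snd X) $ k $ l)"
    "ck_on 0 ?sa (*) ?H (\<lambda>X. snd (snd X) $ g $ h)" for i j k l g h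
    by (auto intro!: continuous_intros)
  have inv: "ck_on 0 ?sa (*) ?H (\<lambda>X. matrix_inv (mat (of_real x) - fst X) $ i $ j)" if x: "0 < x" for x i j
  proof (rule ck_on_matrix_inv[OF open_hurwitz_map])
    show "ck_on 0 ?sa (*) ?H (\<lambda>X. (mat (of_real x) - fst X) $ i $ j)" for i j
      by (auto intro!: continuous_intros)
    show "det (mat (of_real x) - fst X) \<noteq> 0" if "X \<in> ?H" for X
      using hurwitz_imp_invertible_shift[of X x] that x by (simp add: invertible_det_nz)
  qed
  have "ck_on 0 ?sa (*) ?H (\<lambda>X. obs_matrix \<sigma> p X $ a $ j)" if "good_points \<sigma> \<mu>" for \<sigma> p \<mu> a j
    unfolding obs_matrix_def using that
    by (auto simp: vector_matrix_mult_def good_points_def distrib_left simp del: ck_on.simps map_triple_sel intro!: ck_on_sum ck_on_mult lin inv)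
  hence O: "open {X \<in> ?H. invertible (obs_matrix \<sigma> p X)}" if "good_points \<sigma> \<mu>" for \<sigma> p \<mu>
    using continuous_open_preimage[OF ck_on_imp_continuous_on[OF ck_on_det[of 0 ?sa ?H "obs_matrix \<sigma> p"]] open_hurwitz_map, of "- {0}"] that
    by (simp add: invertible_det_nz vimage_def Collect_conj_eq[symmetric] Int_def open_Compl)
  have "ck_on 0 ?sa (*) ?H (\<lambda>X. ctr_matrix \<mu> m X $ a $ j)" if "good_points \<sigma> \<mu>" for \<mu> m \<sigma> a j
    unfolding ctr_matrix_def using that
    by (auto simp: matrix_matrix_mult_def good_points_def distrib_left simp del: ck_on.simps map_triple_sel intro!: ck_on_sum ck_on_mult lin inv)
  hence R: "open {X \<in> ?H. invertible (ctr_matrix \<mu> m X)}" if "good_points \<sigma> \<mu>" for \<sigma> m \<mu>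
    using continuous_open_preimage[OF ck_on_imp_continuous_on[OF ck_on_det[of 0 ?sa ?H "ctr_matrix \<mu> m"]] open_hurwitz_map, of "- {0}"] that
    by (simp add: invertible_det_nz vimage_def Collect_conj_eq[symmetric] Int_def open_Compl)
  have "stable_minimal e = (\<Union>(\<sigma>, p, \<mu>, m)\<in>{(\<sigma>, p, \<mu>, m). good_points \<sigma> \<mu>}.
      {X \<in> ?H. invertible (obs_matrix \<sigma> p X)} \<inter> {X \<in> ?H. invertible (ctr_matrix \<mu> m X)})"
    by (auto simp: stable_minimal_iff simp del: map_triple_sel) blast+
  thus ?thesis using O R by (auto intro!: open_UN)
qed

end

section \<open>The charts given by interpolation\<close>

lemma matrix_mult_scaleR:
  fixes A :: "'k::real_normed_algebra_1^'n^'m" and B :: "'k^'l^'n"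
  shows "A ** (r *\<^sub>R B) = r *\<^sub>R (A ** B)" "(r *\<^sub>R A) ** B = r *\<^sub>R (A ** B)"
  by (simp_all add: vec_eq_iff matrix_matrix_mult_def scaleR_sum_right)

lemma matrix_add_rdistrib:
  fixes A :: "'a::semiring_1^'n^'m"
  shows "(A + B) ** C = A ** C + B ** C"
  by (simp add: vec_eq_iff matrix_matrix_mult_def distrib_right sum.distrib)

context scalar_embedding
begin

lemma stable_minimal_hurwitz: "X \<in> stable_minimal e \<Longrightarrow> hurwitz (fst (map_triple e X))"
  by (simp add: stable_minimal_def)

lemma transfer_h2_change_basis:
  assumes T: "invertible T" and X: "hurwitz (fst (map_triple e X))"
  shows "transfer_h2 e (change_basis T X) = transfer_h2 e X"
proof -
  have "transfer_function (map_triple e (change_basis T X)) s = transfer_function (map_triple e X) s" if "0 < Re s" for s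
    using tf_change_basis[of "map_matrix e T" s "map_triple e X"] hurwitz_imp_invertible[OF X, of s] that T
    by (simp add: tf_eq_transfer_function map_change_basis invertible_map_matrix)
  hence "(\<lambda>s. if 0 < Re s then transfer_function (map_triple e (change_basis T X)) s else 0)
    = (\<lambda>s. if 0 < Re s then transfer_function (map_triple e X) s else 0)" by auto
  thus ?thesis by (simp only: transfer_h2_def)
qed

lemma normed_scalars_e: "normed_scalars scale_e"
proof -
  interpret normed_scalars scaleC_h2 by (rule normed_scalars_scaleC_h2)
  show ?thesis
    unfolding normed_scalars_def normed_scalars_axioms_def using comp1[OF linear_e] by (auto simp: e_mult assoc)
qed

lemma continuous_on_transfer_h2: "continuous_on (stable_minimal e) (transfer_h2 e)"
  by (rule continuous_on_subset[OF ck_on_imp_continuous_on[OF ck_on_transfer_h2]]) (auto simp: stable_minimal_def)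

lemma linear_change_basis:
  "bounded_linear (change_basis T :: ('k, 'r::finite, 'm::finite, 'p::finite) triple \<Rightarrow> _)"
  by (rule linear_conv_bounded_linear[THEN iffD1], rule linearI)
    (simp_all add: change_basis_def matrix_add_ldistrib matrix_add_rdistrib matrix_mult_scaleR)

lemma interpolation_chart_exists:
  fixes X :: "('k, 'r::finite, 'm::finite, 'p::finite) triple"
  assumes X: "X \<in> stable_minimal e"
  obtains \<sigma> \<mu> :: "'r \<Rightarrow> real" and p m where "good_points \<sigma> \<mu>"
    "invertible (loewner_matrix \<sigma> p \<mu> m (h2_data \<sigma> p \<mu> m (transfer_h2 e X)))"
proof -
  obtain \<sigma> p \<mu> m where g: "good_points \<sigma> \<mu>" and inv: "invertible (obs_matrix \<sigma> p X)" "invertible (ctr_matrix \<mu> m X)"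
    using X unfolding stable_minimal_iff by blast
  note hur = stable_minimal_hurwitz[OF X]
  have "loewner_matrix \<sigma> p \<mu> m (h2_data \<sigma> p \<mu> m (transfer_h2 e X)) = obs_matrix \<sigma> p X ** ctr_matrix \<mu> m X"
    unfolding h2_data_transfer_h2[OF hur g]
    by (rule loewner_interpolation_data)
      (use g hurwitz_imp_invertible_shift[OF hur] in \<open>auto simp: good_points_def less_imp_le\<close>)
  hence "invertible (loewner_matrix \<sigma> p \<mu> m (h2_data \<sigma> p \<mu> m (transfer_h2 e X)))"
    using inv by (simp add: invertible_mult)
  with g show ?thesis by (rule that)
qed

end

locale interpolation_chart = scalar_embedding e pr
  for e :: "'k::{real_normed_field,euclidean_space} \<Rightarrow> complex" and pr +
  fixes \<sigma> \<mu> :: "'r::finite \<Rightarrow> real" and p :: "'r \<Rightarrow> 'p::finite" and m :: "'r \<Rightarrow> 'm::finite"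
  assumes good: "good_points \<sigma> \<mu>"
begin

abbreviation S :: "('k, 'r, 'm, 'p) triple set" where "S \<equiv> stable_minimal e"

abbreviation coord :: "('m, 'p) h2 \<Rightarrow> 'k^('r \<times> ('m + 'p))" where "coord \<equiv> h2_data \<sigma> p \<mu> m"

definition regular :: "('k^('r \<times> ('m + 'p))) set" where
  "regular = {w. invertible (loewner_matrix \<sigma> p \<mu> m w)}"

definition realize :: "'k^('r \<times> ('m + 'p)) \<Rightarrow> ('k, 'r, 'm, 'p) triple" where
  "realize w = observable_form \<sigma> p (interpolant \<sigma> p \<mu> m w)"

abbreviation (input) point :: "'k^('r \<times> ('m + 'p)) \<Rightarrow> ('m, 'p) h2" where
  "point w \<equiv> transfer_h2 e (realize w)"

definition chart_domain :: "('m, 'p) h2 set" where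
  "chart_domain = {H \<in> transfer_h2 e ` S. coord H \<in> regular}"

text \<open>Regular data may also belong to an unstable system; membership of the realization in
  \<open>S\<close> excludes this, and it is an open condition.\<close>

definition chart_range :: "('k^('r \<times> ('m + 'p))) set" where
  "chart_range = {w \<in> regular. realize w \<in> S}"

lemma shift_invertible:
  assumes "X \<in> S"
  shows "invertible (mat (of_real (\<sigma> a)) - fst X)" "invertible (mat (of_real (\<mu> b)) - fst X)" "\<sigma> a \<noteq> \<mu> b"
  using good hurwitz_imp_invertible_shift[OF stable_minimal_hurwitz[OF assms]]
  by (auto simp: good_points_def less_imp_le)

lemma coord_transfer_h2: "X \<in> S \<Longrightarrow> coord (transfer_h2 e X) = interpolation_data \<sigma> p \<mu> m X"
  by (rule h2_data_transfer_h2[OF stable_minimal_hurwitz good])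

text \<open>On the chart, \<open>realize\<close> after \<open>coord\<close> selects from each class
  of equivalent triples the representative whose observability matrix is the identity.\<close>

lemma realize_coord:
  assumes X: "X \<in> S" and reg: "coord (transfer_h2 e X) \<in> regular"
  shows "invertible (obs_matrix \<sigma> p X)"
    and "realize (coord (transfer_h2 e X)) = change_basis (obs_matrix \<sigma> p X) X"
  using observable_form_interpolant[OF shift_invertible[OF X], where p=p and m=m] reg
  by (auto simp: realize_def regular_def coord_transfer_h2[OF X])

lemma coord_in_chart_range:
  assumes H: "H \<in> chart_domain"
  shows "coord H \<in> chart_range" "point (coord H) = H"
proof -
  obtain X where X: "X \<in> S" "H = transfer_h2 e X" and reg: "coord (transfer_h2 e X) \<in> regular"
    using H by (auto simp: chart_domain_def)
  note T = realize_coord[OF X(1) reg]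
  show "coord H \<in> chart_range"
    using reg stable_minimal_change_basis[OF T(1) X(1)] by (simp add: chart_range_def X(2) T(2))
  show "point (coord H) = H"
    using transfer_h2_change_basis[OF T(1) stable_minimal_hurwitz[OF X(1)]] by (simp add: X(2) T(2))
qed

lemma coord_realize:
  assumes w: "w \<in> chart_range"
  shows "coord (point w) = w" "point w \<in> chart_domain"
proof -
  have S: "realize w \<in> S" and reg: "w \<in> regular" using w by (auto simp: chart_range_def)
  show *: "coord (point w) = w"
    unfolding coord_transfer_h2[OF S] unfolding realize_def
    by (rule interpolation_data_observable_form)
      (use shift_invertible[OF S] reg in \<open>auto simp: realize_def regular_def\<close>)
  show "point w \<in> chart_domain"
    using S reg by (simp add: chart_domain_def *)
qed

lemma coord_image: "coord ` chart_domain = chart_range"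
  using coord_in_chart_range coord_realize by force

lemma open_regular: "open regular"
  unfolding regular_def by (rule open_loewner_invertible)

lemma linear_coord: "bounded_linear coord"
  by (rule linear_h2_data[OF good])

lemma openin_chart_domain: "openin (top_of_set (transfer_h2 e ` S)) chart_domain"
proof -
  have "open (coord -` regular)"
    using open_regular linear_continuous_on[OF linear_coord] by (rule open_vimage)
  moreover have "chart_domain = transfer_h2 e ` S \<inter> coord -` regular" by (auto simp: chart_domain_def)
  ultimately show ?thesis by (simp add: openin_open_Int)
qed

lemma linear_observable_form:
  "bounded_linear (\<lambda>v. observable_form \<sigma> p v - observable_form \<sigma> p 0 :: ('k, 'r, 'm, 'p) triple)"
  by (rule linear_conv_bounded_linear[THEN iffD1], rule linearI)
    (auto simp: observable_form_def vec_eq_iff algebra_simps)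

lemma continuous_on_observable_form:
  "continuous_on UNIV (observable_form \<sigma> p :: _ \<Rightarrow> ('k, 'r, 'm, 'p) triple)"
proof -
  have "continuous_on UNIV (\<lambda>v. (observable_form \<sigma> p v - observable_form \<sigma> p 0) + observable_form \<sigma> p 0 :: ('k, 'r, 'm, 'p) triple)"
    by (intro continuous_on_add continuous_on_const linear_continuous_on linear_observable_form)
  thus ?thesis by simp
qed

lemma continuous_on_realize: "continuous_on regular realize"
  unfolding realize_def[abs_def] regular_def
  by (rule continuous_on_compose2[OF continuous_on_observable_form ck_on_imp_continuous_on[OF ck_on_interpolant]]) auto

lemma open_realize: "open V \<Longrightarrow> open {w \<in> regular. realize w \<in> V}"
  using continuous_open_preimage[OF continuous_on_realize open_regular, of V]
  by (simp add: vimage_def Collect_conj_eq)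

lemma open_chart_range: "open chart_range"
  unfolding chart_range_def by (rule open_realize[OF open_stable_minimal])

text \<open>The chain rule \<open>ck_on_compose\<close> requires a middle space
  \<open>'k^'n\<close>, which triples are not. So the affine map \<open>observable_form\<close> is
  first merged into \<open>f\<close>, and only the rational map \<open>interpolant\<close> is
  composed by the chain rule.\<close>

lemma ck_on_realize:
  assumes V: "open V" and f: "ck_on n scale_triple sb V f" and sb: "normed_scalars sb"
  shows "ck_on n (*s) sb {w \<in> regular. realize w \<in> V} (\<lambda>w. f (realize w))"
proof -
  let ?V = "{v. (observable_form \<sigma> p v :: ('k, 'r, 'm, 'p) triple) \<in> V}"
  have oV: "open ?V"
    using open_vimage[OF V continuous_on_observable_form] by (simp add: vimage_def)
  have "ck_on n (*s) (\<lambda>c. sb c) ?V (\<lambda>v. f (observable_form \<sigma> p 0 + (observable_form \<sigma> p v - observable_form \<sigma> p 0)))"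
    by (rule ck_on_comp_affine[where h="\<lambda>c. c", OF linear_observable_form _ _ f])
      (auto simp: observable_form_def map_triple_def vec_eq_iff algebra_simps)
  hence "ck_on n (*s) sb ?V (\<lambda>v. f (observable_form \<sigma> p v))" by simp
  moreover have "ck_on n (*s) (*s) {w \<in> regular. realize w \<in> V} (interpolant \<sigma> p \<mu> m)"
    by (rule ck_on_subset[OF ck_on_interpolant]) (auto simp: regular_def)
  ultimately have "ck_on n (*s) sb {w \<in> regular. realize w \<in> V} (\<lambda>w. f (observable_form \<sigma> p (interpolant \<sigma> p \<mu> m w)))"
    by (rule ck_on_compose[OF sb open_realize[OF V] oV, rotated]) (auto simp: realize_def)
  thus ?thesis by (simp add: realize_def)
qed

lemma ck_on_point: "ck_on n (*s) scale_e chart_range point"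
  unfolding chart_range_def
  by (rule ck_on_realize[OF open_stable_minimal ck_on_subset[OF ck_on_transfer_h2] normed_scalars_e])
    (auto simp: stable_minimal_def)

end

section \<open>State-space isomorphism and the quotient topology\<close>

context scalar_embedding
begin

text \<open>\<open>coord\<close> depends only on the transfer function, so two triples with the same
  one have the same normal form. The equivalence is the observability matrix of \<open>X\<close>
  followed by the inverse of that of \<open>Y\<close>.\<close>

lemma transfer_h2_eq_iff:
  fixes X Y :: "('k, 'r::finite, 'm::finite, 'p::finite) triple"
  assumes X: "X \<in> stable_minimal e" and Y: "Y \<in> stable_minimal e"
  shows "transfer_h2 e X = transfer_h2 e Y \<longleftrightarrow> state_space_equivalent X Y"
proof
  assume eq: "transfer_h2 e X = transfer_h2 e Y"
  obtain \<sigma> \<mu> :: "'r \<Rightarrow> real" and p m where g: "good_points \<sigma> \<mu>"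
    and inv: "invertible (loewner_matrix \<sigma> p \<mu> m (h2_data \<sigma> p \<mu> m (transfer_h2 e X)))"
    using interpolation_chart_exists[OF X] .
  interpret interpolation_chart e pr \<sigma> \<mu> p m by unfold_locales (rule g)
  have reg: "coord (transfer_h2 e X) \<in> regular" using inv by (simp add: regular_def)
  note 1 = realize_coord[OF X reg] and 2 = realize_coord[OF Y reg[unfolded eq]]
  let ?O = "obs_matrix \<sigma> p X" and ?Q = "obs_matrix \<sigma> p Y"
  note inv = 1(1) 2(1) invertible_matrix_inv[OF 2(1)]
  have "change_basis (matrix_inv ?Q ** ?O) X = change_basis (matrix_inv ?Q) (change_basis ?O X)"
    by (simp only: change_basis_change_basis[OF inv(3,1)])
  also have "change_basis ?O X = change_basis ?Q Y"
    unfolding 1(2)[symmetric] 2(2)[symmetric] eq ..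
  also have "change_basis (matrix_inv ?Q) (change_basis ?Q Y) = Y"
    by (simp add: change_basis_change_basis[OF inv(3,2)] matrix_inv[OF inv(2)])
  finally show "state_space_equivalent X Y"
    unfolding state_space_equivalent_iff using invertible_mult[OF inv(3,1)] by metis
next
  assume "state_space_equivalent X Y"
  then obtain T where T: "invertible T" "Y = change_basis T X" by (auto simp: state_space_equivalent_iff)
  show "transfer_h2 e X = transfer_h2 e Y"
    unfolding T(2) by (rule transfer_h2_change_basis[OF T(1) stable_minimal_hurwitz[OF X], symmetric])
qed

lemma HK_topology_eq:
  fixes S :: "('k, 'r::finite, 'm::finite, 'p::finite) triple set"
  assumes S: "S = stable_minimal e"
  shows "HK_topology e S = top_of_set (transfer_h2 e ` S)"
  unfolding topology_eq HK_topology_def openin_quotient_topology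
proof (intro allI iffI conjI)
  fix U assume U: "openin (top_of_set (transfer_h2 e ` S)) U"
  thus "U \<subseteq> transfer_h2 e ` S" by (auto dest: openin_imp_subset)
  have "{x \<in> S. transfer_h2 e x \<in> U} = S \<inter> transfer_h2 e -` U" by auto
  moreover have "openin (top_of_set S) (S \<inter> transfer_h2 e -` U)"
    using continuous_on_transfer_h2 U unfolding S continuous_on_open by (elim allE impE)
  ultimately show "openin (top_of_set S) {x \<in> S. transfer_h2 e x \<in> U}" by simp
next
  fix U assume U: "U \<subseteq> transfer_h2 e ` S \<and> openin (top_of_set S) {x \<in> S. transfer_h2 e x \<in> U}"
  define G where "G = {x \<in> S. transfer_h2 e x \<in> U}"
  have G: "open G" using U openin_open_trans[OF _ open_stable_minimal] by (auto simp: G_def S)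
  show "openin (top_of_set (transfer_h2 e ` S)) U"
  proof (subst openin_subopen, intro ballI)
    fix H assume H: "H \<in> U"
    then obtain X where X: "X \<in> S" "H = transfer_h2 e X" using U by auto
    obtain \<sigma> \<mu> :: "'r \<Rightarrow> real" and p m where g: "good_points \<sigma> \<mu>"
      and inv: "invertible (loewner_matrix \<sigma> p \<mu> m (h2_data \<sigma> p \<mu> m (transfer_h2 e X)))"
      using interpolation_chart_exists[OF X(1)[unfolded S]] .
    interpret I: interpolation_chart e pr \<sigma> \<mu> p m by unfold_locales (rule g)
    have cont: "continuous_on I.chart_domain (\<lambda>H. I.realize (I.coord H))"
      by (rule continuous_on_compose2[OF I.continuous_on_realize linear_continuous_on[OF I.linear_coord]])
        (auto simp: I.chart_domain_def)
    have "openin (top_of_set I.chart_domain) (I.chart_domain \<inter> (\<lambda>H. I.realize (I.coord H)) -` G)"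
      by (rule continuous_openin_preimage_gen[OF cont G])
    from openin_trans[OF this I.openin_chart_domain]
    have "openin (top_of_set (transfer_h2 e ` S)) (I.chart_domain \<inter> (\<lambda>H. I.realize (I.coord H)) -` G)"
      by (simp add: S)
    \<comment> \<open>On the chart, \<open>I.realize (I.coord H)\<close> is a realization of
      \<open>H\<close>; as \<open>G\<close> is the full preimage of \<open>U\<close>, it lies in
      \<open>G\<close> exactly if \<open>H\<close> lies in \<open>U\<close>.\<close>
    moreover have "I.chart_domain \<inter> (\<lambda>H. I.realize (I.coord H)) -` G = I.chart_domain \<inter> U"
      using I.coord_in_chart_range by (auto simp: G_def S I.chart_range_def)
    moreover have "H \<in> I.chart_domain" using X inv by (auto simp: I.chart_domain_def I.regular_def S)
    ultimately show "\<exists>T. openin (top_of_set (transfer_h2 e ` S)) T \<and> H \<in> T \<and> T \<subseteq> U"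
      using H by (metis IntI Int_lower2)
  qed
qed

end

section \<open>The embedded submanifold\<close>

text \<open>The difference quotients lie in \<open>E\<close> and approximate \<open>D v\<close>. It
  places the range of the differential inside \<open>h2_real\<close> in the real case, where
  closedness is meant relative to that subspace.\<close>

lemma derivative_in_closed_subspace:
  assumes f: "(f has_derivative D) (at x)" and U: "open U" "x \<in> U" "f ` U \<subseteq> E" and E: "closed E" "subspace E"
  shows "D v \<in> E"
proof -
  have "D v \<in> closure E" unfolding closure_approachable
  proof (intro allI impI)
    fix \<epsilon> :: real assume \<epsilon>: "0 < \<epsilon>"
    \<comment> \<open>A bound on \<open>norm v\<close> that is positive for \<open>v = 0\<close> as
      well.\<close>
    define M where "M = norm v + 1"
    have M: "M > 0" "norm v < M" by (auto simp: M_def add_nonneg_pos)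
    obtain d where d: "d > 0" "\<And>y. norm (y - x) < d \<Longrightarrow> norm (f y - f x - D (y - x)) \<le> \<epsilon> / M * norm (y - x)"
      using f \<epsilon> M unfolding has_derivative_at_alt by (meson divide_pos_pos)
    obtain r where r: "r > 0" "ball x r \<subseteq> U" using U open_contains_ball by blast
    \<comment> \<open>So small that \<open>x + t v\<close> stays both in \<open>U\<close> and within
      the radius \<open>d\<close> of the derivative estimate.\<close>
    define t where "t = min d r / (2 * M)"
    have t: "t > 0" using d r M by (simp add: t_def)
    have small: "norm (t *\<^sub>R v) < min d r"
    proof -
      have "t * norm v < t * M * 2" using t M by (simp add: mult_strict_left_mono less_le_trans)
      also have "\<dots> = min d r" using M by (simp add: t_def)
      finally show ?thesis using t by simp
    qed
    define y where "y = x + t *\<^sub>R v"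
    have y: "y \<in> U" using r small by (auto simp: y_def dist_norm)
    have "norm (f y - f x - D (t *\<^sub>R v)) \<le> \<epsilon> / M * norm (t *\<^sub>R v)"
      using d(2)[of y] small by (simp add: y_def)
    also have "\<dots> < t * \<epsilon>"
      using t M \<epsilon> by (simp add: field_simps)
    finally have "norm (f y - f x - t *\<^sub>R D v) < t * \<epsilon>"
      using linear_cmul[OF has_derivative_linear[OF f]] by simp
    moreover have "f y - f x - t *\<^sub>R D v = t *\<^sub>R ((1 / t) *\<^sub>R (f y - f x) - D v)"
      using t by (simp add: scaleR_diff_right)
    ultimately have "norm ((1 / t) *\<^sub>R (f y - f x) - D v) < \<epsilon>"
      using t by simp
    moreover have "(1 / t) *\<^sub>R (f y - f x) \<in> E"
      using U y E(2) by (intro subspace_scale subspace_diff) auto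
    ultimately show "\<exists>u\<in>E. dist u (D v) < \<epsilon>" by (auto simp: dist_norm)
  qed
  thus ?thesis using E(1) closure_closed by blast
qed

text \<open>The range is the fixed point set of the continuous map
  \<open>D \<circ> L\<close>.\<close>

lemma left_inverse_imp_closed_range:
  fixes L :: "'b::real_normed_vector \<Rightarrow> 'a::real_normed_vector"
  assumes "bounded_linear L" "bounded_linear D" "\<And>v. L (D v) = v"
  shows "inj D" "closed (range D)"
proof -
  show "inj D" using assms(3) by (metis injI)
  have "range D = {h. D (L h) = h}" using assms(3) by auto (metis rangeI)
  moreover have "closed {h. D (L h) = h}"
    by (intro closed_Collect_eq continuous_on_id linear_continuous_on bounded_linear_compose[OF assms(2,1)])
  ultimately show "closed (range D)" by simp
qed

lemma surj_of_right_inverse: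
  fixes f :: "'a::euclidean_space \<Rightarrow> 'b::euclidean_space" and g :: "'b \<Rightarrow> 'a"
  assumes f: "f differentiable (at (g w))" and g: "g differentiable (at w)"
    and id: "open V" "w \<in> V" "\<And>w. w \<in> V \<Longrightarrow> f (g w) = w"
  shows "surj (differential f (g w))"
proof -
  have "((\<lambda>w. f (g w)) has_derivative (\<lambda>v. differential f (g w) (differential g w v))) (at w)"
    by (rule has_derivative_compose[where g=f]) (use f g in \<open>auto simp: frechet_derivative_works\<close>)
  moreover have "((\<lambda>w. f (g w)) has_derivative (\<lambda>v. v)) (at w)"
    by (rule has_derivative_transform_within_open[OF has_derivative_ident id(1,2)]) (simp add: id(3))
  ultimately have "(\<lambda>v. differential f (g w) (differential g w v)) = (\<lambda>v. v)"
    by (rule has_derivative_unique)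
  thus ?thesis by (metis surj_def)
qed

lemma smooth_on_imp_differentiable:
  assumes "smooth_on sa sb U f" "x \<in> U"
  shows "f differentiable (at x)"
  using assms ck_on_Suc_iff[of U 0] unfolding smooth_on_def by blast

section \<open>Charts of the maximal atlas\<close>

context scalar_embedding
begin

text \<open>The conditions on a chart with the quotient topology already replaced by the subspace
  topology, so that they refer to the Hardy norm.\<close>

lemma HK_atlasD:
  fixes S :: "('k, 'r::finite, 'm::finite, 'p::finite) triple set"
  assumes S: "S = stable_minimal e" and c: "(U, \<phi>) \<in> HK_atlas e S"
  shows "openin (top_of_set (transfer_h2 e ` S)) U" (is ?A) and "open (\<phi> ` U)" (is ?B)
    and "homeomorphic_map (top_of_set U) (top_of_set (\<phi> ` U)) \<phi>" (is ?C)
    and "smooth_on scale_triple (*s) {x \<in> S. transfer_h2 e x \<in> U} (\<lambda>x. \<phi> (transfer_h2 e x))" (is ?D)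
    and "\<And>x. x \<in> S \<Longrightarrow> transfer_h2 e x \<in> U \<Longrightarrow> surj (differential (\<lambda>x. \<phi> (transfer_h2 e x)) x)"
proof -
  have "subtopology (top_of_set (transfer_h2 e ` S)) U = top_of_set U" if "openin (top_of_set (transfer_h2 e ` S)) U"
    using openin_imp_subset[OF that] by (simp add: subtopology_subtopology Int_absorb1)
  thus ?A ?B ?C ?D "\<And>x. x \<in> S \<Longrightarrow> transfer_h2 e x \<in> U \<Longrightarrow> surj (differential (\<lambda>x. \<phi> (transfer_h2 e x)) x)"
    using c HK_topology_eq[OF S] by (auto simp: HK_atlas_def quotient_atlas_def is_chart_def HK_topology_def o_def)
qed

lemma HK_chart_inj:
  fixes S :: "('k, 'r::finite, 'm::finite, 'p::finite) triple set"
  assumes "S = stable_minimal e" "(U, \<phi>) \<in> HK_atlas e S"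
  shows "inj_on \<phi> U"
  using homeomorphic_imp_injective_map[OF HK_atlasD(3)[OF assms]] by simp

lemma HK_chart_open_image:
  fixes S :: "('k, 'r::finite, 'm::finite, 'p::finite) triple set"
  assumes S: "S = stable_minimal e" and c: "(U, \<phi>) \<in> HK_atlas e S"
    and W: "openin (top_of_set (transfer_h2 e ` S)) W" "W \<subseteq> U"
  shows "open (\<phi> ` W)"
proof -
  have "openin (top_of_set U) W"
    using W openin_imp_subset[OF HK_atlasD(1)[OF S c]] by (rule openin_subset_trans)
  hence "openin (top_of_set (\<phi> ` U)) (\<phi> ` W)"
    using homeomorphic_imp_open_map[OF HK_atlasD(3)[OF S c]] by (simp add: open_map_def)
  thus ?thesis using HK_atlasD(2)[OF S c] by (rule openin_open_trans)
qed

lemma HK_chart_inverse_continuous: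
  fixes S :: "('k, 'r::finite, 'm::finite, 'p::finite) triple set"
  assumes S: "S = stable_minimal e" and c: "(U, \<phi>) \<in> HK_atlas e S"
  shows "continuous_on (\<phi> ` U) (inv_into U \<phi>)"
proof -
  obtain g where g: "homeomorphic_maps (top_of_set U) (top_of_set (\<phi> ` U)) \<phi> g"
    using HK_atlasD(3)[OF S c] by (auto simp: homeomorphic_map_maps)
  hence "continuous_on (\<phi> ` U) g" "\<And>x. x \<in> U \<Longrightarrow> g (\<phi> x) = x"
    by (auto simp: homeomorphic_maps_def)
  moreover from this(2) have "inv_into U \<phi> y = g y" if "y \<in> \<phi> ` U" for y
    using HK_chart_inj[OF S c] that by auto
  ultimately show ?thesis by (subst continuous_on_cong[OF refl, where g=g]) auto
qed

end

section \<open>The interpolation charts within the atlas\<close>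

context interpolation_chart
begin

lemma smooth_coord_transfer:
  "smooth_on scale_triple (*s) S (\<lambda>X. coord (transfer_h2 e X))"
  unfolding smooth_on_def
proof (intro conjI allI)
  show "open S" by (rule open_stable_minimal)
  show "ck_on n scale_triple (*s) S (\<lambda>X. coord (transfer_h2 e X))" for n
    by (rule ck_on_linear_comp[OF linear_coord h2_data_scale ck_on_subset[OF ck_on_transfer_h2]])
      (auto simp: stable_minimal_def)
qed

lemma realize_differentiable:
  assumes "w \<in> regular"
  shows "realize differentiable (at w)"
proof -
  have "ck_on (Suc 0) (*s) (*s) regular (interpolant \<sigma> p \<mu> m)"
    unfolding regular_def by (rule ck_on_interpolant)
  hence "interpolant \<sigma> p \<mu> m differentiable (at w)"
    using assms ck_on_Suc_iff[OF open_regular] by blast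
  then obtain D where D: "(interpolant \<sigma> p \<mu> m has_derivative D) (at w)" by (auto simp: differentiable_def)
  let ?l = "\<lambda>v. observable_form \<sigma> p v - observable_form \<sigma> p 0 :: ('k, 'r, 'm, 'p) triple"
  have "((\<lambda>w. ?l (interpolant \<sigma> p \<mu> m w) + observable_form \<sigma> p 0) has_derivative (\<lambda>v. ?l (D v) + 0)) (at w)"
    by (intro has_derivative_add has_derivative_const bounded_linear.has_derivative[OF linear_observable_form D])
  thus ?thesis by (auto simp: realize_def[abs_def] differentiable_def)
qed

text \<open>The section \<open>realize\<close> passes through the normal form of \<open>X\<close>;
  changing the basis back by \<open>T\<close> gives a differentiable section \<open>g\<close>
  through \<open>X\<close> itself. It is a local right inverse of the map, so the differential at
  \<open>X\<close> is onto.\<close>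

lemma surj_coord_transfer:
  assumes X: "X \<in> S" and reg: "coord (transfer_h2 e X) \<in> regular"
  shows "surj (differential (\<lambda>X. coord (transfer_h2 e X)) X)"
proof -
  define T w g where "T = obs_matrix \<sigma> p X" and "w = coord (transfer_h2 e X)"
    and "g = (\<lambda>w. change_basis (matrix_inv T) (realize w))"
  note T = realize_coord[OF X reg, folded T_def]
  have gw: "g w = X"
    using T by (simp add: g_def w_def change_basis_change_basis invertible_matrix_inv matrix_inv)
  have w: "w \<in> chart_range"
    unfolding w_def by (rule coord_in_chart_range) (use X reg in \<open>auto simp: chart_domain_def\<close>)
  have "surj (differential (\<lambda>X. coord (transfer_h2 e X)) (g w))"
  proof (rule surj_of_right_inverse[OF _ _ open_chart_range w])
    show "(\<lambda>X. coord (transfer_h2 e X)) differentiable (at (g w))"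
      unfolding gw by (rule smooth_on_imp_differentiable[OF smooth_coord_transfer X])
    have "realize differentiable (at w)"
      using realize_differentiable w by (auto simp: chart_range_def)
    thus "g differentiable (at w)"
      unfolding g_def differentiable_def using bounded_linear.has_derivative[OF linear_change_basis] by blast
    show "coord (transfer_h2 e (g v)) = v" if v: "v \<in> chart_range" for v
    proof -
      have "transfer_h2 e (g v) = point v"
        unfolding g_def using v invertible_matrix_inv[OF T(1)]
        by (intro transfer_h2_change_basis stable_minimal_hurwitz) (auto simp: chart_range_def)
      thus ?thesis using coord_realize(1)[OF v] by simp
    qed
  qed
  thus ?thesis by (simp add: gw)
qed

lemma homeomorphic_coord: "homeomorphic_map (top_of_set chart_domain) (top_of_set chart_range) coord"
proof (rule homeomorphic_maps_imp_map)
  show "homeomorphic_maps (top_of_set chart_domain) (top_of_set chart_range) coord point"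
    unfolding homeomorphic_maps_def
    using coord_in_chart_range coord_realize linear_continuous_on[OF linear_coord]
      ck_on_imp_continuous_on[OF ck_on_point]
    by auto
qed

lemma chart_in_HK_atlas: "(chart_domain, coord) \<in> HK_atlas e S"
proof -
  have top: "quotient_topology S (transfer_h2 e) = top_of_set (transfer_h2 e ` S)"
    using HK_topology_eq[OF refl] by (simp add: HK_topology_def)
  have sub: "subtopology (top_of_set (transfer_h2 e ` S)) chart_domain = top_of_set chart_domain"
    using openin_imp_subset[OF openin_chart_domain] by (simp add: subtopology_subtopology Int_absorb1)
  have "{x \<in> S. transfer_h2 e x \<in> chart_domain} = S \<inter> {x. coord (transfer_h2 e x) \<in> regular}"
    by (auto simp: chart_domain_def)
  moreover have "open (S \<inter> (\<lambda>x. coord (transfer_h2 e x)) -` regular)"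
    using ck_on_imp_continuous_on[of 0] smooth_coord_transfer open_stable_minimal open_regular
    unfolding smooth_on_def by (blast intro: continuous_open_preimage)
  ultimately have "open {x \<in> S. transfer_h2 e x \<in> chart_domain}"
    by (simp add: vimage_def)
  hence "smooth_on scale_triple (*s) {x \<in> S. transfer_h2 e x \<in> chart_domain} (coord \<circ> transfer_h2 e)"
    using smooth_coord_transfer unfolding smooth_on_def o_def by (blast intro: ck_on_subset)
  moreover have "surj (differential (coord \<circ> transfer_h2 e) x)" if "x \<in> S" "transfer_h2 e x \<in> chart_domain" for x
    using surj_coord_transfer[OF that(1)] that(2) by (simp add: chart_domain_def o_def)
  ultimately show ?thesis
    using homeomorphic_coord openin_chart_domain open_chart_range
    by (simp add: HK_atlas_def quotient_atlas_def is_chart_def top sub coord_image)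
qed

text \<open>The transition map \<open>h\<close> from these coordinates to an arbitrary chart is a smooth homeomorphism with
surjective differential, so its inverse is smooth.\<close>

lemma chart_transition:
  fixes U :: "('m, 'p) h2 set" and \<phi> :: "('m, 'p) h2 \<Rightarrow> 'k^('r \<times> ('m + 'p))"
  assumes c: "(U, \<phi>) \<in> HK_atlas e S"
  defines "V \<equiv> {w \<in> regular. realize w \<in> {x \<in> S. transfer_h2 e x \<in> U}}"
    and "h \<equiv> (\<lambda>w. \<phi> (point w))"
    and "g \<equiv> (\<lambda>y. coord (inv_into U \<phi> y))"
  shows "smooth_on (*s) (*s) V h"
    and "smooth_on (*s) (*s) (\<phi> ` (U \<inter> chart_domain)) g"
    and "y \<in> \<phi> ` (U \<inter> chart_domain) \<Longrightarrow> g y \<in> V \<and> differential h (g y) (differential g y v) = v"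
proof -
  note A = HK_atlasD[OF refl c]
  have inv: "inv_into U \<phi> (\<phi> H) = H" if "H \<in> U" for H
    using HK_chart_inj[OF refl c] that by simp
  have V: "V \<subseteq> chart_range" "\<And>w. w \<in> V \<Longrightarrow> point w \<in> U \<inter> chart_domain"
    using coord_realize(2) by (auto simp: V_def chart_range_def)
  show h: "smooth_on (*s) (*s) V h"
    using A(4) ck_on_realize[OF _ _ normed_scalars_vector_scalar_mult] open_realize
    unfolding V_def h_def smooth_on_def by blast
  have hV: "h ` V = \<phi> ` (U \<inter> chart_domain)"
  proof (intro subset_antisym subsetI)
    fix y assume "y \<in> \<phi> ` (U \<inter> chart_domain)"
    then obtain H where H: "H \<in> U" "H \<in> chart_domain" "y = \<phi> H" by auto
    note C = coord_in_chart_range[OF H(2)]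
    have "coord H \<in> V" using C H by (simp add: V_def chart_range_def)
    moreover have "h (coord H) = y" using C H by (simp add: h_def)
    ultimately show "y \<in> h ` V" by blast
  qed (use V in \<open>auto simp: h_def\<close>)
  have UC: "openin (top_of_set (transfer_h2 e ` S)) (U \<inter> chart_domain)"
    using A(1) openin_chart_domain by (rule openin_Int)
  have ohV: "open (h ` V)"
    unfolding hV by (rule HK_chart_open_image[OF refl c UC]) simp
  have gh: "g (h w) = w" if "w \<in> V" for w
    using V that coord_realize(1) by (auto simp: g_def h_def inv subset_iff)
  have contg: "continuous_on (h ` V) g"
    unfolding g_def hV
    by (rule continuous_on_compose2[OF linear_continuous_on[OF linear_coord] continuous_on_subset[OF HK_chart_inverse_continuous[OF refl c]]])
      auto
  \<comment> \<open>Near \<open>realize w\<close> the map \<open>\<phi>\<close> after the transfer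
    map equals \<open>h\<close> after the interpolation coordinates. Its differential is onto since
    \<open>\<phi>\<close> belongs to the atlas, so that of the outer factor \<open>h\<close> is
    onto.\<close>
  have surj: "surj (differential h w)" if w: "w \<in> V" for w
  proof -
    let ?X = "realize w"
    have X: "?X \<in> S" "transfer_h2 e ?X \<in> U" "transfer_h2 e ?X \<in> chart_domain"
      using w V(2)[OF w] by (auto simp: V_def)
    have cw: "coord (transfer_h2 e ?X) = w" using coord_realize(1) V(1) w by blast
    have d1: "((\<lambda>X. h (coord (transfer_h2 e X))) has_derivative
        (\<lambda>v. differential h w (differential (\<lambda>X. coord (transfer_h2 e X)) ?X v))) (at ?X)"
      using has_derivative_compose[where f="\<lambda>X. coord (transfer_h2 e X)" and g=h and x="?X" and s=UNIV]
        smooth_on_imp_differentiable[OF h w] smooth_on_imp_differentiable[OF smooth_coord_transfer X(1)]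
      by (simp add: cw frechet_derivative_works)
    have d2: "open {x \<in> S. transfer_h2 e x \<in> U \<inter> chart_domain}"
    proof -
      have "{x \<in> S. transfer_h2 e x \<in> U \<inter> chart_domain}
        = {x \<in> S. transfer_h2 e x \<in> U} \<inter> {x \<in> S. transfer_h2 e x \<in> chart_domain}" by auto
      thus ?thesis
        using A(4) HK_atlasD(4)[OF refl chart_in_HK_atlas] by (simp add: smooth_on_def open_Int)
    qed
    have d3: "h (coord (transfer_h2 e x)) = \<phi> (transfer_h2 e x)" if "x \<in> {x \<in> S. transfer_h2 e x \<in> U \<inter> chart_domain}" for x
      using coord_in_chart_range(2) that by (simp add: h_def)
    have "((\<lambda>X. \<phi> (transfer_h2 e X)) has_derivative
        (\<lambda>v. differential h w (differential (\<lambda>X. coord (transfer_h2 e X)) ?X v))) (at ?X)"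
      by (rule has_derivative_transform_within_open[OF d1 d2 _ d3]) (use X in simp_all)
    hence eq: "differential (\<lambda>X. \<phi> (transfer_h2 e X)) ?X
        = (\<lambda>v. differential h w (differential (\<lambda>X. coord (transfer_h2 e X)) ?X v))"
      by (rule frechet_derivative_at[symmetric])
    have "surj (\<lambda>v. differential h w (differential (\<lambda>X. coord (transfer_h2 e X)) ?X v))"
      using A(5)[OF X(1,2)] by (simp only: eq)
    thus ?thesis unfolding surj_def by blast
  qed
  show "smooth_on (*s) (*s) (\<phi> ` (U \<inter> chart_domain)) g"
    unfolding hV[symmetric] by (rule smooth_on_inverse(1)[OF h ohV contg gh surj])
  show "g y \<in> V \<and> differential h (g y) (differential g y v) = v" if "y \<in> \<phi> ` (U \<inter> chart_domain)"
  proof -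
    have "y \<in> h ` V" using that by (simp only: hV)
    then obtain w where w: "y = h w" "w \<in> V" by (rule imageE)
    have "g y = w" unfolding w(1) by (rule gh[OF w(2)])
    moreover have "differential h w (differential g y v) = v"
      unfolding w(1) by (rule smooth_on_inverse(2)[OF h ohV contg gh surj w(2)])
    ultimately show ?thesis using w(2) by simp
  qed
qed

end

section \<open>Inverse charts, transition maps and second countability\<close>

context scalar_embedding
begin

lemma HK_chart_through:
  fixes S :: "('k, 'r::finite, 'm::finite, 'p::finite) triple set"
  assumes S: "S = stable_minimal e" and H: "H \<in> transfer_h2 e ` S"
  obtains \<sigma> \<mu> :: "'r \<Rightarrow> real" and p m where "good_points \<sigma> \<mu>" "H \<in> interpolation_chart.chart_domain e pr \<sigma> \<mu> p m"
proof -
  obtain X :: "('k, 'r, 'm, 'p) triple" where X: "X \<in> stable_minimal e" "H = transfer_h2 e X"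
    using H unfolding S by blast
  obtain \<sigma> \<mu> :: "'r \<Rightarrow> real" and p m where g: "good_points \<sigma> \<mu>"
    and inv: "invertible (loewner_matrix \<sigma> p \<mu> m (h2_data \<sigma> p \<mu> m (transfer_h2 e X)))"
    using interpolation_chart_exists[OF X(1)] .
  interpret interpolation_chart e pr \<sigma> \<mu> p m by unfold_locales (rule g)
  have "H \<in> chart_domain" using X inv by (auto simp: chart_domain_def regular_def)
  with g show ?thesis by (rule that)
qed

text \<open>Near \<open>y\<close> the inverse chart is \<open>point\<close> after the smooth map
  \<open>z \<mapsto> coord (inv_into U \<phi> z)\<close>. As \<open>coord\<close> is linear on the
  ambient space, the differential of that map is \<open>coord\<close> applied to the differential of
  the inverse chart. Applying next the differential of the transition map recovers \<open>v\<close>,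
  which gives the bounded left inverse.\<close>

lemma HK_chart_inverse_smooth:
  fixes S :: "('k, 'r::finite, 'm::finite, 'p::finite) triple set"
  assumes S: "S = stable_minimal e" and c: "(U, \<phi>) \<in> HK_atlas e S"
  shows "smooth_on (*s) scale_e (\<phi> ` U) (inv_into U \<phi>)"
    and "y \<in> \<phi> ` U \<Longrightarrow> inj (differential (inv_into U \<phi>) y) \<and> closed (range (differential (inv_into U \<phi>) y))"
proof -
  let ?k = "inv_into U \<phi>"
  note A = HK_atlasD[OF S c]
  have local: "\<exists>Y. open Y \<and> y \<in> Y \<and> (\<forall>n. ck_on n (*s) scale_e Y ?k) \<and>
      inj (differential ?k y) \<and> closed (range (differential ?k y))" if y: "y \<in> \<phi> ` U" for y
  proof -
    have Hy: "?k y \<in> U" "\<phi> (?k y) = y" using y by (auto simp: inv_into_into f_inv_into_f)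
    obtain \<sigma> \<mu> :: "'r \<Rightarrow> real" and p m where g: "good_points \<sigma> \<mu>"
      and H: "?k y \<in> interpolation_chart.chart_domain e pr \<sigma> \<mu> p m"
      by (rule HK_chart_through[OF S]) (use Hy openin_imp_subset[OF A(1)] in auto)
    interpret interpolation_chart e pr \<sigma> \<mu> p m by unfold_locales (rule g)
    let ?Y = "\<phi> ` (U \<inter> chart_domain)"
    note C = chart_transition[OF c[unfolded S]]
    have oY: "open ?Y" using C(2) by (simp add: smooth_on_def)
    have yY: "y \<in> ?Y" using Hy H by force
    have inv: "?k z \<in> U \<inter> chart_domain" if "z \<in> ?Y" for z
      using that HK_chart_inj[OF S c] by auto
    have ck: "ck_on n (*s) scale_e ?Y ?k" for n
    proof -
      have "ck_on n (*s) scale_e ?Y (\<lambda>z. point (coord (?k z)))"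
        by (rule ck_on_compose[OF normed_scalars_e oY open_chart_range _ ck_on_point])
          (use C(2) inv coord_in_chart_range(1) in \<open>auto simp: smooth_on_def\<close>)
      thus ?thesis by (rule ck_on_eqI) (use oY inv coord_in_chart_range(2) in auto)
    qed
    have "?k differentiable (at y)"
      using ck[of "Suc 0", unfolded ck_on_Suc_iff[OF oY]] yY by blast
    hence der: "(?k has_derivative differential ?k y) (at y)" by (simp only: frechet_derivative_works)
    have "((\<lambda>z. coord (?k z)) has_derivative (\<lambda>v. coord (differential ?k y v))) (at y)"
      by (rule bounded_linear.has_derivative[OF linear_coord der])
    hence D: "differential (\<lambda>z. coord (?k z)) y v = coord (differential ?k y v)" for v
      by (simp add: frechet_derivative_at[symmetric])
    let ?h = "\<lambda>w. \<phi> (point w)"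
    have "?h differentiable (at (coord (?k y)))"
      using smooth_on_imp_differentiable[OF C(1)] C(3)[OF yY] by blast
    hence L: "bounded_linear (\<lambda>H. differential ?h (coord (?k y)) (coord H))"
      by (intro bounded_linear_compose[OF _ linear_coord])
        (auto simp: frechet_derivative_works intro: has_derivative_bounded_linear)
    note R = left_inverse_imp_closed_range[OF L has_derivative_bounded_linear[OF der]]
    have "differential ?h (coord (?k y)) (coord (differential ?k y v)) = v" for v
      using C(3)[OF yY, of v] by (simp add: D)
    from R[OF this] show ?thesis using oY yY ck by (intro exI[of _ "?Y"]) simp
  qed
  show "smooth_on (*s) scale_e (\<phi> ` U) ?k"
    unfolding smooth_on_def
  proof (intro conjI allI)
    show "ck_on n (*s) scale_e (\<phi> ` U) ?k" for n
    proof (rule ck_on_localI[OF A(2)])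
      fix y assume "y \<in> \<phi> ` U"
      from local[OF this] show "\<exists>Y. open Y \<and> y \<in> Y \<and> ck_on n (*s) scale_e Y ?k" by blast
    qed
  qed (rule A(2))
  show "inj (differential ?k y) \<and> closed (range (differential ?k y))" if "y \<in> \<phi> ` U"
    using local[OF that] by blast
qed

text \<open>Near a common point both charts are compared with an interpolation chart: the transition
  is \<open>\<psi> \<circ> point\<close> after \<open>coord \<circ> inv_into U \<phi>\<close>, and
  \<open>chart_transition\<close> makes both factors smooth.\<close>

lemma HK_transition_smooth:
  fixes S :: "('k, 'r::finite, 'm::finite, 'p::finite) triple set"
  assumes S: "S = stable_minimal e" and c: "(U, \<phi>) \<in> HK_atlas e S" and c': "(V, \<psi>) \<in> HK_atlas e S"
  shows "smooth_on (*s) (*s) (\<phi> ` (U \<inter> V)) (\<psi> \<circ> inv_into U \<phi>)"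
proof -
  let ?k = "inv_into U \<phi>"
  note A = HK_atlasD[OF S c] and A' = HK_atlasD[OF S c']
  have UV: "openin (top_of_set (transfer_h2 e ` S)) (U \<inter> V)" using A(1) A'(1) by (rule openin_Int)
  have o: "open (\<phi> ` (U \<inter> V))" by (rule HK_chart_open_image[OF S c UV]) simp
  have inv: "?k z \<in> W" if "z \<in> \<phi> ` W" "W \<subseteq> U" for z W
    using that HK_chart_inj[OF S c] by (auto simp: subset_iff)
  have "\<exists>Y. open Y \<and> y \<in> Y \<and> ck_on n (*s) (*s) Y (\<psi> \<circ> ?k)" if y: "y \<in> \<phi> ` (U \<inter> V)" for y n
  proof -
    have ky: "?k y \<in> U \<inter> V" using inv[OF y] by simp
    hence Hy: "\<phi> (?k y) = y" using y by (auto intro: f_inv_into_f)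
    obtain \<sigma> \<mu> :: "'r \<Rightarrow> real" and p m where g: "good_points \<sigma> \<mu>"
      and H: "?k y \<in> interpolation_chart.chart_domain e pr \<sigma> \<mu> p m"
      by (rule HK_chart_through[OF S]) (use ky openin_imp_subset[OF A(1)] in auto)
    interpret interpolation_chart e pr \<sigma> \<mu> p m by unfold_locales (rule g)
    let ?W = "U \<inter> V \<inter> chart_domain"
    let ?Y = "\<phi> ` ?W"
    note C = chart_transition[OF c[unfolded S]] and C' = chart_transition[OF c'[unfolded S]]
    have oY: "open ?Y"
      by (rule HK_chart_open_image[OF S c openin_Int[OF UV openin_chart_domain[folded S]]]) auto
    have yY: "y \<in> ?Y" using Hy ky H by force
    have kW: "?k z \<in> ?W" if "z \<in> ?Y" for z by (rule inv[OF that]) auto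
    let ?V = "{w \<in> regular. realize w \<in> {x \<in> stable_minimal e. transfer_h2 e x \<in> V}}"
    have "ck_on n (*s) (*s) ?Y (\<lambda>z. \<psi> (point (coord (?k z))))"
    proof (rule ck_on_compose[where f="\<lambda>z. coord (?k z)" and V="?V", OF normed_scalars_vector_scalar_mult oY])
      show "open ?V" "ck_on n (*s) (*s) ?V (\<lambda>w. \<psi> (point w))"
        using C'(1) by (simp_all add: smooth_on_def)
      show "(\<lambda>z. coord (?k z)) ` ?Y \<subseteq> ?V"
        using kW coord_in_chart_range by (fastforce simp: chart_range_def)
      have "ck_on n (*s) (*s) (\<phi> ` (U \<inter> chart_domain)) (\<lambda>z. coord (?k z))"
        using C(2) by (simp add: smooth_on_def)
      thus "ck_on n (*s) (*s) ?Y (\<lambda>z. coord (?k z))"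
        by (rule ck_on_subset) auto
    qed
    hence "ck_on n (*s) (*s) ?Y (\<psi> \<circ> ?k)"
      by (rule ck_on_eqI) (use oY kW coord_in_chart_range(2) in auto)
    with oY yY show ?thesis by blast
  qed
  thus ?thesis unfolding smooth_on_def by (auto intro!: ck_on_localI o)
qed

text \<open>Second countability passes to images under continuous open maps. The transfer map is
  open because the saturation of an open set is the union of its preimages under the changes of
  basis, which are linear and hence continuous.\<close>

lemma second_countable_transfer_image:
  fixes S :: "('k, 'r::finite, 'm::finite, 'p::finite) triple set"
  assumes S: "S = stable_minimal e"
  shows "second_countable (top_of_set (transfer_h2 e ` S))"
proof (rule second_countable_open_map_image)
  show "continuous_map (top_of_set S) (top_of_set (transfer_h2 e ` S)) (transfer_h2 e)"
    using continuous_on_transfer_h2 by (auto simp: S)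
  show "second_countable (top_of_set S)"
    unfolding second_countable_def
  proof -
    obtain \<B> where \<B>: "countable \<B>" "{} \<notin> \<B>" "\<And>C. C \<in> \<B> \<Longrightarrow> openin (top_of_set S) C"
      "\<And>T. openin (top_of_set S) T \<Longrightarrow> \<exists>\<U>. \<U> \<subseteq> \<B> \<and> T = \<Union>\<U>"
      using subset_second_countable[of S] by blast
    have "\<exists>V\<in>\<B>. x \<in> V \<and> V \<subseteq> U" if "openin (top_of_set S) U" "x \<in> U" for U x
      using \<B>(4)[OF that(1)] that(2) by blast
    with \<B>(1,3) show "\<exists>\<B>. countable \<B> \<and> (\<forall>V\<in>\<B>. openin (top_of_set S) V) \<and>
        (\<forall>U x. openin (top_of_set S) U \<and> x \<in> U \<longrightarrow> (\<exists>V\<in>\<B>. x \<in> V \<and> V \<subseteq> U))"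
      by (intro exI[of _ \<B>] conjI ballI allI impI) simp_all
  qed
  show "open_map (top_of_set S) (top_of_set (transfer_h2 e ` S)) (transfer_h2 e)"
    unfolding open_map_def HK_topology_eq[OF S, symmetric] HK_topology_def openin_quotient_topology
  proof (intro allI impI conjI)
    fix W assume "openin (top_of_set S) W"
    hence W: "open W" "W \<subseteq> S"
      unfolding S openin_open_eq[OF open_stable_minimal] by blast+
    thus "transfer_h2 e ` W \<subseteq> transfer_h2 e ` S" by auto
    have "{x \<in> S. transfer_h2 e x \<in> transfer_h2 e ` W} = (\<Union>T\<in>{T. invertible T}. S \<inter> change_basis T -` W)"
    proof (intro subset_antisym subsetI)
      fix x assume "x \<in> {x \<in> S. transfer_h2 e x \<in> transfer_h2 e ` W}"
      then obtain y where y: "x \<in> S" "y \<in> W" "transfer_h2 e x = transfer_h2 e y" by blast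
      hence "x \<in> stable_minimal e" "y \<in> stable_minimal e" using W(2) unfolding S by blast+
      from transfer_h2_eq_iff[OF this] y(3) have "state_space_equivalent x y" by simp
      then show "x \<in> (\<Union>T\<in>{T. invertible T}. S \<inter> change_basis T -` W)"
        using y by (auto simp: state_space_equivalent_iff)
    next
      fix x assume "x \<in> (\<Union>T\<in>{T. invertible T}. S \<inter> change_basis T -` W)"
      then obtain T where T: "invertible T" "x \<in> S" "change_basis T x \<in> W" by blast
      have "transfer_h2 e x = transfer_h2 e (change_basis T x)"
        by (rule transfer_h2_change_basis[symmetric, OF T(1) stable_minimal_hurwitz[OF T(2)[unfolded S]]])
      with T(2,3) show "x \<in> {x \<in> S. transfer_h2 e x \<in> transfer_h2 e ` W}" by blast
    qed
    moreover have "open (\<Union>T\<in>{T. invertible T}. S \<inter> change_basis T -` W)"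
      using W(1) open_stable_minimal
      by (intro open_UN ballI open_Int open_vimage linear_continuous_on[OF linear_change_basis]) (auto simp: S)
    ultimately show "openin (top_of_set S) {x \<in> S. transfer_h2 e x \<in> transfer_h2 e ` W}"
      by (intro open_subset) auto
  qed
qed simp

lemma embedded_submanifold_transfer_image:
  fixes S :: "('k, 'r::finite, 'm::finite, 'p::finite) triple set"
  assumes S: "S = stable_minimal e" and E: "closed E" "subspace E" "transfer_h2 e ` S \<subseteq> E"
  shows "embedded_submanifold (*s) scale_e E (transfer_h2 e ` S) (HK_topology e S) (HK_atlas e S)"
proof -
  let ?N = "transfer_h2 e ` S"
  note top = HK_topology_eq[OF S]
  have dom: "U \<subseteq> ?N" if "(U, \<phi>) \<in> HK_atlas e S" for U \<phi>
    using HK_atlasD(1)[OF S that] by (rule openin_imp_subset)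
  have cover: "(\<Union>(U, \<phi>)\<in>HK_atlas e S. U) = ?N"
  proof (intro subset_antisym subsetI)
    fix H assume "H \<in> ?N"
    then obtain \<sigma> \<mu> :: "'r \<Rightarrow> real" and p m where g: "good_points \<sigma> \<mu>"
      and H: "H \<in> interpolation_chart.chart_domain e pr \<sigma> \<mu> p m"
      by (rule HK_chart_through[OF S])
    interpret interpolation_chart e pr \<sigma> \<mu> p m by unfold_locales (rule g)
    show "H \<in> (\<Union>(U, \<phi>)\<in>HK_atlas e S. U)"
      using H chart_in_HK_atlas S by blast
  qed (use dom in blast)
  have manifold: "smooth_manifold (*s) (HK_topology e S) (HK_atlas e S)"
    unfolding smooth_manifold_def
  proof (intro conjI)
    show "Hausdorff_space (HK_topology e S)"
      unfolding top by (simp add: Hausdorff_space_subtopology)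
    show "second_countable (HK_topology e S)"
      unfolding top by (rule second_countable_transfer_image[OF S])
    show "(\<Union>(U, \<phi>)\<in>HK_atlas e S. U) = topspace (HK_topology e S)" unfolding top using cover by simp
    show "\<forall>c\<in>HK_atlas e S. is_chart (HK_topology e S) c"
      by (auto simp: HK_atlas_def quotient_atlas_def HK_topology_def)
    show "\<forall>(U, \<phi>)\<in>HK_atlas e S. \<forall>(V, \<psi>)\<in>HK_atlas e S. smooth_on (*s) (*s) (\<phi> ` (U \<inter> V)) (\<psi> \<circ> inv_into U \<phi>)"
      using HK_transition_smooth[OF S] by blast
  qed
  have immersion: "smooth_immersion (*s) scale_e (HK_topology e S) (HK_atlas e S) E (\<lambda>x. x)"
    unfolding smooth_immersion_def
  proof (intro conjI)
    show "(\<lambda>x. x) ` topspace (HK_topology e S) \<subseteq> E" unfolding top using E(3) by simp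
    show "\<forall>(U, \<phi>)\<in>HK_atlas e S. smooth_on (*s) scale_e (\<phi> ` U) ((\<lambda>x. x) \<circ> inv_into U \<phi>) \<and>
        (\<forall>y\<in>\<phi> ` U. inj (differential ((\<lambda>x. x) \<circ> inv_into U \<phi>) y) \<and>
           closedin (top_of_set E) (range (differential ((\<lambda>x. x) \<circ> inv_into U \<phi>) y)))"
    proof (clarify, intro conjI ballI)
      fix U \<phi> assume c: "(U, \<phi>) \<in> HK_atlas e S"
      let ?k = "inv_into U \<phi>"
      have k: "(\<lambda>x. x) \<circ> ?k = ?k" by (simp add: o_def)
      note C = HK_chart_inverse_smooth[OF S c]
      show "smooth_on (*s) scale_e (\<phi> ` U) ((\<lambda>x. x) \<circ> ?k)" unfolding k by (rule C(1))
      fix y assume y: "y \<in> \<phi> ` U"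
      show "inj (differential ((\<lambda>x. x) \<circ> ?k) y)" unfolding k using C(2)[OF y] by blast
      have "?k ` \<phi> ` U \<subseteq> E" using dom[OF c] E(3) by (auto simp: inv_into_into subset_iff)
      hence "differential ?k y v \<in> E" for v
        using smooth_on_imp_differentiable[OF C(1) y] HK_atlasD(2)[OF S c] y E(1,2)
        by (intro derivative_in_closed_subspace[of ?k _ y "\<phi> ` U"]) (auto simp: frechet_derivative_works)
      thus "closedin (top_of_set E) (range (differential ((\<lambda>x. x) \<circ> ?k) y))"
        unfolding k using C(2)[OF y] by (intro closed_subset) auto
    qed
  qed
  have "homeomorphic_map (HK_topology e S) (top_of_set ((\<lambda>x. x) ` topspace (HK_topology e S))) (\<lambda>x. x)"
    using homeomorphic_map_id[of "top_of_set ?N" "top_of_set ?N"] by (simp add: top id_def)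
  with immersion manifold show ?thesis
    using E(3) top unfolding embedded_submanifold_def smooth_embedding_def by blast
qed

end

section \<open>The complex and the real case\<close>

interpretation complex_embedding: scalar_embedding "\<lambda>z. z" "\<lambda>z. z"
  by (simp add: scalar_embedding_def bounded_linear_ident)

interpretation real_embedding: scalar_embedding complex_of_real Re
  by (simp add: scalar_embedding_def bounded_linear_of_real bounded_linear_Re)

text \<open>Reality is a family of equations between point values, each of them closed because
  evaluation is bounded.\<close>

lemma closed_h2_real: "closed (h2_real :: ('m::finite, 'p::finite) h2 set)"
proof -
  have eq: "h2_real = {H :: ('m, 'p) h2. \<forall>s i j. 0 < Re s \<longrightarrow> cnj (h2_fun H s $ i $ j) = h2_fun H (cnj s) $ i $ j}"
    by (auto simp: h2_real_def vec_eq_iff)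
  have cl: "closed {H :: ('m, 'p) h2. 0 < Re s \<longrightarrow> cnj (h2_fun H s $ i $ j) = h2_fun H (cnj s) $ i $ j}" for s i j
    by (cases "0 < Re s")
      (auto intro!: closed_Collect_eq linear_continuous_on bounded_linear_h2_eval
        bounded_linear_compose[OF bounded_linear_cnj bounded_linear_h2_eval])
  show ?thesis unfolding eq by (intro closed_Collect_all cl)
qed

lemma subspace_h2_real: "subspace h2_real"
  by (auto simp: subspace_def h2_real_def vec_eq_iff)

text \<open>Conjugation is a field homomorphism that fixes a complexified real triple, so it carries
  the value of the transfer function at \<open>s\<close> to the value at
  \<open>cnj s\<close>.\<close>

lemma transfer_h2_real:
  assumes "hurwitz (fst (map_triple complex_of_real X))"
  shows "transfer_h2 complex_of_real X \<in> h2_real"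
  unfolding h2_real_def
proof (intro CollectI allI impI)
  fix s assume s: "0 < Re s"
  let ?Y = "map_triple complex_of_real X"
  have Y: "map_triple cnj ?Y = ?Y" by (simp add: map_triple_def case_prod_beta vec_eq_iff)
  have "tf (map_triple cnj ?Y) (cnj s) = map_matrix cnj (tf ?Y s)"
    by (rule cnj.tf_map_triple) (use hurwitz_imp_invertible[OF assms, of s] s in auto)
  thus "map_matrix cnj (h2_fun (transfer_h2 complex_of_real X) s) = h2_fun (transfer_h2 complex_of_real X) (cnj s)"
    using s assms unfolding Y by (simp add: h2_fun_transfer_h2 tf_eq_transfer_function)
qed

theorem theorem4p1:
  fixes S :: "(complex, 'r::finite, 'm::finite, 'p::finite) triple set"
    and S_R :: "(real, 'r, 'm, 'p) triple set"
  assumes S: "S = stable_minimal (\<lambda>z. z)"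
    and S_R: "S_R = stable_minimal complex_of_real"
  shows "(quotient_by state_space_equivalent S (transfer_h2 (\<lambda>z. z)) \<and>
          embedded_submanifold vector_scalar_mult scaleC_h2 UNIV
            (transfer_h2 (\<lambda>z. z) ` S) (HK_topology (\<lambda>z. z) S) (HK_atlas (\<lambda>z. z) S)) \<and>
         (quotient_by state_space_equivalent S_R (transfer_h2 complex_of_real) \<and>
          embedded_submanifold vector_scalar_mult scaleR h2_real
            (transfer_h2 complex_of_real ` S_R)
            (HK_topology complex_of_real S_R) (HK_atlas complex_of_real S_R))"
proof (intro conjI)
  show "quotient_by state_space_equivalent S (transfer_h2 (\<lambda>z. z))"
    unfolding quotient_by_def S using complex_embedding.transfer_h2_eq_iff by blast
  show "quotient_by state_space_equivalent S_R (transfer_h2 complex_of_real)"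
    unfolding quotient_by_def S_R using real_embedding.transfer_h2_eq_iff by blast
  show "embedded_submanifold vector_scalar_mult scaleC_h2 UNIV
      (transfer_h2 (\<lambda>z. z) ` S) (HK_topology (\<lambda>z. z) S) (HK_atlas (\<lambda>z. z) S)"
    by (rule complex_embedding.embedded_submanifold_transfer_image[OF S]) auto
  have "transfer_h2 complex_of_real ` S_R \<subseteq> h2_real"
    using transfer_h2_real real_embedding.stable_minimal_hurwitz unfolding S_R by blast
  moreover have "(\<lambda>c. scaleC_h2 (complex_of_real c)) = (scaleR :: real \<Rightarrow> ('m, 'p) h2 \<Rightarrow> ('m, 'p) h2)"
    by (simp add: fun_eq_iff scaleR_h2_def)
  ultimately show "embedded_submanifold vector_scalar_mult scaleR h2_real
      (transfer_h2 complex_of_real ` S_R) (HK_topology complex_of_real S_R) (HK_atlas complex_of_real S_R)"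
    using real_embedding.embedded_submanifold_transfer_image[OF S_R closed_h2_real subspace_h2_real] by simp
qed

end
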